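(* Let $Q=\mathbb{R}^+\times\mathbb{R}^+$, $g_1,g_2\in\mathcal{S}([0,\infty))$, $h_1\in C^\infty([0,\infty))$, and let $f_1,f_2\in C^\infty(\overline{Q})$ be such that for every $T>0$ and $j=1,2$, $$\sup\Big\{x^E\Big|\frac{\partial^{n+l}f_j(x,t)}{\partial x^n\partial t^l}\Big|:\ x>0,\ 0\le t\le T\Big\}<\infty\quad\text{for all nonnegative integers } n,l,E.$$ Assume in addition that $$h_1(0)=g_1(0)\quad\text{and}\quad h_1'(0)=-g_2'(0)+f_1(0,0),$$ and let $\Psi_1,\Psi_2$ be the functions defined in the context, extended to $C^1$ functions on $\overline{Q}\setminus\{(0,0)\}$. Then the limits $$\lim_{\substack{(x,t)\to(0,0)\\(x,t)\in\overline{Q}\setminus\{(0,0)\}}}\frac{\partial\Psi_j(x,t)}{\partial x}\quad\text{and}\quad\lim_{\substack{(x,t)\to(0,0)\\(x,t)\in\overline{Q}\setminus\{(0,0)\}}}\frac{\partial\Psi_j(x,t)}{\partial t},\qquad j=1,2,$$ exist, extending the derivatives $\dfrac{\partial\Psi_j}{\partial x}$ and $\dfrac{\partial\Psi_j}{\partial t}$ to continuous functions on $\overline{Q}$.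
   Context: Fix a real number $m\ge 0$. $\mathbb{R}^+=(0,\infty)$. $\mathcal{S}([0,\infty))$ is the space of (complex-valued) $C^\infty$ functions $g$ on $[0,\infty)$ with $\sup_{x\ge0}x^a|g^{(b)}(x)|<\infty$ for all nonnegative integers $a,b$. For $\lambda\in\mathbb{R}$: $\rho(\lambda)=\sqrt{\lambda^2+m^2}$ (nonnegative root), $\omega_1(\lambda)=i\rho(\lambda)$, $\omega_2(\lambda)=-i\rho(\lambda)$, $\hat g_j(\lambda)=\int_0^\infty e^{-i\lambda y}g_j(y)\,dy$ ($j=1,2$). For $x>0$, $t>0$, $x\ne t$ set $$\mathcal{G}_{1,1}=\int_{-\infty}^{\infty}e^{i\lambda x-\omega_1(\lambda)t}\{\lambda\hat g_2(\lambda)+[i\omega_2(\lambda)+m]\hat g_1(\lambda)\}\tfrac{d\lambda}{2\rho(\lambda)},\quad \mathcal{G}_{1,2}=\int_{-\infty}^{\infty}e^{i\lambda x-\omega_1(\lambda)t}\{\lambda\hat g_2(-\lambda)-[i\omega_2(\lambda)+m]\hat g_1(-\lambda)\}\tfrac{d\lambda}{2\rho(\lambda)},$$ $$\mathcal{G}_{1,3}=\int_{-\infty}^{\infty}e^{i\lambda x-\omega_2(\lambda)t}\{\lambda\hat g_2(\lambda)+[i\omega_1(\lambda)+m]\hat g_1(\lambda)\}\tfrac{d\lambda}{2\rho(\lambda)},\quad \mathcal{G}_{1,4}=\int_{-\infty}^{\infty}e^{i\lambda x-\omega_2(\lambda)t}\{\lambda\hat g_2(-\lambda)-[i\omega_1(\lambda)+m]\hat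 g_1(-\lambda)\}\tfrac{d\lambda}{2\rho(\lambda)},$$ $$\mathcal{G}_{2,1}=\int_{-\infty}^{\infty}e^{i\lambda x-\omega_1(\lambda)t}\{\lambda\hat g_1(\lambda)-[i\omega_1(\lambda)+m]\hat g_2(\lambda)\}\tfrac{d\lambda}{2\rho(\lambda)},\quad \mathcal{G}_{2,2}=\int_{-\infty}^{\infty}e^{i\lambda x-\omega_1(\lambda)t}\{\lambda\hat g_1(-\lambda)+[i\omega_1(\lambda)+m]\hat g_2(-\lambda)\}\tfrac{d\lambda}{2\rho(\lambda)},$$ $$\mathcal{G}_{2,3}=\int_{-\infty}^{\infty}e^{i\lambda x-\omega_2(\lambda)t}\{\lambda\hat g_1(\lambda)-[i\omega_2(\lambda)+m]\hat g_2(\lambda)\}\tfrac{d\lambda}{2\rho(\lambda)},\quad \mathcal{G}_{2,4}=\int_{-\infty}^{\infty}e^{i\lambda x-\omega_2(\lambda)t}\{\lambda\hat g_1(-\lambda)+[i\omega_2(\lambda)+m]\hat g_2(-\lambda)\}\tfrac{d\lambda}{2\rho(\lambda)},$$ and, for $s=1,2$, $$\mathcal{H}_{1,s}=\int_{-\infty}^{\infty}e^{i\lambda x-\omega_s(\lambda)t}\Big[\int_0^t h_1(\tau)e^{\omega_s(\lambda)\tau}d\tau\Big]\tfrac{\lambda\,d\lambda}{\rho(\lambda)},\quad \mathcal{H}_{2,s}=\int_{-\infty}^{\infty}e^{i\lambda x-\omega_s(\lambda)t}\Big[\int_0^t h_1(\tau)e^{\omega_s(\lambda)\tau}d\tau\Big]\tfrac{[i\omega_s(\lambda)+m]\,d\lambda}{\rho(\lambda)}.$$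 The $\mathcal{G}$- and $\mathcal{H}$-integrals are understood in the generalized sense $\lim_{A\to\infty}\int_0^A+\lim_{A\to\infty}\int_{-A}^0$. For $f\in\{f_1,f_2\}$, $\omega\in\{\omega_1,\omega_2\}$: $\hat f(\lambda,t)=\int_0^\infty e^{-i\lambda y}f(y,t)\,dy$ and $\tilde{\hat f}(\lambda,\omega,t)=\int_0^te^{\omega(\lambda)\tau}\hat f(\lambda,\tau)\,d\tau$; in $\tilde{\hat f}(-\lambda,\omega,t)$ one replaces $\hat f(\lambda,\tau)$ by $\hat f(-\lambda,\tau)$ (note $\omega(-\lambda)=\omega(\lambda)$). Set $$\mathcal{F}_{1,1}=\int_{-\infty}^\infty e^{i\lambda x-\omega_1(\lambda)t}\{\lambda\tilde{\hat f}_2(\lambda,\omega_1,t)+[i\omega_2(\lambda)+m]\tilde{\hat f}_1(\lambda,\omega_1,t)\}\tfrac{d\lambda}{2\rho(\lambda)}+\int_{-\infty}^\infty e^{i\lambda x-\omega_1(\lambda)t}\{\lambda\tilde{\hat f}_2(-\lambda,\omega_1,t)-[i\omega_2(\lambda)+m]\tilde{\hat f}_1(-\lambda,\omega_1,t)\}\tfrac{d\lambda}{2\rho(\lambda)},$$ $$\mathcal{F}_{1,2}=-\int_{-\infty}^\infty e^{i\lambda x-\omega_2(\lambda)t}\{\lambda\tilde{\hat f}_2(\lambda,\omega_2,t)+[i\omega_1(\lambda)+m]\tilde{\hat f}_1(\lambda,\omega_2,t)\}\tfrac{d\lambda}{2\rho(\lambda)}-\int_{-\infty}^\infty e^{i\lambda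 x-\omega_2(\lambda)t}\{\lambda\tilde{\hat f}_2(-\lambda,\omega_2,t)-[i\omega_1(\lambda)+m]\tilde{\hat f}_1(-\lambda,\omega_2,t)\}\tfrac{d\lambda}{2\rho(\lambda)},$$ $$\mathcal{F}_{2,1}=\int_{-\infty}^\infty e^{i\lambda x-\omega_1(\lambda)t}\{\lambda\tilde{\hat f}_1(\lambda,\omega_1,t)-[i\omega_1(\lambda)+m]\tilde{\hat f}_2(\lambda,\omega_1,t)\}\tfrac{d\lambda}{2\rho(\lambda)}-\int_{-\infty}^\infty e^{i\lambda x-\omega_1(\lambda)t}\{\lambda\tilde{\hat f}_1(-\lambda,\omega_1,t)+[i\omega_1(\lambda)+m]\tilde{\hat f}_2(-\lambda,\omega_1,t)\}\tfrac{d\lambda}{2\rho(\lambda)},$$ $$\mathcal{F}_{2,2}=-\int_{-\infty}^\infty e^{i\lambda x-\omega_2(\lambda)t}\{\lambda\tilde{\hat f}_1(\lambda,\omega_2,t)-[i\omega_2(\lambda)+m]\tilde{\hat f}_2(\lambda,\omega_2,t)\}\tfrac{d\lambda}{2\rho(\lambda)}+\int_{-\infty}^\infty e^{i\lambda x-\omega_2(\lambda)t}\{\lambda\tilde{\hat f}_1(-\lambda,\omega_2,t)+[i\omega_2(\lambda)+m]\tilde{\hat f}_2(-\lambda,\omega_2,t)\}\tfrac{d\lambda}{2\rho(\lambda)}.$$ For $x>0$, $t>0$, $x\ne t$, the functions $\Psi_1,\Psi_2$ are defined by $$2\pi\Psi_1=\mathcal{G}_{1,1}+\mathcal{G}_{1,2}-\mathcal{G}_{1,3}-\mathcal{G}_{1,4}+\mathcal{H}_{1,1}-\mathcal{H}_{1,2}+\mathcal{F}_{1,1}+\mathcal{F}_{1,2},$$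 $$2\pi\Psi_2=\mathcal{G}_{2,1}-\mathcal{G}_{2,2}-\mathcal{G}_{2,3}+\mathcal{G}_{2,4}-\mathcal{H}_{2,1}+\mathcal{H}_{2,2}+\mathcal{F}_{2,1}+\mathcal{F}_{2,2}.$$ According to the paper, under the two displayed compatibility conditions these functions extend to $C^1$ functions on $\overline{Q}\setminus\{(0,0)\}$ (across the diagonal $x=t>0$ and up to the open half-axes); the extensions are denoted by the same symbols.
   Formalization: The existence of the C^1 extensions of Psi_1, Psi_2 is taken as a hypothesis: it does not follow from the two stated conditions when m*g_1(0) is nonzero (matching at the corner needs the extra term -i*m*g_1(0) in h_1'(0)), so the claim covers exactly the data for which the extensions exist. *)

theory Defs
  imports "HOL-Analysis.Analysis"
begin

definition half_deriv :: "(real \<Rightarrow> complex) \<Rightarrow> real \<Rightarrow> complex" where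
  "half_deriv g x = vector_derivative g (at x within {0..})"

definition smooth_half :: "(real \<Rightarrow> complex) \<Rightarrow> bool" where
  "smooth_half g \<longleftrightarrow> (\<forall>k. \<forall>x\<ge>0. (half_deriv ^^ k) g differentiable (at x within {0..}))"

definition schwartz_half :: "(real \<Rightarrow> complex) set" where
  "schwartz_half = {g. smooth_half g \<and>
     (\<forall>a b. bdd_above ((\<lambda>x. x ^ a * norm ((half_deriv ^^ b) g x)) ` {0..}))}"

definition quadrant :: "(real \<times> real) set" where
  "quadrant = {0..} \<times> {0..}"

text \<open>Partial derivatives are taken along the slices of \<open>S\<close>; they are therefore one-sided at
  boundary points of \<open>S\<close>.\<close>

definition pdx :: "(real \<times> real) set \<Rightarrow> (real \<times> real \<Rightarrow> complex) \<Rightarrow> real \<times> real \<Rightarrow> complex" where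
  "pdx S F = (\<lambda>(x, t). vector_derivative (\<lambda>y. F (y, t)) (at x within {y. (y, t) \<in> S}))"

definition pdt :: "(real \<times> real) set \<Rightarrow> (real \<times> real \<Rightarrow> complex) \<Rightarrow> real \<times> real \<Rightarrow> complex" where
  "pdt S F = (\<lambda>(x, t). vector_derivative (\<lambda>s. F (x, s)) (at t within {s. (x, s) \<in> S}))"

primrec Ck_on :: "nat \<Rightarrow> (real \<times> real) set \<Rightarrow> (real \<times> real \<Rightarrow> complex) \<Rightarrow> bool" where
  "Ck_on 0 S F \<longleftrightarrow> continuous_on S F"
| "Ck_on (Suc k) S F \<longleftrightarrow> continuous_on S F \<and>
     (\<forall>(x, t)\<in>S. (\<lambda>y. F (y, t)) differentiable (at x within {y. (y, t) \<in> S}) \<and>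
                 (\<lambda>s. F (x, s)) differentiable (at t within {s. (x, s) \<in> S})) \<and>
     Ck_on k S (pdx S F) \<and> Ck_on k S (pdt S F)"

definition smooth_quadrant :: "(real \<times> real \<Rightarrow> complex) \<Rightarrow> bool" where
  "smooth_quadrant F \<longleftrightarrow> (\<forall>k. Ck_on k quadrant F)"

definition rapid_decay :: "(real \<times> real \<Rightarrow> complex) \<Rightarrow> bool" where
  "rapid_decay f \<longleftrightarrow> (\<forall>T>0. \<forall>n l E.
     bdd_above ((\<lambda>(x, t). x ^ E * norm ((pdx quadrant ^^ n) ((pdt quadrant ^^ l) f) (x, t)))
       ` ({0<..} \<times> {0..T})))"

definition rho :: "real \<Rightarrow> real \<Rightarrow> real" where
  "rho m l = sqrt (l\<^sup>2 + m\<^sup>2)"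

definition om1 :: "real \<Rightarrow> real \<Rightarrow> complex" where
  "om1 m l = \<i> * of_real (rho m l)"

definition om2 :: "real \<Rightarrow> real \<Rightarrow> complex" where
  "om2 m l = - \<i> * of_real (rho m l)"

definition hat :: "(real \<Rightarrow> complex) \<Rightarrow> real \<Rightarrow> complex" where
  "hat g l = integral {0..} (\<lambda>y. exp (- \<i> * of_real l * of_real y) * g y)"

text \<open>The frequency \<open>w\<close> is the value of \<open>om1 m\<close> or \<open>om2 m\<close> at \<open>l\<close>; both are even in \<open>l\<close>.\<close>

definition tilde_hat :: "(real \<times> real \<Rightarrow> complex) \<Rightarrow> real \<Rightarrow> complex \<Rightarrow> real \<Rightarrow> complex" where
  "tilde_hat f l w t = integral {0..t} (\<lambda>\<tau>. exp (w * of_real \<tau>) * hat (\<lambda>y. f (y, \<tau>)) l)"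

text \<open>The two halves of the line are allowed to converge only conditionally. For \<open>m = 0\<close> the
  integrands below divide by zero at the single point \<open>l = 0\<close>, which does not affect the
  integrals.\<close>

definition gen_integral :: "(real \<Rightarrow> complex) \<Rightarrow> complex" where
  "gen_integral F = Lim at_top (\<lambda>A. integral {0..A} F) + Lim at_top (\<lambda>A. integral {-A..0} F)"

definition wave :: "(real \<Rightarrow> complex) \<Rightarrow> real \<Rightarrow> real \<Rightarrow> real \<Rightarrow> complex" where
  "wave om x t l = exp (\<i> * of_real l * of_real x - om l * of_real t)"

definition G11 where
  "G11 m g1 g2 x t = gen_integral (\<lambda>l. wave (om1 m) x t l *
     (of_real l * hat g2 l + (\<i> * om2 m l + of_real m) * hat g1 l) / of_real (2 * rho m l))"

definition G12 where
  "G12 m g1 g2 x t = gen_integral (\<lambda>l. wave (om1 m) x t l *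
     (of_real l * hat g2 (-l) - (\<i> * om2 m l + of_real m) * hat g1 (-l)) / of_real (2 * rho m l))"

definition G13 where
  "G13 m g1 g2 x t = gen_integral (\<lambda>l. wave (om2 m) x t l *
     (of_real l * hat g2 l + (\<i> * om1 m l + of_real m) * hat g1 l) / of_real (2 * rho m l))"

definition G14 where
  "G14 m g1 g2 x t = gen_integral (\<lambda>l. wave (om2 m) x t l *
     (of_real l * hat g2 (-l) - (\<i> * om1 m l + of_real m) * hat g1 (-l)) / of_real (2 * rho m l))"

definition G21 where
  "G21 m g1 g2 x t = gen_integral (\<lambda>l. wave (om1 m) x t l *
     (of_real l * hat g1 l - (\<i> * om1 m l + of_real m) * hat g2 l) / of_real (2 * rho m l))"

definition G22 where
  "G22 m g1 g2 x t = gen_integral (\<lambda>l. wave (om1 m) x t l *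
     (of_real l * hat g1 (-l) + (\<i> * om1 m l + of_real m) * hat g2 (-l)) / of_real (2 * rho m l))"

definition G23 where
  "G23 m g1 g2 x t = gen_integral (\<lambda>l. wave (om2 m) x t l *
     (of_real l * hat g1 l - (\<i> * om2 m l + of_real m) * hat g2 l) / of_real (2 * rho m l))"

definition G24 where
  "G24 m g1 g2 x t = gen_integral (\<lambda>l. wave (om2 m) x t l *
     (of_real l * hat g1 (-l) + (\<i> * om2 m l + of_real m) * hat g2 (-l)) / of_real (2 * rho m l))"

definition H1 :: "real \<Rightarrow> (real \<Rightarrow> complex) \<Rightarrow> (real \<Rightarrow> complex) \<Rightarrow> real \<Rightarrow> real \<Rightarrow> complex" where
  "H1 m om h x t = gen_integral (\<lambda>l. wave om x t l *
     integral {0..t} (\<lambda>\<tau>. h \<tau> * exp (om l * of_real \<tau>)) * of_real l / of_real (rho m l))"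

definition H2 :: "real \<Rightarrow> (real \<Rightarrow> complex) \<Rightarrow> (real \<Rightarrow> complex) \<Rightarrow> real \<Rightarrow> real \<Rightarrow> complex" where
  "H2 m om h x t = gen_integral (\<lambda>l. wave om x t l *
     integral {0..t} (\<lambda>\<tau>. h \<tau> * exp (om l * of_real \<tau>)) *
     (\<i> * om l + of_real m) / of_real (rho m l))"

definition F11 where
  "F11 m f1 f2 x t =
     gen_integral (\<lambda>l. wave (om1 m) x t l *
       (of_real l * tilde_hat f2 l (om1 m l) t
        + (\<i> * om2 m l + of_real m) * tilde_hat f1 l (om1 m l) t) / of_real (2 * rho m l))
   + gen_integral (\<lambda>l. wave (om1 m) x t l *
       (of_real l * tilde_hat f2 (-l) (om1 m l) t
        - (\<i> * om2 m l + of_real m) * tilde_hat f1 (-l) (om1 m l) t) / of_real (2 * rho m l))"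

definition F12 where
  "F12 m f1 f2 x t =
   - gen_integral (\<lambda>l. wave (om2 m) x t l *
       (of_real l * tilde_hat f2 l (om2 m l) t
        + (\<i> * om1 m l + of_real m) * tilde_hat f1 l (om2 m l) t) / of_real (2 * rho m l))
   - gen_integral (\<lambda>l. wave (om2 m) x t l *
       (of_real l * tilde_hat f2 (-l) (om2 m l) t
        - (\<i> * om1 m l + of_real m) * tilde_hat f1 (-l) (om2 m l) t) / of_real (2 * rho m l))"

definition F21 where
  "F21 m f1 f2 x t =
     gen_integral (\<lambda>l. wave (om1 m) x t l *
       (of_real l * tilde_hat f1 l (om1 m l) t
        - (\<i> * om1 m l + of_real m) * tilde_hat f2 l (om1 m l) t) / of_real (2 * rho m l))
   - gen_integral (\<lambda>l. wave (om1 m) x t l *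
       (of_real l * tilde_hat f1 (-l) (om1 m l) t
        + (\<i> * om1 m l + of_real m) * tilde_hat f2 (-l) (om1 m l) t) / of_real (2 * rho m l))"

definition F22 where
  "F22 m f1 f2 x t =
   - gen_integral (\<lambda>l. wave (om2 m) x t l *
       (of_real l * tilde_hat f1 l (om2 m l) t
        - (\<i> * om2 m l + of_real m) * tilde_hat f2 l (om2 m l) t) / of_real (2 * rho m l))
   + gen_integral (\<lambda>l. wave (om2 m) x t l *
       (of_real l * tilde_hat f1 (-l) (om2 m l) t
        + (\<i> * om2 m l + of_real m) * tilde_hat f2 (-l) (om2 m l) t) / of_real (2 * rho m l))"

definition Psi1 where
  "Psi1 m g1 g2 h1 f1 f2 x t =
     (G11 m g1 g2 x t + G12 m g1 g2 x t - G13 m g1 g2 x t - G14 m g1 g2 x t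
      + H1 m (om1 m) h1 x t - H1 m (om2 m) h1 x t
      + F11 m f1 f2 x t + F12 m f1 f2 x t) / of_real (2 * pi)"

definition Psi2 where
  "Psi2 m g1 g2 h1 f1 f2 x t =
     (G21 m g1 g2 x t - G22 m g1 g2 x t - G23 m g1 g2 x t + G24 m g1 g2 x t
      - H2 m (om1 m) h1 x t + H2 m (om2 m) h1 x t
      + F21 m f1 f2 x t + F22 m f1 f2 x t) / of_real (2 * pi)"

text \<open>The formula \<open>P\<close> is meaningful only in the open quadrant off the diagonal. This set is dense in
  the punctured closed quadrant, so a continuous extension of \<open>P\<close> to the latter is unique there.\<close>

definition C1_extension :: "(real \<Rightarrow> real \<Rightarrow> complex) \<Rightarrow> (real \<times> real \<Rightarrow> complex) \<Rightarrow> bool" where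
  "C1_extension P \<Psi> \<longleftrightarrow> Ck_on 1 (quadrant - {(0, 0)}) \<Psi> \<and>
     (\<forall>x>0. \<forall>t>0. x \<noteq> t \<longrightarrow> \<Psi> (x, t) = P x t)"

end

theory Submission
  imports Defs "HOL-Probability.Sinc_Integral"
begin

text \<open>In the frequency variable \<open>l\<close> the formulas for \<open>\<Psi>1\<close> and \<open>\<Psi>2\<close> are Duhamel's formula for the system
\<open>B' = - \<i> H B + R\<close> for a pair \<open>B = (B1, B2)\<close>, with the Hermitian matrix \<open>H = [[m, l], [l, - m]]\<close>,
whose eigenvalues are \<open>\<plusminus> rho m l\<close>. The initial value is built from the odd part of the transform of
\<open>g1\<close> and the even part of that of \<open>g2\<close>; the source \<open>R\<close> is built in the same way from \<open>f1\<close> and \<open>f2\<close>,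
and the boundary value \<open>h1\<close> enters as an additional source \<open>2 h1\<close> in the second equation. Hence \<open>B1\<close>
is odd and \<open>B2\<close> is even in \<open>l\<close>, and off the diagonal \<open>2 pi \<Psi>1\<close> is the integral of \<open>2 \<i> sin (l x)
B1\<close>, and \<open>2 pi \<Psi>2\<close> that of \<open>2 cos (l x) B2\<close>, over \<open>l > 0\<close> (\<open>total_amplitude\<close>, \<open>half_line_limit\<close>). A
single one of the integrals in the definition can be logarithmically singular on the diagonal, so
only the sum can be analysed; but as each of them is defined as a limit, each must first be shown to
converge before they may be added (\<open>amplitude_line_conv\<close>, \<open>boundary_half_conv\<close>).

The regularity of \<open>\<Psi>\<close> is read off from the behaviour of \<open>B\<close> for large \<open>l\<close>. Matching powers of \<open>1 /
l\<close> in the differential equation gives a non-oscillating approximate solution with first component \<open>-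
2 \<i> h1 t / l\<close> and second component of order \<open>1 / l\<^sup>2\<close>. By \<open>h1 0 = g1 0\<close> it has the correct initial
value up to a vector of order \<open>1 / l\<^sup>2\<close>, which is propagated by the free evolution and contributes a
multiple of \<open>(- \<i> sin (l t), cos (l t)) / l\<^sup>2\<close>. What remains is of order \<open>1 / l ^ 3\<close>, with time
derivative of order \<open>1 / l\<^sup>2\<close> (\<open>high_frequency\<close>), so that its contribution to \<open>\<Psi>\<close> may be
differentiated under the integral (\<open>corner_C1_integral\<close>). The integrals of the explicit terms are
smooth functions of \<open>x\<close>, \<open>x + t\<close> and \<open>\<bar>x - t\<bar>\<close> for positive arguments, expressible by the sine
integral.

Consequently the first derivatives of \<open>\<Psi>\<close> have a limit at the origin within each of the regions \<open>t <
x\<close> and \<open>x < t\<close> (\<open>Psi_corner_C1\<close>). The derivatives of a \<open>C1\<close> extension are continuous across the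
diagonal, and the diagonal points close to the origin belong to the closures of both regions, so the
two limits coincide (\<open>limit_across_diagonal\<close>).\<close>

section \<open>Integrals depending on a parameter\<close>

text \<open>The points of a first countable space can be approached along sequences, which reduces the claim to
dominated convergence for sequences of gauge integrals.\<close>

lemma dominated_tendsto:
  fixes f :: "'a::first_countable_topology \<Rightarrow> real \<Rightarrow> complex"
  assumes int: "\<And>p. p \<in> S \<Longrightarrow> f p integrable_on K"
    and w: "w integrable_on K"
    and le: "\<And>p l. p \<in> S \<Longrightarrow> l \<in> K \<Longrightarrow> norm (f p l) \<le> w l"
    and lim: "\<And>l. l \<in> K \<Longrightarrow> ((\<lambda>p. f p l) \<longlongrightarrow> g l) (at z within S)"
  shows "((\<lambda>p. integral K (f p)) \<longlongrightarrow> integral K g) (at z within S)"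
  unfolding tendsto_at_iff_sequentially
proof (intro allI impI)
  fix X :: "nat \<Rightarrow> 'a" assume X: "\<forall>i. X i \<in> S - {z}" "X \<longlonglongrightarrow> z"
  have "(\<lambda>k. integral K (f (X k))) \<longlonglongrightarrow> integral K g"
  proof (rule dominated_convergence(2)[OF _ w])
    show "f (X k) integrable_on K" for k using X int by auto
    show "norm (f (X k) l) \<le> w l" if "l \<in> K" for k l using X le that by auto
    show "(\<lambda>k. f (X k) l) \<longlonglongrightarrow> g l" if "l \<in> K" for l
      using lim[OF that] X unfolding tendsto_at_iff_sequentially comp_def by blast
  qed
  then show "((\<lambda>p. integral K (f p)) \<circ> X) \<longlonglongrightarrow> integral K g"
    by (simp add: comp_def)
qed

lemma dominated_continuous_on:
  fixes f :: "'a::first_countable_topology \<Rightarrow> real \<Rightarrow> complex"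
  assumes "\<And>p. p \<in> S \<Longrightarrow> f p integrable_on K"
    and "w integrable_on K"
    and "\<And>p l. p \<in> S \<Longrightarrow> l \<in> K \<Longrightarrow> norm (f p l) \<le> w l"
    and "\<And>l. l \<in> K \<Longrightarrow> continuous_on S (\<lambda>p. f p l)"
  shows "continuous_on S (\<lambda>p. integral K (f p))"
  unfolding continuous_on_def
proof
  fix z assume "z \<in> S"
  then show "((\<lambda>p. integral K (f p)) \<longlongrightarrow> integral K (f z)) (at z within S)"
    using assms by (intro dominated_tendsto[where w = w]) (auto simp: continuous_on_def)
qed

lemma has_vector_derivative_iff_quotient:
  fixes f :: "real \<Rightarrow> 'a::real_normed_vector"
  shows "(f has_vector_derivative d) (at x within S) \<longleftrightarrow>
    ((\<lambda>y. (f y - f x) /\<^sub>R (y - x)) \<longlongrightarrow> d) (at x within S)"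
proof -
  have *: "norm (f y - f x - (y - x) *\<^sub>R d) / norm (y - x) = norm ((f y - f x) /\<^sub>R (y - x) - d)"
    if "y \<noteq> x" for y
  proof -
    have "(f y - f x) /\<^sub>R (y - x) - d = (f y - f x - (y - x) *\<^sub>R d) /\<^sub>R (y - x)"
      using that by (simp add: scaleR_diff_right)
    then show ?thesis by (simp add: divide_inverse)
  qed
  have "(f has_vector_derivative d) (at x within S) \<longleftrightarrow>
     ((\<lambda>y. norm (f y - f x - (y - x) *\<^sub>R d) / norm (y - x)) \<longlongrightarrow> 0) (at x within S)"
    unfolding has_vector_derivative_def has_derivative_iff_norm
    by (auto simp: bounded_linear_scaleR_left)
  also have "\<dots> \<longleftrightarrow> ((\<lambda>y. norm ((f y - f x) /\<^sub>R (y - x) - d)) \<longlongrightarrow> 0) (at x within S)"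
    by (rule tendsto_cong, unfold eventually_at_filter, intro always_eventually allI impI, erule * )
  also have "\<dots> \<longleftrightarrow> ((\<lambda>y. (f y - f x) /\<^sub>R (y - x)) \<longlongrightarrow> d) (at x within S)"
    unfolding tendsto_norm_zero_iff by (rule Lim_null[symmetric])
  finally show ?thesis .
qed

lemma of_real_has_vector_derivative:
  "(f has_real_derivative d) (at t within S) \<Longrightarrow> ((\<lambda>t. complex_of_real (f t)) has_vector_derivative of_real d) (at t
      within S)"
  by (simp add: has_real_derivative_iff_has_vector_derivative has_vector_derivative_of_real)

lemma cis_has_vector_derivative:
  "((\<lambda>t. cis (a * t)) has_vector_derivative \<i> * of_real a * cis (a * t)) (at t within S)"
  unfolding has_vector_derivative_def
  by (auto intro!: derivative_eq_intros simp: scaleR_conv_of_real algebra_simps)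

lemma norm_diff_le_derivative_bound:
  fixes f :: "real \<Rightarrow> complex"
  assumes "convex Y" "\<And>y. y \<in> Y \<Longrightarrow> (f has_vector_derivative f' y) (at y within Y)"
    "\<And>y. y \<in> Y \<Longrightarrow> norm (f' y) \<le> B" "a \<in> Y" "b \<in> Y"
  shows "norm (f b - f a) \<le> B * \<bar>b - a\<bar>"
  using differentiable_bound[of Y f "\<lambda>y h. h *\<^sub>R f' y" B b a] assms
  by (simp add: has_vector_derivative_def onorm_scaleR_left bounded_linear_ident onorm_id)

lemma norm_quotient_le:
  fixes a :: "'a::real_normed_vector"
  shows "norm a \<le> w * \<bar>d\<bar> \<Longrightarrow> d \<noteq> 0 \<Longrightarrow> norm (a /\<^sub>R d) \<le> w"
  by (simp add: field_simps)

text \<open>The mean value inequality bounds the difference quotients by the same function \<open>w\<close> that bounds the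
derivative, so they converge dominatedly. The set \<open>Y\<close> may be an interval with end points, where the
derivatives are one-sided.\<close>

lemma dominated_vector_derivative:
  fixes f :: "real \<Rightarrow> real \<Rightarrow> complex"
  assumes Y: "convex Y"
    and int: "\<And>y. y \<in> Y \<Longrightarrow> f y integrable_on K"
    and w: "w integrable_on K"
    and der: "\<And>y l. y \<in> Y \<Longrightarrow> l \<in> K \<Longrightarrow> ((\<lambda>y. f y l) has_vector_derivative f' y l) (at y within Y)"
    and le: "\<And>y l. y \<in> Y \<Longrightarrow> l \<in> K \<Longrightarrow> norm (f' y l) \<le> w l"
    and y: "y \<in> Y"
  shows "((\<lambda>y. integral K (f y)) has_vector_derivative integral K (f' y)) (at y within Y)"
  unfolding has_vector_derivative_iff_quotient
proof (rule Lim_transform_eventually)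
  show "((\<lambda>p. integral K (\<lambda>l. (f p l - f y l) /\<^sub>R (p - y))) \<longlongrightarrow> integral K (f' y)) (at y within Y)"
  proof (rule dominated_tendsto[OF _ w])
    show "(\<lambda>l. (f p l - f y l) /\<^sub>R (p - y)) integrable_on K" if "p \<in> Y" for p
      using int[OF that] int[OF y] by (intro integrable_cmul integrable_diff) auto
    show "norm ((f p l - f y l) /\<^sub>R (p - y)) \<le> w l" if "p \<in> Y" "l \<in> K" for p l
    proof (cases "p = y")
      case True then show ?thesis using order_trans[OF norm_ge_zero le[OF y that(2)]] by simp
    next
      case False
      have "norm (f p l - f y l) \<le> w l * \<bar>p - y\<bar>"
        by (rule norm_diff_le_derivative_bound[OF Y der[OF _ that(2)] le[OF _ that(2)] y that(1)])
      then show ?thesis using False by (intro norm_quotient_le) auto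
    qed
    show "((\<lambda>p. (f p l - f y l) /\<^sub>R (p - y)) \<longlongrightarrow> f' y l) (at y within Y)" if "l \<in> K" for l
      using der[OF y that] unfolding has_vector_derivative_iff_quotient .
  qed
  show "\<forall>\<^sub>F p in at y within Y. integral K (\<lambda>l. (f p l - f y l) /\<^sub>R (p - y))
      = (integral K (f p) - integral K (f y)) /\<^sub>R (p - y)"
    unfolding eventually_at_filter
    by (intro always_eventually allI impI, subst integral_cmul, subst integral_diff)
       (rule int, assumption, rule int[OF y], rule refl)
qed

text \<open>The derivative is a dominated limit of difference quotients along a sequence in \<open>Y\<close>, hence
measurable and integrable.\<close>

lemma dominated_derivative_integrable:
  fixes f :: "real \<Rightarrow> real \<Rightarrow> complex"
  assumes Y: "convex Y"
    and int: "\<And>y. y \<in> Y \<Longrightarrow> f y integrable_on K"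
    and w: "w integrable_on K"
    and der: "\<And>y l. y \<in> Y \<Longrightarrow> l \<in> K \<Longrightarrow> ((\<lambda>y. f y l) has_vector_derivative f' y l) (at y within Y)"
    and le: "\<And>y l. y \<in> Y \<Longrightarrow> l \<in> K \<Longrightarrow> norm (f' y l) \<le> w l"
    and y: "y \<in> Y" "y islimpt Y"
  shows "f' y integrable_on K"
proof -
  obtain X where X: "\<forall>i. X i \<in> Y - {y}" "X \<longlonglongrightarrow> y"
    using y(2) unfolding islimpt_sequential by blast
  show ?thesis
  proof (rule dominated_convergence(1)[OF _ w])
    fix k :: nat
    show "(\<lambda>l. (f (X k) l - f y l) /\<^sub>R (X k - y)) integrable_on K"
      using int[of "X k"] int[OF y(1)] X by (intro integrable_cmul integrable_diff) auto
    show "norm ((f (X k) l - f y l) /\<^sub>R (X k - y)) \<le> w l" if "l \<in> K" for l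
    proof -
      have "norm (f (X k) l - f y l) \<le> w l * \<bar>X k - y\<bar>"
        using X by (intro norm_diff_le_derivative_bound[OF Y der[OF _ that] le[OF _ that] y(1)]) auto
      moreover have "X k \<noteq> y" using X by auto
      ultimately show ?thesis by (intro norm_quotient_le) auto
    qed
  next
    fix l assume "l \<in> K"
    from der[OF y(1) this] X
    show "(\<lambda>k. (f (X k) l - f y l) /\<^sub>R (X k - y)) \<longlonglongrightarrow> f' y l"
      unfolding has_vector_derivative_iff_quotient tendsto_at_iff_sequentially comp_def by blast
  qed
qed

section \<open>Improper integrals\<close>

lemma integrable_on_continuous_bounded:
  fixes f :: "real \<Rightarrow> complex"
  assumes "continuous_on K f" "K \<in> sets lebesgue" "w integrable_on K" "\<And>l. l \<in> K \<Longrightarrow> norm (f l) \<le> w l"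
  shows "f integrable_on K"
  using assms continuous_imp_measurable_on_sets_lebesgue measurable_bounded_by_integrable_imp_integrable
  by blast

text \<open>An absolutely convergent integral over a half-line is also the improper one; this connects the
limits in \<^const>\<open>gen_integral\<close> with dominated convergence.\<close>

lemma integral_at_top_limit:
  fixes f :: "real \<Rightarrow> complex"
  assumes int: "\<And>A. f integrable_on {a..A}"
    and w: "w integrable_on {a..}"
    and le: "\<And>l. l \<ge> a \<Longrightarrow> norm (f l) \<le> w l"
  shows "f integrable_on {a..}" "((\<lambda>A. integral {a..A} f) \<longlongrightarrow> integral {a..} f) at_top"
proof -
  have eq: "integral {a..} (\<lambda>l. if l \<in> {a..A} then f l else 0) = integral {a..A} f"
       "(\<lambda>l. if l \<in> {a..A} then f l else 0) integrable_on {a..}" for A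
    using int[of A] integral_restrict_Int[of "{a..}" "{a..A}" f] integrable_restrict_Int[of "{a..A}" f "{a..}"]
    by (auto simp: Int_absorb1 Int_absorb2)
  have *: "f integrable_on {a..} \<and> (\<lambda>n. integral {a..X n} f) \<longlonglongrightarrow> integral {a..} f"
    if X: "filterlim X at_top sequentially" for X :: "nat \<Rightarrow> real"
  proof -
    have le': "norm (if l \<in> {a..X k} then f l else 0) \<le> w l" if "l \<in> {a..}" for k l
      using le[of l] that order_trans[OF norm_ge_zero[of "f l"] le[of l]] by auto
    have lim: "(\<lambda>k. if l \<in> {a..X k} then f l else 0) \<longlonglongrightarrow> f l" if "l \<in> {a..}" for l
    proof (rule tendsto_eventually)
      have "\<forall>\<^sub>F k in sequentially. l \<le> X k" using X unfolding filterlim_at_top by blast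
      then show "\<forall>\<^sub>F k in sequentially. (if l \<in> {a..X k} then f l else 0) = f l"
        by eventually_elim (use that in auto)
    qed
    show ?thesis
      using dominated_convergence[OF eq(2) w le' lim] unfolding eq(1) by blast
  qed
  show "f integrable_on {a..}"
    using *[OF filterlim_real_sequentially] by blast
  show "((\<lambda>A. integral {a..A} f) \<longlongrightarrow> integral {a..} f) at_top"
    by (rule tendsto_at_topI_sequentially) (use * in blast)
qed

lemma integrable_inverse_square: "(\<lambda>l::real. c / l\<^sup>2) integrable_on {1..}"
proof -
  have "(\<lambda>l::real. 1 / l\<^sup>2) integrable_on {1..}"
    using has_integral_inverse_power_to_inf[of 2 1] by (auto simp: integrable_on_def)
  from integrable_cmul[OF this, of c] show ?thesis by simp
qed

lemma has_integral_inverse_square_shift: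
  "((\<lambda>y::real. c / (1 + y)\<^sup>2) has_integral c) {0..}"
proof -
  have *: "((\<lambda>y::real. 1 / (1 + y)\<^sup>2) has_integral (1 - 1 / (1 + A))) {0..A}" if "A \<ge> 0" for A
  proof -
    have "((\<lambda>y::real. 1 / (1 + y)\<^sup>2) has_integral (- (1 / (1 + A)) - (- (1 / (1 + 0))))) {0..A}"
    proof (rule fundamental_theorem_of_calculus[OF that])
      show "((\<lambda>y. - (1 / (1 + y))) has_vector_derivative 1 / (1 + y)\<^sup>2) (at y within {0..A})"
        if "y \<in> {0..A}" for y
        unfolding has_real_derivative_iff_has_vector_derivative[symmetric]
        using that by (auto intro!: derivative_eq_intros simp: power2_eq_square)
    qed
    then show ?thesis by simp
  qed
  have "((\<lambda>y::real. 1 / (1 + y)\<^sup>2) has_integral 1) {0..}"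
  proof (rule has_integral_to_inf)
    show "(\<lambda>y::real. 1 / (1 + y)\<^sup>2) integrable_on {0..A}" for A
      using *[of A] by (cases "A \<ge> 0") (auto simp: integrable_on_def integrable_on_empty)
    have "((\<lambda>A::real. 1 - 1 / (1 + A)) \<longlongrightarrow> 1 - 0) at_top"
      by (intro tendsto_intros tendsto_divide_0[OF tendsto_const] filterlim_at_top_imp_at_infinity
            filterlim_tendsto_add_at_top[OF tendsto_const] filterlim_ident)
    then have "((\<lambda>A::real. 1 - 1 / (1 + A)) \<longlongrightarrow> 1) at_top" by simp
    then show "((\<lambda>A. integral {0..A} (\<lambda>y::real. 1 / (1 + y)\<^sup>2)) \<longlongrightarrow> 1) at_top"
    proof (rule Lim_transform_eventually)
      show "\<forall>\<^sub>F A in at_top. 1 - 1 / (1 + A) = integral {0..A} (\<lambda>y::real. 1 / (1 + y)\<^sup>2)"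
        using eventually_ge_at_top[of 0] by eventually_elim (metis * integral_unique)
    qed
  qed auto
  from has_integral_mult_right[OF this, of c] show ?thesis by simp
qed

section \<open>Half-line Fourier transforms\<close>

lemma norm_fourier_kernel [simp]: "norm (exp (- \<i> * complex_of_real l * complex_of_real y)) = 1"
  using norm_exp_i_times[of "- l * y"] by (simp add: mult.assoc)

text \<open>The sequence \<open>d\<close> lists a function on the half-line and its successive derivatives. The bound \<open>3\<close> is
the number of integrations by parts in \<open>hat_expansion\<close>; the constant \<open>C\<close> is a parameter so that
estimates for the sources can be uniform in time.\<close>

definition decaying_derivs :: "real \<Rightarrow> (nat \<Rightarrow> real \<Rightarrow> complex) \<Rightarrow> bool" where
  "decaying_derivs C d \<longleftrightarrow>
     (\<forall>n. \<forall>y\<ge>0. (d n has_vector_derivative d (Suc n) y) (at y within {0..})) \<and>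
     (\<forall>n\<le>3. \<forall>y\<ge>0. norm (d n y) \<le> C / (1 + y)\<^sup>2)"

lemma decaying_derivs_continuous: "decaying_derivs C d \<Longrightarrow> continuous_on {0..} (d n)"
  unfolding decaying_derivs_def
  by (intro continuous_on_vector_derivative[of _ "d n" "d (Suc n)"]) auto

lemma integrable_inverse_square_decay: "(\<lambda>y::real. C / (1 + y)\<^sup>2) integrable_on {0..}"
  using has_integral_inverse_square_shift[of C] by (auto simp: integrable_on_def)

lemma hat_integrable:
  assumes "continuous_on {0..} g" "\<And>y. y \<ge> 0 \<Longrightarrow> norm (g y) \<le> C / (1 + y)\<^sup>2"
  shows "(\<lambda>y. exp (- \<i> * of_real l * of_real y) * g y) integrable_on {0..}"
  by (rule integrable_on_continuous_bounded[OF _ _ integrable_inverse_square_decay[of C]])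
     (use assms in \<open>auto intro!: continuous_intros simp: norm_mult\<close>)

lemma norm_hat_le:
  assumes "continuous_on {0..} g" "\<And>y. y \<ge> 0 \<Longrightarrow> norm (g y) \<le> C / (1 + y)\<^sup>2"
  shows "norm (hat g l) \<le> C"
proof -
  have "norm (hat g l) \<le> integral {0..} (\<lambda>y. C / (1 + y)\<^sup>2)"
    unfolding hat_def
    by (rule integral_norm_bound_integral[OF hat_integrable[OF assms] integrable_inverse_square_decay])
       (use assms in \<open>auto simp: norm_mult\<close>)
  then show ?thesis using has_integral_inverse_square_shift[of C] by (simp add: integral_unique)
qed

lemma decay_tendsto_0:
  assumes "\<And>y. y \<ge> 0 \<Longrightarrow> norm (g y) \<le> C / (1 + y)\<^sup>2"
  shows "((g :: real \<Rightarrow> complex) \<longlongrightarrow> 0) at_top"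
proof (rule Lim_null_comparison)
  show "\<forall>\<^sub>F y in at_top. norm (g y) \<le> C / (1 + y)\<^sup>2"
    using eventually_ge_at_top[of 0] by eventually_elim (rule assms)
  show "((\<lambda>y. C / (1 + y)\<^sup>2) \<longlongrightarrow> 0) at_top"
    by (intro tendsto_divide_0[OF tendsto_const] filterlim_at_top_imp_at_infinity
          filterlim_pow_at_top filterlim_tendsto_add_at_top[OF tendsto_const] filterlim_ident) auto
qed

text \<open>Integration by parts over \<open>{0..A}\<close>, where the boundary term at \<open>A\<close> vanishes in the limit.\<close>

lemma hat_by_parts:
  assumes der: "\<And>y. y \<ge> 0 \<Longrightarrow> (g has_vector_derivative g' y) (at y within {0..})"
    and g: "\<And>y. y \<ge> 0 \<Longrightarrow> norm (g y) \<le> C / (1 + y)\<^sup>2"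
    and g': "continuous_on {0..} g'" "\<And>y. y \<ge> 0 \<Longrightarrow> norm (g' y) \<le> C / (1 + y)\<^sup>2"
  shows "\<i> * of_real l * hat g l = g 0 + hat g' l"
proof -
  have cont: "continuous_on {0..} g"
    by (rule continuous_on_vector_derivative) (use der in auto)
  let ?e = "\<lambda>y. exp (- \<i> * complex_of_real l * complex_of_real y)"
  let ?F = "\<lambda>y. ?e y * g' y - \<i> * of_real l * (?e y * g y)"
  have intF: "?F integrable_on {0..}"
    by (intro integrable_diff integrable_on_mult_right hat_integrable[OF g'] hat_integrable[OF cont g])
  have val: "integral {0..} ?F = hat g' l - \<i> * of_real l * hat g l"
    unfolding hat_def
    using integral_diff[OF hat_integrable[OF g'] integrable_on_mult_right[OF hat_integrable[OF cont g]]]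
    by simp
  have ftc: "(?F has_integral (?e A * g A - ?e 0 * g 0)) {0..A}" if "A \<ge> 0" for A
  proof (rule fundamental_theorem_of_calculus[OF that])
    fix y assume y: "y \<in> {0..A}"
    have "(g has_vector_derivative g' y) (at y within {0..A})"
      by (rule has_vector_derivative_within_subset[OF der]) (use y in auto)
    moreover have "(?e has_vector_derivative (- \<i> * of_real l) * ?e y) (at y within {0..A})"
      by (auto intro!: derivative_eq_intros has_vector_derivative_real_field)
    ultimately have "((\<lambda>y. ?e y * g y) has_vector_derivative
        (?e y * g' y + (- \<i> * of_real l) * ?e y * g y)) (at y within {0..A})"
      by (rule has_vector_derivative_mult[rotated])
    then show "((\<lambda>y. ?e y * g y) has_vector_derivative ?F y) (at y within {0..A})"
      by (simp add: algebra_simps)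
  qed
  have "((\<lambda>A. integral {0..A} ?F) \<longlongrightarrow> integral {0..} ?F) at_top"
  proof (rule integral_at_top_limit(2))
    show "?F integrable_on {0..A}" for A
      using ftc[of A] by (cases "A \<ge> 0") (auto simp: integrable_on_def integrable_on_empty)
    show "(\<lambda>y. C / (1 + y)\<^sup>2 + \<bar>l\<bar> * (C / (1 + y)\<^sup>2)) integrable_on {0..}"
      by (intro integrable_add integrable_on_mult_right integrable_inverse_square_decay)
    fix y :: real assume y: "y \<ge> 0"
    have "norm (?F y) \<le> norm (?e y * g' y) + norm (\<i> * of_real l * (?e y * g y))"
      by (rule norm_triangle_ineq4)
    also have "\<dots> = norm (g' y) + \<bar>l\<bar> * norm (g y)" by (simp add: norm_mult)
    also have "\<dots> \<le> C / (1 + y)\<^sup>2 + \<bar>l\<bar> * (C / (1 + y)\<^sup>2)"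
      using g g' y by (intro add_mono mult_left_mono) auto
    finally show "norm (?F y) \<le> C / (1 + y)\<^sup>2 + \<bar>l\<bar> * (C / (1 + y)\<^sup>2)" .
  qed
  moreover have "((\<lambda>A. integral {0..A} ?F) \<longlongrightarrow> - g 0) at_top"
  proof (rule Lim_transform_eventually)
    have "((\<lambda>A. ?e A * g A) \<longlongrightarrow> 0) at_top"
      using decay_tendsto_0[OF g] by (subst tendsto_norm_zero_iff[symmetric])
        (simp only: norm_mult norm_fourier_kernel mult_1_left tendsto_norm_zero_iff)
    then have "((\<lambda>A. ?e A * g A - g 0) \<longlongrightarrow> 0 - g 0) at_top" by (intro tendsto_intros)
    then show "((\<lambda>A. ?e A * g A - g 0) \<longlongrightarrow> - g 0) at_top" by simp
    show "\<forall>\<^sub>F A in at_top. ?e A * g A - g 0 = integral {0..A} ?F"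
      using eventually_ge_at_top[of 0]
      by eventually_elim (use integral_unique[OF ftc] in auto)
  qed
  ultimately have "integral {0..} ?F = - g 0"
    by (rule tendsto_unique[rotated]) simp
  then show ?thesis using val by (simp add: algebra_simps) 
qed

text \<open>Each integration by parts gains a factor \<open>1 / l\<close> and leaves a boundary term at \<open>0\<close>: the transform of
a function on the half-line decays only as fast as its value and derivatives at \<open>0\<close> permit.\<close>

lemma hat_expansion:
  assumes d: "decaying_derivs C d" and l: "l \<noteq> 0"
  shows "norm (hat (d 0) l - d 0 0 / (\<i> * of_real l)) \<le> 2 * C / l\<^sup>2"
    and "norm (hat (d 0) l - (d 0 0 / (\<i> * of_real l) + d 1 0 / (\<i> * of_real l)\<^sup>2)) \<le> 2 * C / \<bar>l\<bar> ^ 3"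
proof -
  define z where "z = \<i> * complex_of_real l"
  have z: "z \<noteq> 0" "norm z = \<bar>l\<bar>" using l by (auto simp: z_def norm_mult)
  have parts: "z * hat (d n) l = d n 0 + hat (d (Suc n)) l" if "n \<le> 2" for n
    unfolding z_def
    by (rule hat_by_parts[of _ _ C]) (use d that decaying_derivs_continuous[OF d] in \<open>auto simp: decaying_derivs_def\<close>)
  have bd: "norm (d n 0 + hat (d (Suc n)) l) \<le> 2 * C" if "n \<le> 2" for n
  proof -
    have "norm (d n 0) \<le> C / (1 + 0)\<^sup>2" using d that unfolding decaying_derivs_def
      by (metis le_Suc_eq numeral_2_eq_2 numeral_3_eq_3 order_refl)
    moreover have "norm (hat (d (Suc n)) l) \<le> C"
      by (rule norm_hat_le) (use d that decaying_derivs_continuous[OF d] in \<open>auto simp: decaying_derivs_def\<close>)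
    ultimately show ?thesis by (intro order_trans[OF norm_triangle_ineq]) simp
  qed
  have step: "hat (d n) l = (d n 0 + hat (d (Suc n)) l) / z" if "n \<le> 2" for n
    using parts[OF that] z(1) by (metis nonzero_mult_div_cancel_left)
  have 1: "hat (d 0) l = (d 0 0 + (d 1 0 + hat (d 2) l) / z) / z"
    using step[of 0] step[of 1] by (simp add: numeral_2_eq_2)
  have 0: "hat (d 0) l = (d 0 0 + (d 1 0 + (d 2 0 + hat (d 3) l) / z) / z) / z"
    unfolding 1 using step[of 2] by (simp add: numeral_2_eq_2 numeral_3_eq_3)
  have "hat (d 0) l - d 0 0 / z = (d 1 0 + hat (d 2) l) / z\<^sup>2"
    unfolding 1 using z by (simp add: field_simps power2_eq_square)
  then show "norm (hat (d 0) l - d 0 0 / (\<i> * of_real l)) \<le> 2 * C / l\<^sup>2"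
    using divide_right_mono[OF bd[of 1], of "l\<^sup>2"] z
    by (simp add: z_def[symmetric] norm_divide norm_power numeral_2_eq_2[symmetric])
  have bd2: "norm (d 2 0 + hat (d 3) l) \<le> 2 * C"
    using bd[of 2] by (simp add: numeral_2_eq_2 numeral_3_eq_3)
  have "hat (d 0) l - (d 0 0 / z + d 1 0 / z\<^sup>2) = (d 2 0 + hat (d 3) l) / z ^ 3"
    unfolding 0 using z by (simp add: field_simps power2_eq_square power3_eq_cube)
  then show "norm (hat (d 0) l - (d 0 0 / (\<i> * of_real l) + d 1 0 / (\<i> * of_real l)\<^sup>2)) \<le> 2 * C / \<bar>l\<bar> ^ 3"
    using divide_right_mono[OF bd2, of "\<bar>l\<bar> ^ 3"] z
    by (simp add: z_def[symmetric] norm_divide norm_power)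
qed

lemma hat_continuous_on:
  assumes cont: "continuous_on (S \<times> {0..}) (\<lambda>(p, y). f p y)"
    and le: "\<And>p y. p \<in> S \<Longrightarrow> y \<ge> 0 \<Longrightarrow> norm (f p y) \<le> C / (1 + y)\<^sup>2"
  shows "continuous_on (UNIV \<times> S) (\<lambda>(l, p :: 'a :: first_countable_topology). hat (f p) l)"
  unfolding hat_def split_def
proof (rule dominated_continuous_on[OF _ integrable_inverse_square_decay[of C]])
  show "(\<lambda>y. exp (- \<i> * of_real (fst q) * of_real y) * f (snd q) y) integrable_on {0..}"
    if "q \<in> UNIV \<times> S" for q
  proof (rule hat_integrable)
    show "continuous_on {0..} (f (snd q))"
      using continuous_on_compose2[OF cont, of "{0..}" "\<lambda>y. (snd q, y)"] that
      by (force intro: continuous_intros)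
  qed (use le that in auto)
  show "norm (exp (- \<i> * of_real (fst q) * of_real y) * f (snd q) y) \<le> C / (1 + y)\<^sup>2"
    if "q \<in> UNIV \<times> S" "y \<in> {0..}" for q y
    using le that by (auto simp: norm_mult)
  show "continuous_on (UNIV \<times> S) (\<lambda>q. exp (- \<i> * of_real (fst q) * of_real y) * f (snd q) y)"
    if "y \<in> {0..}" for y
    by (intro continuous_intros continuous_on_compose2[OF cont, of _ "\<lambda>q. (snd q, y)", simplified])
       (use that in auto)
qed

section \<open>Convergence of the frequency integrals\<close>

text \<open>The Landau class \<open>O(1 / l ^ k)\<close>, with an estimate on all of \<open>l \<ge> 1\<close> instead of near infinity, as the
integrals are split at \<open>1\<close>.\<close>

definition inv_power_bound :: "nat \<Rightarrow> (real \<Rightarrow> complex) \<Rightarrow> bool" where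
  "inv_power_bound k f \<longleftrightarrow> (\<exists>C. \<forall>l\<ge>1. norm (f l) \<le> C / l ^ k)"

lemma inv_power_boundI: "(\<And>l. l \<ge> 1 \<Longrightarrow> norm (f l) \<le> C / l ^ k) \<Longrightarrow> inv_power_bound k f"
  unfolding inv_power_bound_def by blast

lemma inv_power_bound_add:
  assumes "inv_power_bound k f" "inv_power_bound k g"
  shows "inv_power_bound k (\<lambda>l. f l + g l)"
proof -
  obtain C D where "\<And>l. l \<ge> 1 \<Longrightarrow> norm (f l) \<le> C / l ^ k" "\<And>l. l \<ge> 1 \<Longrightarrow> norm (g l) \<le> D / l ^ k"
    using assms unfolding inv_power_bound_def by blast
  then show ?thesis
    by (intro inv_power_boundI[of _ "C + D"]) (simp add: add_divide_distrib norm_triangle_mono)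
qed

lemma inv_power_bound_mult:
  assumes "inv_power_bound j f" "inv_power_bound k g"
  shows "inv_power_bound (j + k) (\<lambda>l. f l * g l)"
proof -
  obtain C D where *: "\<And>l. l \<ge> 1 \<Longrightarrow> norm (f l) \<le> C / l ^ j" "\<And>l. l \<ge> 1 \<Longrightarrow> norm (g l) \<le> D / l ^ k"
    using assms unfolding inv_power_bound_def by blast
  show ?thesis
  proof (rule inv_power_boundI[of _ "C * D"])
    fix l :: real assume l: "l \<ge> 1"
    have "norm (f l * g l) \<le> (C / l ^ j) * (D / l ^ k)"
      unfolding norm_mult using *[OF l] order_trans[OF norm_ge_zero *(1)[OF l]] by (intro mult_mono) auto
    then show "norm (f l * g l) \<le> C * D / l ^ (j + k)" by (simp add: power_add)
  qed
qed

lemma inv_power_bound_mult_1_1: "inv_power_bound 1 f \<Longrightarrow> inv_power_bound 1 g \<Longrightarrow> inv_power_bound 2 (\<lambda>l. f l * g l)"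
  and inv_power_bound_mult_0: "inv_power_bound 0 f \<Longrightarrow> inv_power_bound k g \<Longrightarrow> inv_power_bound k (\<lambda>l. f l * g l)"
  using inv_power_bound_mult[of 1 f 1 g] inv_power_bound_mult[of 0 f k g] by (simp_all add: numeral_2_eq_2)

lemma inv_power_bound_mono:
  assumes "inv_power_bound j f" "k \<le> j"
  shows "inv_power_bound k f"
proof -
  obtain C where *: "\<And>l. l \<ge> 1 \<Longrightarrow> norm (f l) \<le> C / l ^ j"
    using assms unfolding inv_power_bound_def by blast
  have "norm (f 1) \<le> C / 1 ^ j" by (rule *) simp
  then have C: "C \<ge> 0" using order_trans[OF norm_ge_zero] by simp
  show ?thesis
  proof (rule inv_power_boundI[of _ C])
    fix l :: real assume l: "l \<ge> 1"
    have "C / l ^ j \<le> C / l ^ k"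
      using l C assms(2) by (intro divide_left_mono power_increasing) auto
    then show "norm (f l) \<le> C / l ^ k" using *[OF l] by linarith
  qed
qed

lemma inv_power_bound_const: "inv_power_bound 0 (\<lambda>l. c)"
  by (rule inv_power_boundI[of _ "norm c"]) simp

lemma inv_power_bound_cmult: "inv_power_bound k f \<Longrightarrow> inv_power_bound k (\<lambda>l. c * f l)"
  using inv_power_bound_mult[OF inv_power_bound_const, of k f c] by simp

lemma inv_power_bound_diff:
  "inv_power_bound k f \<Longrightarrow> inv_power_bound k g \<Longrightarrow> inv_power_bound k (\<lambda>l. f l - g l)"
  using inv_power_bound_add[of k f "\<lambda>l. (-1) * g l"] inv_power_bound_cmult[of k g "-1"] by simp

lemma inv_power_bound_transfer:
  assumes "inv_power_bound k f" "\<And>l. l \<ge> 1 \<Longrightarrow> f l = g l"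
  shows "inv_power_bound k g"
  using assms unfolding inv_power_bound_def by simp

lemma inv_power_bound_inverse: "inv_power_bound 1 (\<lambda>l. c / of_real l)"
  by (rule inv_power_boundI[of _ "norm c"]) (simp add: norm_divide)

text \<open>Convergence of one half of \<^const>\<open>gen_integral\<close>. Local integrability is included because integrals of
sums are split below.\<close>

definition half_conv :: "(real \<Rightarrow> complex) \<Rightarrow> bool" where
  "half_conv F \<longleftrightarrow> (\<forall>A. F integrable_on {0..A}) \<and> (\<exists>L. ((\<lambda>A. integral {0..A} F) \<longlongrightarrow> L) at_top)"

definition line_conv :: "(real \<Rightarrow> complex) \<Rightarrow> bool" where
  "line_conv F \<longleftrightarrow> half_conv F \<and> half_conv (\<lambda>l. F (- l))"

lemma half_conv_lincomb:
  assumes "half_conv F" "half_conv G"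
  shows "half_conv (\<lambda>l. a * F l + b * G l)"
proof -
  obtain L M where L: "((\<lambda>A. integral {0..A} F) \<longlongrightarrow> L) at_top" "((\<lambda>A. integral {0..A} G) \<longlongrightarrow> M) at_top"
    using assms unfolding half_conv_def by blast
  have int: "F integrable_on {0..A}" "G integrable_on {0..A}" for A
    using assms unfolding half_conv_def by auto
  have "integral {0..A} (\<lambda>l. a * F l + b * G l) = a * integral {0..A} F + b * integral {0..A} G" for A
    by (simp add: int integral_add integrable_on_mult_right)
  then have "((\<lambda>A. integral {0..A} (\<lambda>l. a * F l + b * G l)) \<longlongrightarrow> a * L + b * M) at_top"
    by (simp add: tendsto_intros L)
  then show ?thesis
    unfolding half_conv_def using int by (auto intro!: integrable_add integrable_on_mult_right)
qed

text \<open>Folding the line onto the half-line: the two limits in the definition of \<^const>\<open>gen_integral\<close> combine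
into one.\<close>

lemma gen_integral_tendsto:
  assumes "line_conv F"
  shows "((\<lambda>A. integral {0..A} (\<lambda>l. F l + F (- l))) \<longlongrightarrow> gen_integral F) at_top"
proof -
  obtain L M where L: "((\<lambda>A. integral {0..A} F) \<longlongrightarrow> L) at_top"
      and M: "((\<lambda>A. integral {0..A} (\<lambda>l. F (- l))) \<longlongrightarrow> M) at_top"
    using assms unfolding half_conv_def line_conv_def by blast
  have refl: "integral {-A..0} F = integral {0..A} (\<lambda>l. F (- l))" for A
    using Henstock_Kurzweil_Integration.integral_reflect_real[of A 0 "\<lambda>l. F (- l)"] by simp
  have "gen_integral F = L + M"
    unfolding gen_integral_def refl using L M by (simp add: tendsto_Lim)
  moreover have "integral {0..A} (\<lambda>l. F l + F (- l)) = integral {0..A} F + integral {0..A} (\<lambda>l. F (- l))" for A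
    using assms by (intro integral_add) (auto simp: half_conv_def line_conv_def)
  ultimately show ?thesis using tendsto_add[OF L M] by simp
qed

lemma line_conv_lincomb:
  assumes "line_conv F" "line_conv G"
  shows "line_conv (\<lambda>l. a * F l + b * G l)"
  using assms half_conv_lincomb unfolding line_conv_def by blast

lemma gen_integral_lincomb:
  assumes F: "line_conv F" and G: "line_conv G"
  shows "gen_integral (\<lambda>l. a * F l + b * G l) = a * gen_integral F + b * gen_integral G"
proof (rule tendsto_unique)
  have int: "(\<lambda>l. F l + F (- l)) integrable_on {0..A}" "(\<lambda>l. G l + G (- l)) integrable_on {0..A}" for A
    using assms by (auto intro!: integrable_add simp: half_conv_def line_conv_def)
  have "integral {0..A} (\<lambda>l. (a * F l + b * G l) + (a * F (- l) + b * G (- l))) =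
      a * integral {0..A} (\<lambda>l. F l + F (- l)) + b * integral {0..A} (\<lambda>l. G l + G (- l))" for A
  proof -
    have "(\<lambda>l. (a * F l + b * G l) + (a * F (- l) + b * G (- l))) =
      (\<lambda>l. a * (F l + F (- l)) + b * (G l + G (- l)))" by (auto simp: algebra_simps)
    then show ?thesis by (simp only: integral_add int integrable_on_mult_right integral_mult_right)
  qed
  then show "((\<lambda>A. integral {0..A} (\<lambda>l. (a * F l + b * G l) + (a * F (- l) + b * G (- l)))) \<longlongrightarrow>
     a * gen_integral F + b * gen_integral G) at_top"
    using gen_integral_tendsto[OF F] gen_integral_tendsto[OF G] by (simp only: tendsto_intros)
  show "((\<lambda>A. integral {0..A} (\<lambda>l. (a * F l + b * G l) + (a * F (- l) + b * G (- l)))) \<longlongrightarrow>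
     gen_integral (\<lambda>l. a * F l + b * G l)) at_top"
    using gen_integral_tendsto[OF line_conv_lincomb[OF assms]] .
qed simp

lemma line_conv_add: "line_conv F \<Longrightarrow> line_conv G \<Longrightarrow> line_conv (\<lambda>l. F l + G l)"
  and line_conv_diff: "line_conv F \<Longrightarrow> line_conv G \<Longrightarrow> line_conv (\<lambda>l. F l - G l)"
  and gen_integral_add: "line_conv F \<Longrightarrow> line_conv G \<Longrightarrow> gen_integral (\<lambda>l. F l + G l) = gen_integral F + gen_integral G"
  and gen_integral_diff: "line_conv F \<Longrightarrow> line_conv G \<Longrightarrow> gen_integral (\<lambda>l. F l - G l) = gen_integral F - gen_integral G"
  using line_conv_lincomb[of F G 1 1] line_conv_lincomb[of F G 1 "-1"]
    gen_integral_lincomb[of F G 1 1] gen_integral_lincomb[of F G 1 "-1"] by auto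

lemma integrable_on_0_A:
  fixes F :: "real \<Rightarrow> complex"
  assumes "continuous_on {0<..} F" "\<And>l. 0 < l \<Longrightarrow> l \<le> A \<Longrightarrow> norm (F l) \<le> K"
  shows "F integrable_on {0..A}"
proof -
  have "F integrable_on {0<..<A}"
  proof (rule integrable_on_continuous_bounded[where w = "\<lambda>_. K"])
    show "(\<lambda>_. K) integrable_on {0<..<A}"
      using integrable_const_ivl[of K 0 A] by (simp add: integrable_on_open_interval_real)
    show "continuous_on {0<..<A} F" by (rule continuous_on_subset[OF assms(1)]) auto
  qed (use assms in auto)
  then show ?thesis by (simp add: integrable_on_open_interval_real)
qed

lemma integral_Icc_split_limit:
  fixes F :: "real \<Rightarrow> complex"
  assumes int: "\<And>A. F integrable_on {0..A}"
    and L: "((\<lambda>A. integral {1..A} F) \<longlongrightarrow> L) at_top"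
  shows "((\<lambda>A. integral {0..A} F) \<longlongrightarrow> integral {0..1} F + L) at_top"
proof (rule Lim_transform_eventually)
  show "((\<lambda>A. integral {0..1} F + integral {1..A} F) \<longlongrightarrow> integral {0..1} F + L) at_top"
    by (intro tendsto_intros L)
  show "\<forall>\<^sub>F A in at_top. integral {0..1} F + integral {1..A} F = integral {0..A} F"
    using eventually_ge_at_top[of 1]
    by eventually_elim (rule Henstock_Kurzweil_Integration.integral_combine, use int in auto)
qed

text \<open>Integration by parts turns the conditionally convergent integral into a boundary term and an
absolutely convergent integral with \<open>1 / l\<^sup>2\<close>. For \<open>\<xi> = 0\<close> the integral diverges; this is why the
solution formula excludes the diagonal.\<close>

lemma cis_over_frequency_converges:
  assumes "\<xi> \<noteq> 0"
  shows "\<exists>L. ((\<lambda>A. integral {1..A} (\<lambda>l. cis (\<xi> * l) / of_real l)) \<longlongrightarrow> L) at_top"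
proof -
  let ?F = "\<lambda>l. cis (\<xi> * l) / of_real l"
  let ?G = "\<lambda>l. cis (\<xi> * l) / (\<i> * of_real \<xi> * of_real l)"
  let ?R = "\<lambda>l. cis (\<xi> * l) / (\<i> * of_real \<xi> * (of_real l)\<^sup>2)"
  have intF: "?F integrable_on {1..A}" and intR: "?R integrable_on {1..A}" for A
    using assms by (auto intro!: integrable_continuous_real continuous_intros)
  have ftc: "((\<lambda>l. ?F l - ?R l) has_integral ?G A - ?G 1) {1..A}" if "A \<ge> 1" for A
  proof (rule fundamental_theorem_of_calculus[OF that])
    fix l assume l: "l \<in> {1..A}"
    have "((\<lambda>z. exp (\<i> * of_real \<xi> * z) / (\<i> * of_real \<xi> * z)) has_field_derivative
       (exp (\<i> * of_real \<xi> * of_real l) / of_real l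
        - exp (\<i> * of_real \<xi> * of_real l) / (\<i> * of_real \<xi> * (of_real l)\<^sup>2))) (at (complex_of_real l))"
      using l assms by (auto intro!: derivative_eq_intros simp: field_simps power2_eq_square)
    then have "((\<lambda>l. exp (\<i> * of_real \<xi> * of_real l) / (\<i> * of_real \<xi> * of_real l)) has_vector_derivative
       (exp (\<i> * of_real \<xi> * of_real l) / of_real l
        - exp (\<i> * of_real \<xi> * of_real l) / (\<i> * of_real \<xi> * (of_real l)\<^sup>2))) (at l within {1..A})"
      by (rule has_vector_derivative_real_field)
    then show "(?G has_vector_derivative ?F l - ?R l) (at l within {1..A})"
      by (simp add: cis_conv_exp mult.assoc)
  qed
  have R: "((\<lambda>A. integral {1..A} ?R) \<longlongrightarrow> integral {1..} ?R) at_top"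
  proof (rule integral_at_top_limit(2)[OF intR integrable_inverse_square[of "1 / \<bar>\<xi>\<bar>"]])
    show "norm (?R l) \<le> 1 / \<bar>\<xi>\<bar> / l\<^sup>2" if "l \<ge> 1" for l
      using that by (simp add: norm_divide norm_mult norm_power)
  qed
  have G: "(?G \<longlongrightarrow> 0) at_top"
  proof (rule Lim_null_comparison)
    show "\<forall>\<^sub>F A in at_top. norm (?G A) \<le> 1 / \<bar>\<xi>\<bar> / A"
      using eventually_ge_at_top[of 1] by eventually_elim (simp add: norm_divide norm_mult)
    show "((\<lambda>A. 1 / \<bar>\<xi>\<bar> / A) \<longlongrightarrow> 0) at_top"
      by (intro tendsto_divide_0[OF tendsto_const] filterlim_at_top_imp_at_infinity filterlim_ident)
  qed
  have "((\<lambda>A. (?G A - ?G 1) + integral {1..A} ?R) \<longlongrightarrow> (0 - ?G 1) + integral {1..} ?R) at_top"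
    by (intro tendsto_add tendsto_diff G R tendsto_const)
  then have "((\<lambda>A. integral {1..A} ?F) \<longlongrightarrow> (0 - ?G 1) + integral {1..} ?R) at_top"
  proof (rule Lim_transform_eventually)
    show "\<forall>\<^sub>F A in at_top. (?G A - ?G 1) + integral {1..A} ?R = integral {1..A} ?F"
      using eventually_ge_at_top[of 1]
    proof eventually_elim
      case (elim A)
      have "integral {1..A} ?F - integral {1..A} ?R = ?G A - ?G 1"
        using integral_unique[OF ftc[OF elim]] unfolding integral_diff[OF intF intR] .
      then show ?case by (rule subst) (rule diff_add_cancel)
    qed
  qed
  then show ?thesis by blast
qed

text \<open>Two phases are allowed because the boundary integrals have a term without and a term with time
oscillation.\<close>

lemma half_conv_oscillating:
  assumes cont: "continuous_on {0<..} F" and bdd: "\<And>l. 0 < l \<Longrightarrow> l \<le> 1 \<Longrightarrow> norm (F l) \<le> K"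
    and asy: "inv_power_bound 2 (\<lambda>l. F l - (a * cis (\<xi> * l) + b * cis (\<eta> * l)) / of_real l)"
    and ne: "\<xi> \<noteq> 0" "\<eta> \<noteq> 0"
  shows "half_conv F"
proof -
  let ?M = "\<lambda>l. (a * cis (\<xi> * l) + b * cis (\<eta> * l)) / of_real l"
  obtain C where C: "\<And>l. l \<ge> 1 \<Longrightarrow> norm (F l - ?M l) \<le> C / l\<^sup>2"
    using asy unfolding inv_power_bound_def by blast
  have "norm (F l) \<le> \<bar>K\<bar> + \<bar>C\<bar> + norm a + norm b" if "l > 0" for l
  proof (cases "l \<le> 1")
    case True then show ?thesis using bdd[OF that] by (smt (verit) norm_ge_zero)
  next
    case False
    then have l: "l \<ge> 1" by simp
    have "norm (F l) \<le> norm (F l - ?M l) + norm (?M l)"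
      by (metis norm_triangle_sub add.commute)
    also have "\<dots> \<le> C / l\<^sup>2 + (norm a + norm b) / l"
    proof -
      have "norm (a * cis (\<xi> * l) + b * cis (\<eta> * l)) \<le> norm a + norm b"
        by (rule order_trans[OF norm_triangle_ineq]) (simp add: norm_mult)
      then show ?thesis using C[OF l] l by (intro add_mono) (auto simp: norm_divide divide_right_mono)
    qed
    also have "\<dots> \<le> \<bar>C\<bar> / 1 + (norm a + norm b) / 1"
      using l by (intro add_mono frac_le) auto
    finally show ?thesis by simp
  qed
  then have int: "F integrable_on {0..A}" for A
    by (intro integrable_on_0_A[OF cont]) auto
  have intM: "?M integrable_on {1..A}" "(\<lambda>l. cis (\<xi> * l) / of_real l) integrable_on {1..A}"
      "(\<lambda>l. cis (\<eta> * l) / of_real l) integrable_on {1..A}" for A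
    by (auto intro!: integrable_continuous_real continuous_intros)
  have int1: "F integrable_on {1..A}" for A
    by (rule integrable_on_subinterval[OF int[of A]]) auto
  obtain L1 L2 where L: "((\<lambda>A. integral {1..A} (\<lambda>l. cis (\<xi> * l) / of_real l)) \<longlongrightarrow> L1) at_top"
      "((\<lambda>A. integral {1..A} (\<lambda>l. cis (\<eta> * l) / of_real l)) \<longlongrightarrow> L2) at_top"
    using cis_over_frequency_converges ne by blast
  have R: "((\<lambda>A. integral {1..A} (\<lambda>l. F l - ?M l)) \<longlongrightarrow> integral {1..} (\<lambda>l. F l - ?M l)) at_top"
    by (rule integral_at_top_limit(2)[OF _ integrable_inverse_square[of C]])
       (use C int1 intM in \<open>auto intro: integrable_diff\<close>)
  have "integral {1..A} F = integral {1..A} (\<lambda>l. F l - ?M l) +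
      (a * integral {1..A} (\<lambda>l. cis (\<xi> * l) / of_real l) + b * integral {1..A} (\<lambda>l. cis (\<eta> * l) / of_real l))" for A
  proof -
    have "integral {1..A} ?M = integral {1..A} (\<lambda>l. a * (cis (\<xi> * l) / of_real l) + b * (cis (\<eta> * l) / of_real l))"
      by (simp add: add_divide_distrib)
    also have "\<dots> = a * integral {1..A} (\<lambda>l. cis (\<xi> * l) / of_real l) + b * integral {1..A} (\<lambda>l. cis (\<eta> * l) / of_real
        l)"
      by (simp only: integral_add intM integrable_on_mult_right integral_mult_right)
    finally show ?thesis by (simp only: integral_diff int1 intM) simp
  qed
  then have "((\<lambda>A. integral {1..A} F) \<longlongrightarrow> integral {1..} (\<lambda>l. F l - ?M l) + (a * L1 + b * L2)) at_top"
    by (simp only: tendsto_intros R L)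
  from integral_Icc_split_limit[OF int this] show ?thesis
    unfolding half_conv_def using int by blast
qed

section \<open>Amplitudes of the solution formula\<close>

lemma rho_pos: "l \<noteq> 0 \<Longrightarrow> rho m l > 0"
  and rho_nonneg: "rho m l \<ge> 0"
  and rho_minus [simp]: "rho m (- l) = rho m l"
  and rho_minus_mass [simp]: "rho (- m) l = rho m l"
  and rho_ge_frequency: "\<bar>l\<bar> \<le> rho m l"
  and rho_ge_mass: "\<bar>m\<bar> \<le> rho m l"
  and rho_square: "(rho m l)\<^sup>2 = l\<^sup>2 + m\<^sup>2"
proof -
  show "l \<noteq> 0 \<Longrightarrow> rho m l > 0" by (simp add: rho_def add_pos_nonneg)
qed (auto simp: rho_def intro: real_le_rsqrt)

lemma rho_eq_0_iff: "rho m l = 0 \<longleftrightarrow> l = 0 \<and> m = 0"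
  by (simp add: rho_def sum_power2_eq_zero_iff)

lemma continuous_on_rho [continuous_intros]:
  "continuous_on S f \<Longrightarrow> continuous_on S (\<lambda>p. rho m (f p))"
  unfolding rho_def by (intro continuous_intros)

text \<open>From \<open>(rho - l) (rho + l) = m\<^sup>2\<close>.\<close>

lemma rho_minus_frequency_le:
  assumes "l > 0" shows "rho m l - l \<le> m\<^sup>2 / l"
proof -
  have "(rho m l - l) * l \<le> (rho m l - l) * (rho m l + l)"
    using rho_ge_frequency[of l m] assms by (intro mult_left_mono) auto
  also have "\<dots> = m\<^sup>2" using rho_square[of m l] by (simp add: algebra_simps power2_eq_square)
  finally show ?thesis using assms by (simp add: field_simps)
qed

lemma norm_cis_diff_le: "norm (cis a - cis b) \<le> \<bar>a - b\<bar>"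
proof -
  have "norm (cis a - cis b) \<le> 1 * \<bar>a - b\<bar>"
  proof (rule norm_diff_le_derivative_bound[where Y = UNIV and f' = "\<lambda>y. \<i> * cis y"])
    show "(cis has_vector_derivative \<i> * cis y) (at y)" for y
      unfolding has_vector_derivative_def by (auto intro!: derivative_eq_intros)
  qed (auto simp: norm_mult)
  then show ?thesis by simp
qed

text \<open>Replacing the dispersion relation by that of the massless equation costs \<open>O(1 / l)\<close>, since \<open>rho - l\<close>
is of this order.\<close>

lemma phase_error: "inv_power_bound 1 (\<lambda>l. cis (l * y - s * rho m l * t) - cis ((y - s * t) * l))"
proof (rule inv_power_boundI)
  fix l :: real assume l: "l \<ge> 1"
  have "norm (cis (l * y - s * rho m l * t) - cis ((y - s * t) * l)) \<le> \<bar>(l * y - s * rho m l * t) - (y - s * t) * l\<bar>"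
    by (rule norm_cis_diff_le)
  also have "\<dots> = \<bar>s * t\<bar> * (rho m l - l)"
  proof -
    have "(l * y - s * rho m l * t) - (y - s * t) * l = - (s * t) * (rho m l - l)" by (simp add: algebra_simps)
    then show ?thesis using rho_ge_frequency[of l m] l by (simp add: abs_mult)
  qed
  also have "\<dots> \<le> \<bar>s * t\<bar> * (m\<^sup>2 / l)"
    using l rho_minus_frequency_le by (intro mult_left_mono) auto
  finally show "norm (cis (l * y - s * rho m l * t) - cis ((y - s * t) * l)) \<le> (\<bar>s * t\<bar> * m\<^sup>2) / l ^ 1" by simp
qed

lemma frequency_ratio_error: "inv_power_bound 1 (\<lambda>l. of_real l / of_real (rho m l) - 1)"
proof (rule inv_power_boundI)
  fix l :: real assume l: "l \<ge> 1"
  have r: "rho m l \<ge> l" "rho m l > 0" using rho_ge_frequency[of l m] l by auto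
  have "complex_of_real l / of_real (rho m l) - 1 = of_real (- (rho m l - l) / rho m l)"
    using r by (simp add: field_simps)
  then have "norm (complex_of_real l / of_real (rho m l) - 1) = (rho m l - l) / rho m l"
    using r by (simp only: norm_of_real) simp
  also have "\<dots> \<le> (m\<^sup>2 / l) / 1"
    using r l rho_minus_frequency_le[of l m] by (intro frac_le) auto
  finally show "norm (complex_of_real l / of_real (rho m l) - 1) \<le> m\<^sup>2 / l ^ 1" by simp
qed

lemma inverse_rho_bound: "inv_power_bound 1 (\<lambda>l. c / of_real (rho m l))"
proof (rule inv_power_boundI)
  fix l :: real assume l: "l \<ge> 1"
  then show "norm (c / of_real (rho m l)) \<le> norm c / l ^ 1"
    using rho_ge_frequency[of l m] by (simp add: norm_divide divide_left_mono)
qed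

lemma inverse_rho_error: "inv_power_bound 2 (\<lambda>l. c / of_real (rho m l) - c / of_real l)"
proof -
  have "inv_power_bound 2 (\<lambda>l. (of_real l / of_real (rho m l) - 1) * (c / of_real l))"
    by (intro inv_power_bound_mult_1_1 frequency_ratio_error inv_power_bound_inverse)
  then show ?thesis
  proof (rule inv_power_bound_transfer)
    fix l :: real assume "l \<ge> 1"
    then show "(of_real l / of_real (rho m l) - 1) * (c / of_real l) = c / of_real (rho m l) - c / of_real l"
      using rho_pos[of l m] by (simp add: field_simps)
  qed
qed

lemma inv_power_bound_cis: "inv_power_bound 0 (\<lambda>l. cis (f l))"
  by (rule inv_power_boundI[of _ 1]) simp

text \<open>Transforms of the data behave like \<open>c / l\<close> at both ends of the line, with the same \<open>c\<close>.\<close>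

definition amplitude :: "complex \<Rightarrow> (real \<Rightarrow> complex) \<Rightarrow> bool" where
  "amplitude c X \<longleftrightarrow> continuous_on UNIV X \<and> inv_power_bound 2 (\<lambda>l. X l - c / of_real l) \<and>
     inv_power_bound 2 (\<lambda>l. X (- l) + c / of_real l)"

lemma amplitude_reflect: "amplitude c X \<Longrightarrow> amplitude (- c) (\<lambda>l. X (- l))"
  unfolding amplitude_def by (auto intro!: continuous_on_compose2[of UNIV X] continuous_intros)

lemma amplitude_bound: "amplitude c X \<Longrightarrow> inv_power_bound 1 X"
  using inv_power_bound_add[of 1 "\<lambda>l. X l - c / of_real l" "\<lambda>l. c / of_real l"]
    inv_power_bound_mono[of 2 "\<lambda>l. X l - c / of_real l" 1] inv_power_bound_inverse[of c]
  by (simp add: amplitude_def)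

lemma continuous_bounded_unit_interval:
  fixes X :: "real \<Rightarrow> complex"
  assumes "continuous_on UNIV X" obtains K where "\<And>l. 0 \<le> l \<Longrightarrow> l \<le> 1 \<Longrightarrow> norm (X l) \<le> K"
proof -
  have "bounded (X ` {0..1})"
    by (intro compact_imp_bounded compact_continuous_image continuous_on_subset[OF assms]) auto
  then show ?thesis using that unfolding bounded_iff by (metis atLeastAtMost_iff imageI)
qed

text \<open>Up to \<open>O(1 / l\<^sup>2)\<close> the integrand is \<open>cis ((y - s t) l) / l\<close> times a constant, so the integral
converges off the light cone. Near \<open>l = 0\<close> the division by \<open>rho\<close> is harmless since \<open>l\<close>, \<open>m\<close> and
\<open>rho\<close> in the numerator are all bounded by \<open>rho\<close>.\<close>

lemma amplitude_half_conv:
  assumes amp: "amplitude c1 X1" "amplitude c2 X2" and \<kappa>: "norm \<kappa> \<le> \<bar>m\<bar>" and ne: "y - s * t \<noteq> 0"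
  shows "half_conv (\<lambda>l. cis (l * y - s * rho m l * t) *
     (r * of_real l * X2 l + (\<beta> * of_real (rho m l) + \<kappa>) * X1 l) / of_real (2 * rho m l))"
proof -
  define U where "U l = (r * of_real l * X2 l + (\<beta> * of_real (rho m l) + \<kappa>) * X1 l) / of_real (2 * rho m l)" for l
  define a where "a = (r * c2 + \<beta> * c1) / 2"
  let ?c1 = "\<lambda>l. cis (l * y - s * rho m l * t)" and ?c2 = "\<lambda>l. cis ((y - s * t) * l)"
  have U_eq: "U l = (r / 2) * ((of_real l / of_real (rho m l) - 1) * X2 l + X2 l) + (\<beta> / 2) * X1 l
     + (\<kappa> / 2 / of_real (rho m l)) * X1 l" if "l > 0" for l
    using rho_pos[of l m] that unfolding U_def by (simp add: field_simps)
  have U_asy: "inv_power_bound 2 (\<lambda>l. U l - a / of_real l)"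
  proof -
    have "inv_power_bound 2 (\<lambda>l. (r / 2) * ((of_real l / of_real (rho m l) - 1) * X2 l + (X2 l - c2 / of_real l))
       + (\<beta> / 2) * (X1 l - c1 / of_real l) + (\<kappa> / 2 / of_real (rho m l)) * X1 l)"
    proof (intro inv_power_bound_add inv_power_bound_cmult)
      show "inv_power_bound 2 (\<lambda>l. (of_real l / of_real (rho m l) - 1) * X2 l)"
        "inv_power_bound 2 (\<lambda>l. \<kappa> / 2 / of_real (rho m l) * X1 l)"
        by (intro inv_power_bound_mult_1_1 frequency_ratio_error inverse_rho_bound amplitude_bound[OF amp(1)]
              amplitude_bound[OF amp(2)])+
    qed (use amp in \<open>auto simp: amplitude_def\<close>)
    then show ?thesis
      by (rule inv_power_bound_transfer) (simp add: U_eq a_def ring_distribs add_divide_distrib)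
  qed
  have U1: "inv_power_bound 1 U"
    using inv_power_bound_add[OF inv_power_bound_mono[OF U_asy, of 1] inv_power_bound_inverse[of a]] by simp
  obtain K1 K2 where K: "\<And>l. 0 \<le> l \<Longrightarrow> l \<le> 1 \<Longrightarrow> norm (X1 l) \<le> K1" "\<And>l. 0 \<le> l \<Longrightarrow> l \<le> 1 \<Longrightarrow> norm (X2 l) \<le> K2"
    using continuous_bounded_unit_interval amp unfolding amplitude_def by metis
  have "half_conv (\<lambda>l. ?c1 l * U l)"
  \<comment> \<open>there is only one phase here; with coefficient \<open>0\<close> any non-zero \<open>\<eta>\<close> serves as the second\<close>
  proof (rule half_conv_oscillating[where a = a and b = 0 and \<xi> = "y - s * t" and \<eta> = 1])
    show "continuous_on {0<..} (\<lambda>l. ?c1 l * U l)"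
      unfolding U_def using amp
      by (intro continuous_intros)
         (auto simp: amplitude_def rho_eq_0_iff intro: continuous_on_subset)
    fix l :: real assume l: "0 < l" "l \<le> 1"
    have R: "rho m l > 0" "l \<le> rho m l" "\<bar>m\<bar> \<le> rho m l"
      using rho_pos[of l m] rho_ge_frequency[of l m] rho_ge_mass[of m l] l by auto
    have "norm (U l) \<le> (norm r * rho m l * K2 + (norm \<beta> * rho m l + rho m l) * K1) / (2 * rho m l)"
      unfolding U_def norm_divide
    proof (rule frac_le)
      have "norm (r * of_real l * X2 l) \<le> norm r * rho m l * K2"
        unfolding norm_mult using K(2)[of l] l R by (intro mult_mono) auto
      moreover have "norm ((\<beta> * of_real (rho m l) + \<kappa>) * X1 l) \<le> (norm \<beta> * rho m l + rho m l) * K1"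
        unfolding norm_mult using K(1)[of l] l R \<kappa>
        by (intro mult_mono order_trans[OF norm_triangle_ineq] add_mono) (auto simp: norm_mult)
      ultimately show "norm (r * of_real l * X2 l + (\<beta> * of_real (rho m l) + \<kappa>) * X1 l)
         \<le> norm r * rho m l * K2 + (norm \<beta> * rho m l + rho m l) * K1"
        by (intro order_trans[OF norm_triangle_ineq] add_mono)
      show "0 \<le> norm r * rho m l * K2 + (norm \<beta> * rho m l + rho m l) * K1"
        using R order_trans[OF norm_ge_zero K(1)[of l]] order_trans[OF norm_ge_zero K(2)[of l]] l
        by (intro add_nonneg_nonneg mult_nonneg_nonneg) auto
    qed (use R in auto)
    also have "\<dots> = (norm r * K2 + (norm \<beta> + 1) * K1) / 2" using R by (simp add: field_simps)
    finally show "norm (?c1 l * U l) \<le> (norm r * K2 + (norm \<beta> + 1) * K1) / 2" by (simp add: norm_mult)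
  next
    have "inv_power_bound 2 (\<lambda>l. (?c1 l - ?c2 l) * U l + ?c2 l * (U l - a / of_real l))"
      by (intro inv_power_bound_add inv_power_bound_mult_1_1 inv_power_bound_mult_0 phase_error U1
            inv_power_bound_cis U_asy)
    then show "inv_power_bound 2 (\<lambda>l. ?c1 l * U l - (a * ?c2 l + 0 * cis (1 * l)) / of_real l)"
      by (rule inv_power_bound_transfer) (simp add: algebra_simps)
  qed (use ne in auto)
  then show ?thesis by (simp add: U_def mult.assoc)
qed

lemma wave_cis:
  assumes "\<And>l. om l = \<i> * of_real (s * rho m l)"
  shows "wave om x t l = cis (l * x - s * rho m l * t)"
  unfolding wave_def cis_conv_exp assms by (simp add: algebra_simps)

lemma amplitude_line_conv:
  assumes om: "\<And>l. om l = \<i> * of_real (s * rho m l)" and s: "\<bar>s\<bar> = 1"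
    and amp: "amplitude c1 X1" "amplitude c2 X2" and \<kappa>: "norm \<kappa> \<le> \<bar>m\<bar>"
    and xt: "0 < x" "0 < t" "x \<noteq> t"
  shows "line_conv (\<lambda>l. wave om x t l *
     (of_real l * X2 l + (\<beta> * of_real (rho m l) + \<kappa>) * X1 l) / of_real (2 * rho m l))"
proof -
  have ne: "x - s * t \<noteq> 0" "- x - s * t \<noteq> 0"
    using s xt by (auto simp: abs_if split: if_splits)
  show ?thesis
    unfolding line_conv_def wave_cis[of om, OF om]
    using amplitude_half_conv[OF amp \<kappa> ne(1), of 1]
      amplitude_half_conv[OF amplitude_reflect[OF amp(1)] amplitude_reflect[OF amp(2)] \<kappa> ne(2), of "-1"]
    by simp
qed

lemma hat_amplitude:
  assumes "decaying_derivs C d"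
  shows "amplitude (d 0 0 / \<i>) (hat (d 0))"
  unfolding amplitude_def
proof (intro conjI)
  have "continuous_on (UNIV \<times> {0::real}) (\<lambda>(l, p). hat ((\<lambda>_. d 0) p) l)"
  proof (rule hat_continuous_on[of _ _ C])
    have "continuous_on ({0::real} \<times> {0..}) (\<lambda>q. d 0 (snd q))"
      by (rule continuous_on_compose2[OF decaying_derivs_continuous[OF assms]]) (auto intro: continuous_intros)
    then show "continuous_on ({0} \<times> {0..}) (\<lambda>(p::real, y). d 0 y)" by (simp add: split_def)
  qed (use assms in \<open>auto simp: decaying_derivs_def\<close>)
  from continuous_on_compose2[OF this, of UNIV "\<lambda>l. (l, 0)"]
  show "continuous_on UNIV (hat (d 0))" by (force intro: continuous_intros)
  show "inv_power_bound 2 (\<lambda>l. hat (d 0) l - d 0 0 / \<i> / of_real l)"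
  proof (rule inv_power_boundI)
    show "norm (hat (d 0) l - d 0 0 / \<i> / of_real l) \<le> 2 * C / l\<^sup>2" if "l \<ge> 1" for l
      unfolding divide_divide_eq_left using that by (intro hat_expansion(1)[OF assms]) auto
  qed
  show "inv_power_bound 2 (\<lambda>l. hat (d 0) (- l) + d 0 0 / \<i> / of_real l)"
  proof (rule inv_power_boundI)
    fix l :: real assume l: "l \<ge> 1"
    have "hat (d 0) (- l) + d 0 0 / \<i> / of_real l = hat (d 0) (- l) - d 0 0 / (\<i> * of_real (- l))"
      unfolding divide_divide_eq_left by simp
    then show "norm (hat (d 0) (- l) + d 0 0 / \<i> / of_real l) \<le> 2 * C / l\<^sup>2"
      using hat_expansion(1)[OF assms, of "- l"] l by simp
  qed
qed

lemma integral_cis_by_parts: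
  assumes t: "t \<ge> 0"
    and der: "\<And>\<tau>. \<tau> \<in> {0..t} \<Longrightarrow> (\<phi> has_vector_derivative \<phi>' \<tau>) (at \<tau> within {0..t})"
    and cont: "continuous_on {0..t} \<phi>'"
  shows "\<i> * of_real a * integral {0..t} (\<lambda>\<tau>. cis (a * \<tau>) * \<phi> \<tau>)
    = cis (a * t) * \<phi> t - \<phi> 0 - integral {0..t} (\<lambda>\<tau>. cis (a * \<tau>) * \<phi>' \<tau>)"
proof -
  have c: "continuous_on {0..t} \<phi>"
    by (rule continuous_on_vector_derivative) (use der in auto)
  have "((\<lambda>\<tau>. cis (a * \<tau>) * \<phi>' \<tau> + \<i> * of_real a * (cis (a * \<tau>) * \<phi> \<tau>)) has_integral
      cis (a * t) * \<phi> t - cis (a * 0) * \<phi> 0) {0..t}"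
  proof (rule fundamental_theorem_of_calculus[OF t])
    fix \<tau> assume \<tau>: "\<tau> \<in> {0..t}"
    from has_vector_derivative_mult[OF cis_has_vector_derivative der[OF \<tau>], of a]
    show "((\<lambda>\<tau>. cis (a * \<tau>) * \<phi> \<tau>) has_vector_derivative
      cis (a * \<tau>) * \<phi>' \<tau> + \<i> * of_real a * (cis (a * \<tau>) * \<phi> \<tau>)) (at \<tau> within {0..t})"
      by (simp add: algebra_simps)
  qed
  then have ftc: "integral {0..t} (\<lambda>\<tau>. cis (a * \<tau>) * \<phi>' \<tau> + \<i> * of_real a * (cis (a * \<tau>) * \<phi> \<tau>)) = cis (a * t) * \<phi> t
      - \<phi> 0"
    by (simp add: integral_unique)
  have i: "(\<lambda>\<tau>. cis (a * \<tau>) * \<phi>' \<tau>) integrable_on {0..t}" "(\<lambda>\<tau>. cis (a * \<tau>) * \<phi> \<tau>) integrable_on {0..t}"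
    by (intro integrable_continuous_real continuous_intros c cont)+
  show ?thesis
    using ftc
    unfolding integral_add[OF i(1) integrable_on_mult_right[OF i(2)]] integral_mult_right
    by (simp add: algebra_simps)
qed

lemma norm_integral_cis_le:
  assumes "t \<ge> 0" "continuous_on {0..t} \<phi>" "\<And>\<tau>. \<tau> \<in> {0..t} \<Longrightarrow> norm (\<phi> \<tau>) \<le> B"
  shows "norm (integral {0..t} (\<lambda>\<tau>. cis (a * \<tau>) * \<phi> \<tau>)) \<le> B * t"
proof -
  have "continuous_on {0..t} (\<lambda>\<tau>. cis (a * \<tau>) * \<phi> \<tau>)" by (intro continuous_intros assms)
  then show ?thesis
    using integral_bound[of 0 t "\<lambda>\<tau>. cis (a * \<tau>) * \<phi> \<tau>" B] assms by (simp add: norm_mult)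
qed

text \<open>One integration by parts in time gains a factor \<open>1 / a\<close>; here \<open>a\<close> will be \<open>\<plusminus> rho m l\<close>.\<close>

lemma norm_integral_cis_decay:
  assumes t: "t \<ge> 0"
    and der: "\<And>\<tau>. \<tau> \<in> {0..t} \<Longrightarrow> (\<phi> has_vector_derivative \<phi>' \<tau>) (at \<tau> within {0..t})"
    and cont: "continuous_on {0..t} \<phi>'"
  obtains B where "B \<ge> 0" "\<And>a. norm (of_real a * integral {0..t} (\<lambda>\<tau>. cis (a * \<tau>) * \<phi> \<tau>)) \<le> B"
proof -
  have "bounded (\<phi>' ` {0..t})"
    by (intro compact_imp_bounded compact_continuous_image cont) auto
  then obtain B where B: "\<And>\<tau>. \<tau> \<in> {0..t} \<Longrightarrow> norm (\<phi>' \<tau>) \<le> B"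
    unfolding bounded_iff by blast
  have "norm (of_real a * integral {0..t} (\<lambda>\<tau>. cis (a * \<tau>) * \<phi> \<tau>)) \<le> norm (\<phi> t) + norm (\<phi> 0) + B * t" for a
  proof -
    have "norm (of_real a * integral {0..t} (\<lambda>\<tau>. cis (a * \<tau>) * \<phi> \<tau>))
      = norm (\<i> * of_real a * integral {0..t} (\<lambda>\<tau>. cis (a * \<tau>) * \<phi> \<tau>))" by (simp add: norm_mult)
    also have "\<dots> = norm (cis (a * t) * \<phi> t - \<phi> 0 - integral {0..t} (\<lambda>\<tau>. cis (a * \<tau>) * \<phi>' \<tau>))"
      by (rule arg_cong[OF integral_cis_by_parts[OF t der cont]])
    also have "\<dots> \<le> norm (cis (a * t) * \<phi> t) + norm (\<phi> 0) + norm (integral {0..t} (\<lambda>\<tau>. cis (a * \<tau>) * \<phi>' \<tau>))"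
      by (rule order_trans[OF norm_triangle_ineq4 add_right_mono[OF norm_triangle_ineq4]])
    also have "\<dots> \<le> norm (\<phi> t) + norm (\<phi> 0) + B * t"
      using norm_integral_cis_le[OF t cont B] by (simp add: norm_mult)
    finally show ?thesis .
  qed
  moreover have "0 \<le> norm (\<phi> t) + norm (\<phi> 0) + B * t"
    using order_trans[OF norm_ge_zero B[of 0]] t by simp
  ultimately show ?thesis using that by blast
qed

text \<open>The space integral and the time integral each gain a factor \<open>1 / l\<close>, so the leading coefficient
vanishes and the integrals with the sources even converge absolutely.\<close>

lemma tilde_hat_amplitude:
  assumes d: "\<And>\<tau>. \<tau> \<in> {0..t} \<Longrightarrow> decaying_derivs C (d \<tau>)"
    and f: "\<And>\<tau>. d \<tau> 0 = (\<lambda>y. f (y, \<tau>))"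
    and cont: "continuous_on ({0..} \<times> {0..t}) f"
    and der: "\<And>\<tau>. \<tau> \<in> {0..t} \<Longrightarrow> ((\<lambda>\<tau>. f (0, \<tau>)) has_vector_derivative \<phi>' \<tau>) (at \<tau> within {0..t})"
    and \<phi>': "continuous_on {0..t} \<phi>'"
    and om: "\<And>l. om l = \<i> * of_real (s * rho m l)" and s: "\<bar>s\<bar> = 1" and t: "t \<ge> 0"
  shows "amplitude 0 (\<lambda>l. tilde_hat f l (om l) t)"
proof -
  define R where "R l \<tau> = hat (\<lambda>y. f (y, \<tau>)) l" for l \<tau>
  have contR: "continuous_on (UNIV \<times> {0..t}) (\<lambda>(l, \<tau>). R l \<tau>)"
    unfolding R_def
  proof (rule hat_continuous_on[where f = "\<lambda>\<tau> y. f (y, \<tau>)" and C = C])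
    show "continuous_on ({0..t} \<times> {0..}) (\<lambda>(\<tau>, y). f (y, \<tau>))"
      unfolding split_def by (intro continuous_on_compose2[OF cont] continuous_intros) auto
    show "norm (f (y, \<tau>)) \<le> C / (1 + y)\<^sup>2" if "\<tau> \<in> {0..t}" "y \<ge> 0" for y \<tau>
      using d[OF that(1)] that f[of \<tau>] unfolding decaying_derivs_def by (metis le0)
  qed
  have contR1: "continuous_on {0..t} (R l)" for l
    using continuous_on_compose2[OF contR, of "{0..t}" "\<lambda>\<tau>. (l, \<tau>)"] by (force intro: continuous_intros)
  have eq: "tilde_hat f l (om l) t = integral {0..t} (\<lambda>\<tau>. cis (s * rho m l * \<tau>) * R l \<tau>)" for l
    unfolding tilde_hat_def R_def by (simp add: om cis_conv_exp mult.assoc)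
  have contf: "continuous_on {0..t} (\<lambda>\<tau>. f (0, \<tau>))"
    by (rule continuous_on_vector_derivative) (use der in auto)
  obtain B where B: "B \<ge> 0" "\<And>a. norm (of_real a * integral {0..t} (\<lambda>\<tau>. cis (a * \<tau>) * f (0, \<tau>))) \<le> B"
    using norm_integral_cis_decay[OF t der \<phi>'] by blast
  have bound: "norm (tilde_hat f l (om l) t) \<le> (B + 2 * C * t) / l\<^sup>2" if l: "\<bar>l\<bar> \<ge> 1" for l
  proof -
    let ?I = "integral {0..t} (\<lambda>\<tau>. cis (s * rho m l * \<tau>) * f (0, \<tau>))"
    let ?J = "integral {0..t} (\<lambda>\<tau>. cis (s * rho m l * \<tau>) * (R l \<tau> - f (0, \<tau>) / (\<i> * of_real l)))"
    have l0: "l \<noteq> 0" using l by auto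
    have int: "(\<lambda>\<tau>. cis (s * rho m l * \<tau>) * f (0, \<tau>) / (\<i> * of_real l)) integrable_on {0..t}"
       "(\<lambda>\<tau>. cis (s * rho m l * \<tau>) * (R l \<tau> - f (0, \<tau>) / (\<i> * of_real l))) integrable_on {0..t}"
      using l0 by (auto intro!: integrable_continuous_real continuous_intros contf contR1)
    have "tilde_hat f l (om l) t = ?I / (\<i> * of_real l) + ?J"
      unfolding eq integral_divide[symmetric] integral_add[OF int, symmetric]
      by (simp add: algebra_simps)
    then have "norm (tilde_hat f l (om l) t) \<le> norm (?I / (\<i> * of_real l)) + norm ?J"
      by (simp only: norm_triangle_ineq)
    also have "norm ?J \<le> 2 * C / l\<^sup>2 * t"
    proof (rule norm_integral_cis_le[OF t])
      show "norm (R l \<tau> - f (0, \<tau>) / (\<i> * of_real l)) \<le> 2 * C / l\<^sup>2" if "\<tau> \<in> {0..t}" for \<tau>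
        using hat_expansion(1)[OF d[OF that] l0] by (simp add: R_def f)
    qed (use l0 in \<open>auto intro!: continuous_intros contf contR1\<close>)
    also have "norm (?I / (\<i> * of_real l)) \<le> B / l\<^sup>2"
    proof -
      have "norm ?I * \<bar>l\<bar> \<le> norm ?I * rho m l"
        by (intro mult_left_mono rho_ge_frequency) auto
      also have "\<dots> \<le> B"
        using B(2)[of "s * rho m l"] s rho_nonneg[of m l] by (simp add: norm_mult abs_mult mult.commute)
      finally have "norm ?I * \<bar>l\<bar> / l\<^sup>2 \<le> B / l\<^sup>2" by (rule divide_right_mono) simp
      moreover have "norm ?I * \<bar>l\<bar> / l\<^sup>2 = norm ?I / \<bar>l\<bar>"
        using l0 by (cases "l \<ge> 0") (auto simp: power2_eq_square)
      ultimately show ?thesis using l0 by (simp add: norm_divide norm_mult)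
    qed
    finally show ?thesis by (simp add: add_divide_distrib)
  qed
  have "continuous_on UNIV (\<lambda>l. integral (cbox 0 t) (\<lambda>\<tau>. cis (s * rho m l * \<tau>) * R l \<tau>))"
    by (rule integral_continuous_on_param)
       (use contR in \<open>auto simp: split_def intro!: continuous_intros\<close>)
  then show ?thesis
    unfolding amplitude_def using bound[of l for l] bound[of "- l" for l]
    by (auto simp: eq intro!: inv_power_boundI[of _ "B + 2 * C * t"])
qed

text \<open>Integrating by parts in time twice, the inner integral is \<open>(cis (s rho t) h0 t - h0 0) / (\<i> s rho)\<close>
up to \<open>O(1 / l\<^sup>2)\<close>. The first summand cancels the time oscillation of the wave and leaves the phase
\<open>y l\<close>, which is why \<open>y \<noteq> 0\<close> is needed besides \<open>y \<noteq> s t\<close>.\<close>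

lemma boundary_half_conv:
  fixes h0 h1 h2 :: "real \<Rightarrow> complex"
  assumes t: "t \<ge> 0"
    and h: "\<And>\<tau>. \<tau> \<in> {0..t} \<Longrightarrow> (h0 has_vector_derivative h1 \<tau>) (at \<tau> within {0..t})"
      "\<And>\<tau>. \<tau> \<in> {0..t} \<Longrightarrow> (h1 has_vector_derivative h2 \<tau>) (at \<tau> within {0..t})"
      "continuous_on {0..t} h2"
    and s: "\<bar>s\<bar> = 1" and \<kappa>: "norm \<kappa> \<le> \<bar>m\<bar>" and ne: "y \<noteq> 0" "y - s * t \<noteq> 0"
  shows "half_conv (\<lambda>l. cis (l * y - s * rho m l * t) *
     integral {0..t} (\<lambda>\<tau>. cis (s * rho m l * \<tau>) * h0 \<tau>) *
     (\<alpha> * of_real l + \<beta> * of_real (rho m l) + \<kappa>) / of_real (rho m l))"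
proof -
  have ch: "continuous_on {0..t} h0" "continuous_on {0..t} h1"
    by (rule continuous_on_vector_derivative, use h in auto)+
  let ?X = "\<lambda>l. integral {0..t} (\<lambda>\<tau>. cis (s * rho m l * \<tau>) * h0 \<tau>)"
  let ?X1 = "\<lambda>l. integral {0..t} (\<lambda>\<tau>. cis (s * rho m l * \<tau>) * h1 \<tau>)"
  let ?c1 = "\<lambda>l. cis (l * y - s * rho m l * t)" and ?c2 = "\<lambda>l. cis ((y - s * t) * l)"
  define u where "u l = (\<alpha> * of_real l + \<beta> * of_real (rho m l) + \<kappa>) / of_real (rho m l)" for l
  define v where "v l = u l / (\<i> * of_real s * of_real (rho m l))" for l
  define w where "w = (\<alpha> + \<beta>) / (\<i> * of_real s)"
  have s0: "s \<noteq> 0" using s by auto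
  have u_eq: "u l = \<alpha> * (of_real l / of_real (rho m l) - 1) + (\<alpha> + \<beta>) + \<kappa> / of_real (rho m l)" if "l > 0" for l
    using rho_pos[of l m] that by (simp add: u_def field_simps)
  have u_asy: "inv_power_bound 1 (\<lambda>l. u l - (\<alpha> + \<beta>))"
    by (rule inv_power_bound_transfer[of _ "\<lambda>l. \<alpha> * (of_real l / of_real (rho m l) - 1) + \<kappa> / of_real (rho m l)"])
       (intro inv_power_bound_add inv_power_bound_cmult frequency_ratio_error inverse_rho_bound, simp add: u_eq)
  have v_asy: "inv_power_bound 2 (\<lambda>l. v l - w / of_real l)"
  proof (rule inv_power_bound_transfer)
    show "inv_power_bound 2 (\<lambda>l. (u l - (\<alpha> + \<beta>)) * (1 / (\<i> * of_real s) / of_real (rho m l)) + (w / of_real (rho m l)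
        - w / of_real l))"
      by (intro inv_power_bound_add inv_power_bound_mult_1_1 u_asy inverse_rho_bound inverse_rho_error)
    show "(u l - (\<alpha> + \<beta>)) * (1 / (\<i> * of_real s) / of_real (rho m l)) + (w / of_real (rho m l) - w / of_real l)
       = v l - w / of_real l" if "l \<ge> 1" for l
      using rho_pos[of l m] that s0 by (simp add: v_def w_def left_diff_distrib diff_divide_distrib)
  qed
  have v1: "inv_power_bound 1 v"
    using inv_power_bound_add[OF inv_power_bound_mono[OF v_asy, of 1] inv_power_bound_inverse[of w]] by simp
  obtain B where B: "B \<ge> 0" "\<And>a. norm (of_real a * integral {0..t} (\<lambda>\<tau>. cis (a * \<tau>) * h1 \<tau>)) \<le> B"
    using norm_integral_cis_decay[OF t h(2,3)] by blast
  have X1: "inv_power_bound 1 ?X1"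
  proof (rule inv_power_boundI)
    fix l :: real assume l: "l \<ge> 1"
    have "norm (?X1 l) * \<bar>l\<bar> \<le> norm (?X1 l) * rho m l"
      by (intro mult_left_mono rho_ge_frequency) auto
    also have "\<dots> \<le> B"
      using B(2)[of "s * rho m l"] s rho_nonneg[of m l] by (simp add: norm_mult abs_mult mult.commute)
    finally show "norm (?X1 l) \<le> B / l ^ 1" using l by (simp add: field_simps)
  qed
  have parts: "?X l * u l = (cis (s * rho m l * t) * h0 t - h0 0 - ?X1 l) * v l" if "l \<ge> 1" for l
  proof -
    have "?X l * u l = (\<i> * of_real (s * rho m l) * ?X l) * v l"
      using rho_pos[of l m] that s0 by (simp add: v_def)
    then show ?thesis by (simp only: integral_cis_by_parts[OF t h(1) ch(2)])
  qed
  have cX: "continuous_on UNIV ?X"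
  proof -
    have "continuous_on (UNIV \<times> {0..t}) (\<lambda>q. h0 (snd q))"
      by (intro continuous_on_compose2[OF ch(1)] continuous_intros) auto
    then have "continuous_on UNIV (\<lambda>l. integral (cbox 0 t) (\<lambda>\<tau>. cis (s * rho m l * \<tau>) * h0 \<tau>))"
      by (intro integral_continuous_on_param) (auto simp: split_def intro!: continuous_intros)
    then show ?thesis by simp
  qed
  obtain K where K: "\<And>l. 0 \<le> l \<Longrightarrow> l \<le> 1 \<Longrightarrow> norm (?X l) \<le> K"
    using continuous_bounded_unit_interval[OF cX] by blast
  have "half_conv (\<lambda>l. ?c1 l * (?X l * u l))"
  proof (rule half_conv_oscillating[where a = "h0 t * w" and b = "- h0 0 * w" and \<xi> = y and \<eta> = "y - s * t"])
    show "continuous_on {0<..} (\<lambda>l. ?c1 l * (?X l * u l))"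
      unfolding u_def by (intro continuous_intros continuous_on_subset[OF cX]) (auto simp: rho_eq_0_iff)
    fix l :: real assume l: "0 < l" "l \<le> 1"
    have R: "rho m l > 0" "l \<le> rho m l" "\<bar>m\<bar> \<le> rho m l"
      using rho_pos[of l m] rho_ge_frequency[of l m] rho_ge_mass[of m l] l by auto
    have "norm (u l) \<le> (norm \<alpha> * rho m l + norm \<beta> * rho m l + rho m l) / rho m l"
      unfolding u_def norm_divide using R l \<kappa>
      by (intro frac_le order_trans[OF norm_triangle_ineq] add_mono)
         (auto simp: norm_mult intro!: mult_left_mono)
    also have "\<dots> = norm \<alpha> + norm \<beta> + 1" using R by (simp add: field_simps)
    finally show "norm (?c1 l * (?X l * u l)) \<le> K * (norm \<alpha> + norm \<beta> + 1)"
      using K[of l] l order_trans[OF norm_ge_zero K[of l]] unfolding norm_mult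
      by (simp add: mult_mono)
  next
    show "inv_power_bound 2 (\<lambda>l. ?c1 l * (?X l * u l) - (h0 t * w * cis (y * l) + - h0 0 * w * ?c2 l) / of_real l)"
    proof (rule inv_power_bound_transfer)
      show "inv_power_bound 2 (\<lambda>l. h0 t * (cis (y * l) * (v l - w / of_real l))
        - h0 0 * ((?c1 l - ?c2 l) * v l + ?c2 l * (v l - w / of_real l)) - ?c1 l * (?X1 l * v l))"
        by (intro inv_power_bound_add inv_power_bound_diff inv_power_bound_cmult inv_power_bound_mult_1_1
            inv_power_bound_mult_0 inv_power_bound_cis phase_error v_asy v1 X1)
      fix l :: real assume l: "l \<ge> 1"
      have "?c1 l * cis (s * rho m l * t) = cis (y * l)" by (simp add: cis_mult mult.commute)
      then have "?c1 l * (?X l * u l) = (h0 t * cis (y * l) - ?c1 l * h0 0 - ?c1 l * ?X1 l) * v l"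
        unfolding parts[OF l] by (simp add: algebra_simps) 
      then show "h0 t * (cis (y * l) * (v l - w / of_real l))
        - h0 0 * ((?c1 l - ?c2 l) * v l + ?c2 l * (v l - w / of_real l)) - ?c1 l * (?X1 l * v l)
        = ?c1 l * (?X l * u l) - (h0 t * w * cis (y * l) + - h0 0 * w * ?c2 l) / of_real l"
        by (simp add: ring_distribs add_divide_distrib diff_divide_distrib mult.assoc mult.left_commute mult.commute)
    qed
  qed (use ne in auto)
  then show ?thesis by (simp add: u_def mult.assoc)
qed

section \<open>The frequency-side Dirac system\<close>

text \<open>The growth of solutions does not depend on \<open>l\<close>, because the matrix of the system is Hermitian. In
terms of the left eigenvectors \<open>(m + s rho, l)\<close> with \<open>s = \<plusminus> 1\<close> the system decouples, and the first
component is half the difference of the two eigencomponents divided by \<open>rho\<close>.\<close>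

lemma dirac_bound_first:
  fixes y1 y2 E1 E2 :: "real \<Rightarrow> complex"
  assumes l: "l > 0"
    and y1: "\<And>t. t \<in> {0..1} \<Longrightarrow> (y1 has_vector_derivative - \<i> * (of_real m * y1 t + of_real l * y2 t) + E1 t) (at t
        within {0..1})"
    and y2: "\<And>t. t \<in> {0..1} \<Longrightarrow> (y2 has_vector_derivative - \<i> * (of_real l * y1 t - of_real m * y2 t) + E2 t) (at t
        within {0..1})"
    and init: "norm (y1 0) \<le> e" "norm (y2 0) \<le> e"
    and E: "\<And>t. t \<in> {0..1} \<Longrightarrow> norm (E1 t) \<le> e" "\<And>t. t \<in> {0..1} \<Longrightarrow> norm (E2 t) \<le> e"
    and t: "t \<in> {0..1}"
  shows "norm (y1 t) \<le> 6 * e"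
proof -
  define r where "r = rho m l"
  have r: "r > 0" "l \<le> r" "\<bar>m\<bar> \<le> r" "r\<^sup>2 = l\<^sup>2 + m\<^sup>2"
    using rho_pos[of l m] rho_ge_frequency[of l m] rho_ge_mass[of m l] rho_square[of m l] l by (auto simp: r_def)
  \<comment> \<open>the factor \<open>cis (s r t)\<close> removes the homogeneous part of the equation of an eigencomponent\<close>
  define z where "z s t = cis (s * r * t) * ((of_real m + of_real (s * r)) * y1 t + of_real l * y2 t)" for s t
  have e: "e \<ge> 0" using order_trans[OF norm_ge_zero init(1)] .
  have coeff: "norm ((of_real m + of_real (s * r)) * a + of_real l * b) \<le> 3 * r * e"
    if "\<bar>s\<bar> = 1" "norm a \<le> e" "norm b \<le> e" for s and a b :: complex
  proof -
    have "norm (complex_of_real m + of_real (s * r)) \<le> 2 * r"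
      using norm_triangle_ineq[of "complex_of_real m" "of_real (s * r)"] that r
      by (simp add: norm_mult)
    then have "norm ((of_real m + of_real (s * r)) * a) \<le> 2 * r * e"
      unfolding norm_mult using that r by (intro mult_mono) auto
    moreover have "norm (of_real l * b) \<le> r * e"
      unfolding norm_mult using that r l e by (intro mult_mono) auto
    ultimately show ?thesis using norm_triangle_ineq[of "(of_real m + of_real (s * r)) * a" "of_real l * b"] by
        linarith
  qed
  have z: "norm (z s t) \<le> 6 * r * e" if s: "\<bar>s\<bar> = 1" for s
  proof -
    have s2: "(complex_of_real s)\<^sup>2 = 1" using s by (auto simp: abs_if split: if_splits)
    have "norm (z s t - z s 0) \<le> (3 * r * e) * \<bar>t - 0\<bar>"
    proof (rule norm_diff_le_derivative_bound[where Y = "{0..1}"])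
      fix u :: real assume u: "u \<in> {0..1}"
      have "(z s has_vector_derivative
         cis (s * r * u) * ((of_real m + of_real (s * r)) * (- \<i> * (of_real m * y1 u + of_real l * y2 u) + E1 u)
             + of_real l * (- \<i> * (of_real l * y1 u - of_real m * y2 u) + E2 u))
         + \<i> * of_real (s * r) * cis (s * r * u) * ((of_real m + of_real (s * r)) * y1 u + of_real l * y2 u))
         (at u within {0..1})"
        unfolding z_def
        by (intro has_vector_derivative_mult cis_has_vector_derivative has_vector_derivative_add
              has_vector_derivative_mult_right y1 y2 u)
      moreover have "cis (s * r * u) * ((of_real m + of_real (s * r)) * (- \<i> * (of_real m * y1 u + of_real l * y2 u)
          + E1 u)
             + of_real l * (- \<i> * (of_real l * y1 u - of_real m * y2 u) + E2 u))
         + \<i> * of_real (s * r) * cis (s * r * u) * ((of_real m + of_real (s * r)) * y1 u + of_real l * y2 u)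
         = cis (s * r * u) * ((of_real m + of_real (s * r)) * E1 u + of_real l * E2 u)"
      proof -
        have R: "(complex_of_real r)\<^sup>2 = (of_real l)\<^sup>2 + (of_real m)\<^sup>2"
          using r(4) by (simp flip: of_real_power of_real_add)
        show ?thesis unfolding of_real_mult using s2 R by algebra
      qed
      ultimately show "(z s has_vector_derivative cis (s * r * u) * ((of_real m + of_real (s * r)) * E1 u + of_real l
          * E2 u)) (at u within {0..1})"
        by simp
      show "norm (cis (s * r * u) * ((of_real m + of_real (s * r)) * E1 u + of_real l * E2 u)) \<le> 3 * r * e"
        using coeff[OF s E(1)[OF u] E(2)[OF u]] by (simp add: norm_mult)
    qed (use t in auto)
    also have "\<dots> \<le> 3 * r * e" using t r e by (simp add: mult_left_le)
    finally have "norm (z s t - z s 0) \<le> 3 * r * e" .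
    moreover have "norm (z s 0) \<le> 3 * r * e"
      unfolding z_def using coeff[OF s init] by (simp add: norm_mult)
    ultimately show ?thesis using norm_triangle_sub[of "z s t" "z s 0"] by linarith
  qed
  have "cis (- (r * t)) * z 1 t - cis (r * t) * z (-1) t
      = ((of_real m + of_real r) * y1 t + of_real l * y2 t) - ((of_real m - of_real r) * y1 t + of_real l * y2 t)"
    unfolding z_def mult.assoc[symmetric] cis_mult by simp
  then have "y1 t = (cis (- (r * t)) * z 1 t - cis (r * t) * z (-1) t) / of_real (2 * r)"
    using r by (simp add: field_simps)
  then have "norm (y1 t) = norm (cis (- (r * t)) * z 1 t - cis (r * t) * z (-1) t) / (2 * r)"
    using r by (simp add: norm_divide)
  also have "\<dots> \<le> (6 * r * e + 6 * r * e) / (2 * r)"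
    using r z[of 1] z[of "-1"]
    by (intro divide_right_mono order_trans[OF norm_triangle_ineq4] add_mono) (auto simp: norm_mult)
  also have "\<dots> = 6 * e" using r by (simp add: field_simps)
  finally show ?thesis .
qed

text \<open>Exchanging the two components amounts to changing the sign of \<open>m\<close>, so the estimate for the second
component is an instance of that for the first.\<close>

lemma dirac_bound:
  fixes y1 y2 E1 E2 :: "real \<Rightarrow> complex"
  assumes "l > 0"
    and "\<And>t. t \<in> {0..1} \<Longrightarrow> (y1 has_vector_derivative - \<i> * (of_real m * y1 t + of_real l * y2 t) + E1 t) (at t within
        {0..1})"
    and "\<And>t. t \<in> {0..1} \<Longrightarrow> (y2 has_vector_derivative - \<i> * (of_real l * y1 t - of_real m * y2 t) + E2 t) (at t within
        {0..1})"
    and "norm (y1 0) \<le> e" "norm (y2 0) \<le> e"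
    and "\<And>t. t \<in> {0..1} \<Longrightarrow> norm (E1 t) \<le> e" "\<And>t. t \<in> {0..1} \<Longrightarrow> norm (E2 t) \<le> e"
    and "t \<in> {0..1}"
  shows "norm (y1 t) \<le> 6 * e" "norm (y2 t) \<le> 6 * e"
proof -
  show "norm (y1 t) \<le> 6 * e"
    by (rule dirac_bound_first[of l y1 m y2 E1 E2]) (use assms in auto)
  have swap: "(y2 has_vector_derivative - \<i> * (of_real (- m) * y2 t + of_real l * y1 t) + E2 t) (at t within {0..1})"
    "(y1 has_vector_derivative - \<i> * (of_real l * y2 t - of_real (- m) * y1 t) + E1 t) (at t within {0..1})"
    if "t \<in> {0..1}" for t
    using assms(2,3)[OF that] by (simp_all add: algebra_simps)
  show "norm (y2 t) \<le> 6 * e"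
    by (rule dirac_bound_first[of l y2 "- m" y1 E2 E1, OF assms(1) swap]) (use assms in auto)
qed

text \<open>The first component of \<open>exp (- \<i> t H) G + \<integral> exp (- \<i> (t - \<tau>) H) R d\<tau>\<close>, written out in the
eigenprojections of \<open>H\<close>. The second component is obtained by exchanging the components of the data
and changing the sign of \<open>m\<close>.\<close>

definition duhamel :: "real \<Rightarrow> complex \<Rightarrow> complex \<Rightarrow> (real \<Rightarrow> complex) \<Rightarrow> (real \<Rightarrow> complex) \<Rightarrow> real \<Rightarrow> real \<Rightarrow> complex" where
  "duhamel m Ga Gb Ra Rb l t =
     (let r = rho m l; I = (\<lambda>s R. integral {0..t} (\<lambda>\<tau>. cis (s * r * \<tau>) * R \<tau>)) in
      (cis (- (r * t)) * (of_real (m + r) * (Ga + I 1 Ra) + of_real l * (Gb + I 1 Rb))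
       - cis (r * t) * (of_real (m - r) * (Ga + I (-1) Ra) + of_real l * (Gb + I (-1) Rb))) / of_real (2 * r))"

lemma duhamel_0: "l > 0 \<Longrightarrow> duhamel m Ga Gb Ra Rb l 0 = Ga"
  using rho_pos[of l m] by (simp add: duhamel_def field_simps)

lemma duhamel_derivative:
  assumes l: "l > 0" and t: "t \<in> {0..1}"
    and cont: "continuous_on {0..1} Ra" "continuous_on {0..1} Rb"
  shows "(duhamel m Ga Gb Ra Rb l has_vector_derivative
     - \<i> * (of_real m * duhamel m Ga Gb Ra Rb l t + of_real l * duhamel (- m) Gb Ga Rb Ra l t) + Ra t) (at t within
         {0..1})"
proof -
  define r where "r = rho m l"
  have r: "r > 0" "r\<^sup>2 = l\<^sup>2 + m\<^sup>2" using rho_pos[of l m] rho_square[of m l] l by (auto simp: r_def)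
  define Y where "Y s G R t = G + integral {0..t} (\<lambda>\<tau>. cis (s * r * \<tau>) * R \<tau>)" for s and G :: complex and R t
  have D: "duhamel m Ga Gb Ra Rb l = (\<lambda>t. (cis (- r * t) * (of_real (m + r) * Y 1 Ga Ra t + of_real l * Y 1 Gb Rb t)
       - cis (r * t) * (of_real (m - r) * Y (-1) Ga Ra t + of_real l * Y (-1) Gb Rb t)) / of_real (2 * r))"
    and D': "duhamel (- m) Gb Ga Rb Ra l = (\<lambda>t. (cis (- r * t) * (of_real (- m + r) * Y 1 Gb Rb t + of_real l * Y 1
        Ga Ra t)
       - cis (r * t) * (of_real (- m - r) * Y (-1) Gb Rb t + of_real l * Y (-1) Ga Ra t)) / of_real (2 * r))"
    by (auto simp: duhamel_def Let_def Y_def r_def fun_eq_iff)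
  have Y: "(Y s G R has_vector_derivative cis (s * r * t) * R t) (at t within {0..1})"
    if "continuous_on {0..1} R" for s G R
  proof -
    have "((\<lambda>t. G + integral {0..t} (\<lambda>\<tau>. cis (s * r * \<tau>) * R \<tau>)) has_vector_derivative 0 + cis (s * r * t) * R t) (at
        t within {0..1})"
      by (intro has_vector_derivative_add has_vector_derivative_const integral_has_vector_derivative t
          continuous_intros that)
    then show ?thesis by (simp add: Y_def[abs_def])
  qed
  define c where "c = cis (r * t)"
  define d where "d = cis (- r * t)"
  have cd: "c * d = 1" by (simp add: c_def d_def cis_mult)
  have "(duhamel m Ga Gb Ra Rb l has_vector_derivative
     ((d * (of_real (m + r) * (c * Ra t) + of_real l * (c * Rb t))
        + \<i> * of_real (- r) * d * (of_real (m + r) * Y 1 Ga Ra t + of_real l * Y 1 Gb Rb t))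
      - (c * (of_real (m - r) * (d * Ra t) + of_real l * (d * Rb t))
        + \<i> * of_real r * c * (of_real (m - r) * Y (-1) Ga Ra t + of_real l * Y (-1) Gb Rb t))) / of_real (2 * r))
            (at t within {0..1})"
    unfolding D using Y[OF cont(1), of 1 Ga] Y[OF cont(2), of 1 Gb] Y[OF cont(1), of "-1" Ga] Y[OF cont(2), of "-1"
        Gb]
      cis_has_vector_derivative[of "- r" t "{0..1}"] cis_has_vector_derivative[of r t "{0..1}"]
    unfolding c_def d_def
    by (intro has_vector_derivative_divide has_vector_derivative_diff has_vector_derivative_mult
        has_vector_derivative_add has_vector_derivative_mult_right) simp_all
  moreover have "((d * (of_real (m + r) * (c * Ra t) + of_real l * (c * Rb t))
        + \<i> * of_real (- r) * d * (of_real (m + r) * Y 1 Ga Ra t + of_real l * Y 1 Gb Rb t))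
      - (c * (of_real (m - r) * (d * Ra t) + of_real l * (d * Rb t))
        + \<i> * of_real r * c * (of_real (m - r) * Y (-1) Ga Ra t + of_real l * Y (-1) Gb Rb t))) / of_real (2 * r)
     = - \<i> * (of_real m * duhamel m Ga Gb Ra Rb l t + of_real l * duhamel (- m) Gb Ga Rb Ra l t) + Ra t"
  proof -
    have R: "(complex_of_real r)\<^sup>2 = (of_real l)\<^sup>2 + (of_real m)\<^sup>2"
      using r(2) by (simp flip: of_real_power of_real_add)
    let ?P = "d * (of_real (m + r) * Y 1 Ga Ra t + of_real l * Y 1 Gb Rb t)
       - c * (of_real (m - r) * Y (-1) Ga Ra t + of_real l * Y (-1) Gb Rb t)"
    let ?Q = "d * (of_real (- m + r) * Y 1 Gb Rb t + of_real l * Y 1 Ga Ra t)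
       - c * (of_real (- m - r) * Y (-1) Gb Rb t + of_real l * Y (-1) Ga Ra t)"
    have frac: "(- \<i> * (a * P + b * Q) + e * w) / w = - \<i> * (a * (P / w) + b * (Q / w)) + e"
      if "w \<noteq> 0" for a b P Q e w :: complex using that by (simp add: field_simps)
    have num: "(d * (of_real (m + r) * (c * Ra t) + of_real l * (c * Rb t))
        + \<i> * of_real (- r) * d * (of_real (m + r) * Y 1 Ga Ra t + of_real l * Y 1 Gb Rb t))
      - (c * (of_real (m - r) * (d * Ra t) + of_real l * (d * Rb t))
        + \<i> * of_real r * c * (of_real (m - r) * Y (-1) Ga Ra t + of_real l * Y (-1) Gb Rb t))
      = - \<i> * (of_real m * ?P + of_real l * ?Q) + Ra t * of_real (2 * r)"
      unfolding of_real_add of_real_diff of_real_minus of_real_mult of_real_numeral using cd R by algebra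
    show ?thesis
      unfolding num D D' c_def[symmetric] d_def[symmetric] by (rule frac) (use r in simp)
  qed
  ultimately show ?thesis by simp
qed

lemma duhamel_continuous:
  assumes G: "continuous_on UNIV Ga" "continuous_on UNIV Gb"
    and R: "continuous_on (UNIV \<times> {0..1}) (\<lambda>(l, \<tau>). Ra l \<tau>)" "continuous_on (UNIV \<times> {0..1}) (\<lambda>(l, \<tau>). Rb l \<tau>)"
    and t: "t \<in> {0..1}"
  shows "continuous_on {0<..} (\<lambda>l. duhamel m (Ga l) (Gb l) (Ra l) (Rb l) l t)"
proof -
  have I: "continuous_on {0<..} (\<lambda>l. integral {0..t} (\<lambda>\<tau>. cis (s * rho m l * \<tau>) * R l \<tau>))"
    if "continuous_on (UNIV \<times> {0..1}) (\<lambda>(l, \<tau>). R l \<tau>)" for R :: "real \<Rightarrow> real \<Rightarrow> complex" and s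
  proof -
    have "continuous_on (UNIV \<times> {0..t}) (\<lambda>q. R (fst q) (snd q))"
      by (rule continuous_on_subset[OF that[unfolded split_def]]) (use t in auto)
    then have "continuous_on UNIV (\<lambda>l. integral (cbox 0 t) (\<lambda>\<tau>. cis (s * rho m l * \<tau>) * R l \<tau>))"
      by (intro integral_continuous_on_param) (auto simp: split_def intro!: continuous_intros)
    then show ?thesis by (auto intro: continuous_on_subset)
  qed
  have Gc: "continuous_on {0<..} Ga" "continuous_on {0<..} Gb"
    using G by (auto intro: continuous_on_subset)
  note Ic = I[OF R(1), of 1] I[OF R(1), of "-1"] I[OF R(2), of 1] I[OF R(2), of "-1"]
  have "\<forall>l\<in>{0<..}. complex_of_real (2 * rho m l) \<noteq> 0" by (simp add: rho_eq_0_iff)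
  then show ?thesis
    unfolding duhamel_def Let_def using Ic Gc
    by (intro continuous_on_divide continuous_on_diff continuous_on_mult continuous_on_add continuous_on_of_real
          continuous_on_cis continuous_on_minus continuous_on_const continuous_on_id continuous_on_rho)
qed

text \<open>What is needed of an amplitude \<open>f\<close> so that its sine and cosine transforms over \<open>K\<close> are \<open>C1\<close> in space
and time up to \<open>t = 0\<close>: a space derivative costs a factor \<open>l\<close>, a time derivative replaces \<open>f\<close> by
\<open>f'\<close>.\<close>

definition controlled :: "real set \<Rightarrow> (real \<Rightarrow> real \<Rightarrow> complex) \<Rightarrow> (real \<Rightarrow> real \<Rightarrow> complex) \<Rightarrow> bool" where
  "controlled K f f' \<longleftrightarrow>
     (\<exists>w. w integrable_on K \<and>
       (\<forall>l\<in>K. \<forall>t\<in>{0..1}. (1 + \<bar>l\<bar>) * norm (f l t) \<le> w l \<and> norm (f' l t) \<le> w l)) \<and>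
     (\<forall>l\<in>K. \<forall>t\<in>{0..1}. (f l has_vector_derivative f' l t) (at t within {0..1})) \<and>
     (\<forall>l\<in>K. continuous_on {0..1} (f' l)) \<and>
     (\<forall>t\<in>{0..1}. continuous_on K (\<lambda>l. f l t))"

lemma controlledI:
  assumes "w integrable_on K"
    and "\<And>l t. l \<in> K \<Longrightarrow> t \<in> {0..1} \<Longrightarrow> (1 + \<bar>l\<bar>) * norm (f l t) \<le> w l"
    and "\<And>l t. l \<in> K \<Longrightarrow> t \<in> {0..1} \<Longrightarrow> norm (f' l t) \<le> w l"
    and "\<And>l t. l \<in> K \<Longrightarrow> t \<in> {0..1} \<Longrightarrow> (f l has_vector_derivative f' l t) (at t within {0..1})"
    and "\<And>l. l \<in> K \<Longrightarrow> continuous_on {0..1} (f' l)"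
    and "\<And>t. t \<in> {0..1} \<Longrightarrow> continuous_on K (\<lambda>l. f l t)"
  shows "controlled K f f'"
  using assms unfolding controlled_def by blast

lemma controlled_add:
  assumes "controlled K f f'" "controlled K g g'"
  shows "controlled K (\<lambda>l t. f l t + g l t) (\<lambda>l t. f' l t + g' l t)"
proof -
  obtain w where w: "w integrable_on K"
    "\<forall>l\<in>K. \<forall>t\<in>{0..1}. (1 + \<bar>l\<bar>) * norm (f l t) \<le> w l \<and> norm (f' l t) \<le> w l"
    using assms(1) unfolding controlled_def by blast
  obtain v where v: "v integrable_on K"
    "\<forall>l\<in>K. \<forall>t\<in>{0..1}. (1 + \<bar>l\<bar>) * norm (g l t) \<le> v l \<and> norm (g' l t) \<le> v l"
    using assms(2) unfolding controlled_def by blast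
  have "(1 + \<bar>l\<bar>) * norm (f l t + g l t) \<le> w l + v l \<and> norm (f' l t + g' l t) \<le> w l + v l"
    if "l \<in> K" "t \<in> {0..1}" for l t
  proof -
    have "(1 + \<bar>l\<bar>) * norm (f l t + g l t) \<le> (1 + \<bar>l\<bar>) * (norm (f l t) + norm (g l t))"
      by (intro mult_left_mono norm_triangle_ineq) simp
    then show ?thesis
      using w(2)[rule_format, OF that] v(2)[rule_format, OF that] norm_triangle_ineq[of "f' l t" "g' l t"]
      by (simp add: distrib_left)
  qed
  then show ?thesis
    using assms unfolding controlled_def[of K f] controlled_def[of K g]
    by (intro controlledI[OF integrable_add[OF w(1) v(1)]])
       (auto intro!: has_vector_derivative_add continuous_on_add)
qed

lemma controlled_highI:
  assumes "\<And>l t. l \<ge> 1 \<Longrightarrow> t \<in> {0..1} \<Longrightarrow> (f l has_vector_derivative f' l t) (at t within {0..1})"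
    and le: "\<And>l t. l \<ge> 1 \<Longrightarrow> t \<in> {0..1} \<Longrightarrow> norm (f l t) \<le> C / l ^ 3"
    "\<And>l t. l \<ge> 1 \<Longrightarrow> t \<in> {0..1} \<Longrightarrow> norm (f' l t) \<le> C / l\<^sup>2"
    and "\<And>l. l \<ge> 1 \<Longrightarrow> continuous_on {0..1} (f' l)"
    and "\<And>t. t \<in> {0..1} \<Longrightarrow> continuous_on {1..} (\<lambda>l. f l t)"
  shows "controlled {1..} f f'"
proof -
  have "(1 + \<bar>l\<bar>) * norm (f l t) \<le> 2 * C / l\<^sup>2 \<and> norm (f' l t) \<le> 2 * C / l\<^sup>2" if l: "l \<ge> 1" and t: "t \<in> {0..1}" for l
      t
  proof -
    have C: "C \<ge> 0" using order_trans[OF norm_ge_zero le(2)[of 1 t]] t by simp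
    have "(1 + \<bar>l\<bar>) * norm (f l t) \<le> (2 * l) * (C / l ^ 3)"
      using le(1)[OF l t] l by (intro mult_mono) auto
    also have "\<dots> = 2 * C / l\<^sup>2" using l by (simp add: power2_eq_square power3_eq_cube)
    finally have "(1 + \<bar>l\<bar>) * norm (f l t) \<le> 2 * C / l\<^sup>2" .
    moreover have "C / l\<^sup>2 \<le> 2 * C / l\<^sup>2" using C by (intro divide_right_mono) auto
    ultimately show ?thesis using le(2)[OF l t] by linarith
  qed
  then show ?thesis
    using assms integrable_inverse_square[of "2 * C"] unfolding controlled_def by auto
qed

lemma controlled_cong:
  assumes "controlled K f f'" "\<And>l t. l \<in> K \<Longrightarrow> f l t = g l t"
  shows "controlled K g f'"
proof -
  have *: "f l = g l" if "l \<in> K" for l using assms(2)[OF that] by (intro ext)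
  have "continuous_on K (\<lambda>l. f l t) \<longleftrightarrow> continuous_on K (\<lambda>l. g l t)" for t
    by (rule continuous_on_cong) (use assms(2) in auto)
  then show ?thesis using assms(1) unfolding controlled_def by (simp add: * cong: ball_cong_simp)
qed

lemma integrable_on_Ioc_iff:
  fixes f :: "real \<Rightarrow> 'a::banach"
  shows "f integrable_on {a<..b} \<longleftrightarrow> f integrable_on {a..b}"
  by (rule integrable_spike_set_eq) (rule negligible_subset[of "{a}"], auto)

lemma integral_Ioc_eq:
  fixes f :: "real \<Rightarrow> 'a::banach"
  shows "integral {a<..b} f = integral {a..b} f"
  by (rule integral_spike_set) (rule negligible_subset[of "{a}"], auto)+

lemma continuous_unit_square_bound:
  fixes F :: "real \<Rightarrow> real \<Rightarrow> complex"
  assumes "continuous_on (UNIV \<times> {0..1}) (\<lambda>(l, \<tau>). F l \<tau>)"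
  obtains c where "\<And>l \<tau>. l \<in> {0..1} \<Longrightarrow> \<tau> \<in> {0..1} \<Longrightarrow> norm (F l \<tau>) \<le> c"
proof -
  have "bounded ((\<lambda>(l, \<tau>). F l \<tau>) ` ({0..1} \<times> {0..1}))"
    by (intro compact_imp_bounded compact_continuous_image compact_Times continuous_on_subset[OF assms]) auto
  then obtain c where "\<forall>p\<in>{0..1} \<times> {0..1}. norm ((\<lambda>(l, \<tau>). F l \<tau>) p) \<le> c"
    unfolding bounded_iff by blast
  then show ?thesis by (intro that[of c]) auto
qed

lemma norm_over_power_le: "norm a \<le> A \<Longrightarrow> L > 0 \<Longrightarrow> norm (a / complex_of_real L ^ k) \<le> A / L ^ k"
  by (simp add: norm_divide norm_power divide_right_mono)

text \<open>Initial values \<open>G1\<close>, \<open>G2\<close> and sources \<open>R1\<close>, \<open>R2\<close> of the system on the frequency side, with the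
asymptotic expansions that transforms of smooth functions on the half-line have. The sequences \<open>r0\<close>,
\<open>r1\<close>, \<open>r2\<close> list coefficients together with their time derivatives. That the same \<open>r0\<close> occurs in the
expansion of \<open>R2\<close>, where it comes from the boundary value, and in that of \<open>G1\<close>, where it comes from
the initial value, is the compatibility condition \<open>h1 0 = g1 0\<close>.\<close>

locale half_line_data =
  fixes m :: real and G1 G2 :: "real \<Rightarrow> complex" and R1 R2 :: "real \<Rightarrow> real \<Rightarrow> complex"
    and r0 r1 r2 :: "nat \<Rightarrow> real \<Rightarrow> complex" and \<gamma> :: complex and C :: real
  assumes G_cont: "continuous_on UNIV G1" "continuous_on UNIV G2"
    and R_cont: "continuous_on (UNIV \<times> {0..1}) (\<lambda>(l, \<tau>). R1 l \<tau>)" "continuous_on (UNIV \<times> {0..1}) (\<lambda>(l, \<tau>). R2 l \<tau>)"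
    and r_deriv: "\<And>k \<tau>. \<tau> \<in> {0..1} \<Longrightarrow> (r0 k has_vector_derivative r0 (Suc k) \<tau>) (at \<tau> within {0..1})"
      "\<And>k \<tau>. \<tau> \<in> {0..1} \<Longrightarrow> (r1 k has_vector_derivative r1 (Suc k) \<tau>) (at \<tau> within {0..1})"
      "\<And>k \<tau>. \<tau> \<in> {0..1} \<Longrightarrow> (r2 k has_vector_derivative r2 (Suc k) \<tau>) (at \<tau> within {0..1})"
    and G_asy: "\<And>l. l \<ge> 1 \<Longrightarrow> norm (G1 l + \<i> * r0 0 0 / of_real l) \<le> C / l ^ 3"
      "\<And>l. l \<ge> 1 \<Longrightarrow> norm (G2 l - \<gamma> / (of_real l)\<^sup>2) \<le> C / l ^ 3"
    and R_asy: "\<And>l \<tau>. l \<ge> 1 \<Longrightarrow> \<tau> \<in> {0..1} \<Longrightarrow> norm (R1 l \<tau> - r1 0 \<tau> / of_real l) \<le> C / l ^ 3"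
      "\<And>l \<tau>. l \<ge> 1 \<Longrightarrow> \<tau> \<in> {0..1} \<Longrightarrow> norm (R2 l \<tau> - (r0 0 \<tau> + r2 0 \<tau> / (of_real l)\<^sup>2)) \<le> C / l ^ 3"
begin

definition Amp1 :: "real \<Rightarrow> real \<Rightarrow> complex" where "Amp1 l = duhamel m (G1 l) (G2 l) (R1 l) (R2 l) l"
definition Amp2 :: "real \<Rightarrow> real \<Rightarrow> complex" where "Amp2 l = duhamel (- m) (G2 l) (G1 l) (R2 l) (R1 l) l"

text \<open>The coefficients in the formal solution \<open>(- \<i> r0 / l + third_order / l ^ 3, second_order / l\<^sup>2)\<close> of
the system; \<open>second_order\<close> cancels the terms of order \<open>1 / l\<close> in the first equation and
\<open>third_order\<close> those of order \<open>1 / l\<^sup>2\<close> in the second.\<close>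

definition second_order :: "nat \<Rightarrow> real \<Rightarrow> complex" where
  "second_order k \<tau> = - \<i> * r1 k \<tau> + r0 (Suc k) \<tau> + \<i> * of_real m * r0 k \<tau>"

definition third_order :: "nat \<Rightarrow> real \<Rightarrow> complex" where
  "third_order k \<tau> = - \<i> * r2 k \<tau> + \<i> * second_order (Suc k) \<tau> + of_real m * second_order k \<tau>"

text \<open>The mismatch at order \<open>1 / l\<^sup>2\<close> between the initial value and the formal solution. It causes the
singularity that travels along the diagonal.\<close>

definition wave_coeff :: complex where "wave_coeff = \<gamma> - second_order 0 0"

lemma second_order_deriv: "\<tau> \<in> {0..1} \<Longrightarrow> (second_order k has_vector_derivative second_order (Suc k) \<tau>) (at \<tau> within
    {0..1})"
  unfolding second_order_def by (intro has_vector_derivative_add has_vector_derivative_mult_right r_deriv)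

lemma third_order_deriv: "\<tau> \<in> {0..1} \<Longrightarrow> (third_order k has_vector_derivative third_order (Suc k) \<tau>) (at \<tau> within
    {0..1})"
  unfolding third_order_def by (intro has_vector_derivative_add has_vector_derivative_mult_right r_deriv
      second_order_deriv)

lemma third_order_cont: "continuous_on {0..1} (third_order k)"
  by (rule continuous_on_vector_derivative) (rule third_order_deriv)

lemma R_cont1: "continuous_on {0..1} (R1 l)" "continuous_on {0..1} (R2 l)"
  using continuous_on_compose2[OF R_cont(1), of "{0..1}" "\<lambda>\<tau>. (l, \<tau>)"]
    continuous_on_compose2[OF R_cont(2), of "{0..1}" "\<lambda>\<tau>. (l, \<tau>)"]
  by (force intro: continuous_intros)+

lemma Amp_deriv:
  assumes "l > 0" "t \<in> {0..1}"
  shows "(Amp1 l has_vector_derivative - \<i> * (of_real m * Amp1 l t + of_real l * Amp2 l t) + R1 l t) (at t within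
      {0..1})"
    and "(Amp2 l has_vector_derivative - \<i> * (of_real l * Amp1 l t - of_real m * Amp2 l t) + R2 l t) (at t within
        {0..1})"
  using duhamel_derivative[OF assms R_cont1(1,2), where m = m and Ga = "G1 l" and Gb = "G2 l"]
    duhamel_derivative[OF assms R_cont1(2,1), where m = "- m" and Ga = "G2 l" and Gb = "G1 l"]
  unfolding Amp1_def Amp2_def by (simp_all add: algebra_simps)

lemma Amp_init: "l > 0 \<Longrightarrow> Amp1 l 0 = G1 l" "l > 0 \<Longrightarrow> Amp2 l 0 = G2 l"
  by (simp_all add: Amp1_def Amp2_def duhamel_0)

lemma Amp_cont: "t \<in> {0..1} \<Longrightarrow> continuous_on {0<..} (\<lambda>l. Amp1 l t)" "t \<in> {0..1} \<Longrightarrow> continuous_on {0<..} (\<lambda>l. Amp2 l t)"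
  unfolding Amp1_def Amp2_def using duhamel_continuous G_cont R_cont by blast+

lemma Amp_cont_time:
  assumes "l > 0" shows "continuous_on {0..1} (Amp1 l)" "continuous_on {0..1} (Amp2 l)"
  by (rule continuous_on_vector_derivative, rule Amp_deriv[OF assms], assumption)+

text \<open>For bounded \<open>l\<close> the data are bounded, and \<open>dirac_bound\<close> carries this over to the solution with a
constant that does not degenerate as \<open>l\<close> tends to \<open>0\<close>, even for \<open>m = 0\<close>.\<close>

lemma low_frequency:
  "controlled {0<..1} Amp1 (\<lambda>l t. - \<i> * (of_real m * Amp1 l t + of_real l * Amp2 l t) + R1 l t)"
  "controlled {0<..1} Amp2 (\<lambda>l t. - \<i> * (of_real l * Amp1 l t - of_real m * Amp2 l t) + R2 l t)"
proof -
  obtain c1 where c1: "\<And>l \<tau>. l \<in> {0..1} \<Longrightarrow> \<tau> \<in> {0..1} \<Longrightarrow> norm (R1 l \<tau>) \<le> c1"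
    using continuous_unit_square_bound[OF R_cont(1)] by blast
  obtain c2 where c2: "\<And>l \<tau>. l \<in> {0..1} \<Longrightarrow> \<tau> \<in> {0..1} \<Longrightarrow> norm (R2 l \<tau>) \<le> c2"
    using continuous_unit_square_bound[OF R_cont(2)] by blast
  obtain c3 where c3: "\<And>l. 0 \<le> l \<Longrightarrow> l \<le> 1 \<Longrightarrow> norm (G1 l) \<le> c3"
    using continuous_bounded_unit_interval[OF G_cont(1)] by blast
  obtain c4 where c4: "\<And>l. 0 \<le> l \<Longrightarrow> l \<le> 1 \<Longrightarrow> norm (G2 l) \<le> c4"
    using continuous_bounded_unit_interval[OF G_cont(2)] by blast
  define e where "e = max (max c1 c2) (max c3 c4)"
  have R: "norm (R1 l \<tau>) \<le> e" "norm (R2 l \<tau>) \<le> e" "norm (G1 l) \<le> e" "norm (G2 l) \<le> e"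
    if "0 < l" "l \<le> 1" "\<tau> \<in> {0..1}" for l \<tau>
    using c1[of l \<tau>] c2[of l \<tau>] c3[of l] c4[of l] that by (simp_all add: e_def le_max_iff_disj)
  have e: "e \<ge> 0" using order_trans[OF norm_ge_zero R(1)[of 1 0]] by simp
  have B: "norm (Amp1 l t) \<le> 6 * e" "norm (Amp2 l t) \<le> 6 * e" if "0 < l" "l \<le> 1" "t \<in> {0..1}" for l t
    by (rule dirac_bound[OF that(1) Amp_deriv[OF that(1)]];
        use Amp_init[OF that(1)] R[OF that(1,2)] that in simp)+
  define M where "M = 19 * e + \<bar>m\<bar> * (6 * e)"
  have F: "(1 + \<bar>l\<bar>) * norm (Amp1 l t) \<le> M \<and> norm (- \<i> * (of_real m * Amp1 l t + of_real l * Amp2 l t) + R1 l t) \<le> M"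
    "(1 + \<bar>l\<bar>) * norm (Amp2 l t) \<le> M \<and> norm (- \<i> * (of_real l * Amp1 l t - of_real m * Amp2 l t) + R2 l t) \<le> M"
    if l: "0 < l" "l \<le> 1" and t: "t \<in> {0..1}" for l t
  proof -
    have 1: "(1 + \<bar>l\<bar>) * norm (Amp1 l t) \<le> 2 * (6 * e)" "(1 + \<bar>l\<bar>) * norm (Amp2 l t) \<le> 2 * (6 * e)"
      using B[OF l t] l by (intro mult_mono; simp)+
    have 2: "norm (of_real m * Amp1 l t) \<le> \<bar>m\<bar> * (6 * e)" "norm (of_real m * Amp2 l t) \<le> \<bar>m\<bar> * (6 * e)"
      "norm (of_real l * Amp1 l t) \<le> 1 * (6 * e)" "norm (of_real l * Amp2 l t) \<le> 1 * (6 * e)"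
      unfolding norm_mult using B[OF l t] l by (intro mult_mono; simp)+
    have 3: "norm (- \<i> * (p + q) + R) \<le> norm p + norm q + norm R" "norm (- \<i> * (p - q) + R) \<le> norm p + norm q + norm
        R" for p q R :: complex
    proof -
      have "norm (- \<i> * p') = norm p'" for p' :: complex by (simp add: norm_mult)
      then show "norm (- \<i> * (p + q) + R) \<le> norm p + norm q + norm R" "norm (- \<i> * (p - q) + R) \<le> norm p + norm q +
          norm R"
        using norm_triangle_ineq[of "- \<i> * (p + q)" R] norm_triangle_ineq[of "- \<i> * (p - q)" R]
          norm_triangle_ineq[of p q] norm_triangle_ineq4[of p q] by (metis add_right_mono order_trans)+
    qed
    show "(1 + \<bar>l\<bar>) * norm (Amp1 l t) \<le> M \<and> norm (- \<i> * (of_real m * Amp1 l t + of_real l * Amp2 l t) + R1 l t) \<le> M"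
      "(1 + \<bar>l\<bar>) * norm (Amp2 l t) \<le> M \<and> norm (- \<i> * (of_real l * Amp1 l t - of_real m * Amp2 l t) + R2 l t) \<le> M"
      unfolding M_def using 1 2 3(1)[of "of_real m * Amp1 l t" "of_real l * Amp2 l t" "R1 l t"]
        3(2)[of "of_real l * Amp1 l t" "of_real m * Amp2 l t" "R2 l t"]
        e mult_nonneg_nonneg[of "\<bar>m\<bar>" "6 * e"] R[OF l t] by (intro conjI; linarith)+
  qed
  have w: "(\<lambda>_. M) integrable_on {0<..(1::real)}"
    unfolding integrable_on_Ioc_iff by (rule integrable_const_ivl)
  show "controlled {0<..1} Amp1 (\<lambda>l t. - \<i> * (of_real m * Amp1 l t + of_real l * Amp2 l t) + R1 l t)"
    "controlled {0<..1} Amp2 (\<lambda>l t. - \<i> * (of_real l * Amp1 l t - of_real m * Amp2 l t) + R2 l t)"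
    by (rule controlledI[OF w], use F in simp, use F in simp, rule Amp_deriv, simp, simp,
        intro continuous_on_add continuous_on_mult continuous_on_diff continuous_on_const Amp_cont_time R_cont1,
            simp, simp,
        rule continuous_on_subset[OF Amp_cont(1)] continuous_on_subset[OF Amp_cont(2)], simp, force)+
qed


lemma third_order_bound: obtains A where "A \<ge> 0" "\<And>\<tau>. \<tau> \<in> {0..1} \<Longrightarrow> norm (third_order k \<tau>) \<le> A"
proof -
  have "bounded (third_order k ` {0..1})"
    by (intro compact_imp_bounded compact_continuous_image third_order_cont) auto
  then obtain A where A: "\<And>\<tau>. \<tau> \<in> {0..1} \<Longrightarrow> norm (third_order k \<tau>) \<le> A"
    unfolding bounded_iff by blast
  then show ?thesis using that order_trans[OF norm_ge_zero A[of 0]] by simp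
qed

text \<open>The exact free evolution of the initial vector \<open>(0, wave_coeff / l\<^sup>2)\<close>.\<close>

definition free_wave1 :: "real \<Rightarrow> real \<Rightarrow> complex" where
  "free_wave1 l t = - \<i> * wave_coeff * of_real (l * sin (rho m l * t) / rho m l) / of_real l ^ 2"
definition free_wave2 :: "real \<Rightarrow> real \<Rightarrow> complex" where
  "free_wave2 l t = wave_coeff * (of_real (cos (rho m l * t)) + \<i> * of_real (m * sin (rho m l * t) / rho m l)) /
      of_real l ^ 2"

text \<open>The solution minus the formal solution and the free wave; \<open>residual1\<close> and \<open>residual2\<close> are the
right-hand sides of the system that it solves.\<close>

definition remainder1 :: "real \<Rightarrow> real \<Rightarrow> complex" where
  "remainder1 l t = Amp1 l t - (- \<i> * r0 0 t / of_real l + third_order 0 t / of_real l ^ 3) - free_wave1 l t"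
definition remainder2 :: "real \<Rightarrow> real \<Rightarrow> complex" where
  "remainder2 l t = Amp2 l t - second_order 0 t / of_real l ^ 2 - free_wave2 l t"

definition residual1 :: "real \<Rightarrow> real \<Rightarrow> complex" where
  "residual1 l t = (R1 l t - r1 0 t / of_real l) - (third_order 1 t + \<i> * of_real m * third_order 0 t) / of_real l ^
      3"
definition residual2 :: "real \<Rightarrow> real \<Rightarrow> complex" where
  "residual2 l t = R2 l t - (r0 0 t + r2 0 t / (of_real l)\<^sup>2)"

lemma sin_rho_deriv: "l > 0 \<Longrightarrow> ((\<lambda>t. complex_of_real (c * sin (rho m l * t) / rho m l)) has_vector_derivative of_real
    (c * cos (rho m l * t))) (at t within S)"
  and cos_rho_deriv: "((\<lambda>t. complex_of_real (cos (rho m l * t))) has_vector_derivative of_real (- (rho m l * sin (rho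
      m l * t)))) (at t within S)"
  using rho_pos[of l m] by (auto intro!: of_real_has_vector_derivative derivative_eq_intros)

lemma free_wave_deriv:
  assumes "l > 0"
  shows "(free_wave1 l has_vector_derivative - \<i> * (of_real m * free_wave1 l t + of_real l * free_wave2 l t)) (at t
      within S)"
    and "(free_wave2 l has_vector_derivative - \<i> * (of_real l * free_wave1 l t - of_real m * free_wave2 l t)) (at t
        within S)"
proof -
  define r where "r = rho m l"
  have r: "r \<noteq> 0" "(complex_of_real r)\<^sup>2 = (of_real l)\<^sup>2 + (of_real m)\<^sup>2" and l: "l \<noteq> 0"
    using rho_pos[of l m] rho_square[of m l] assms by (auto simp: r_def simp flip: of_real_power of_real_add)
  have "(free_wave1 l has_vector_derivative - \<i> * wave_coeff * of_real (l * cos (r * t)) / of_real l ^ 2) (at t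
      within S)"
    unfolding free_wave1_def[abs_def] r_def
    by (intro has_vector_derivative_divide has_vector_derivative_mult_right sin_rho_deriv assms)
  moreover have "- \<i> * wave_coeff * of_real (l * cos (r * t)) / of_real l ^ 2 = - \<i> * (of_real m * free_wave1 l t +
      of_real l * free_wave2 l t)"
    using r l unfolding free_wave1_def free_wave2_def r_def[symmetric] by (simp add: field_simps)
  ultimately show "(free_wave1 l has_vector_derivative - \<i> * (of_real m * free_wave1 l t + of_real l * free_wave2 l
      t)) (at t within S)" by simp
  have "(free_wave2 l has_vector_derivative wave_coeff * (of_real (- (r * sin (r * t))) + \<i> * of_real (m * cos (r *
      t))) / of_real l ^ 2) (at t within S)"
    unfolding free_wave2_def[abs_def] r_def
    by (intro has_vector_derivative_divide has_vector_derivative_mult_right sin_rho_deriv cos_rho_deriv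
        has_vector_derivative_add assms)
  moreover have "wave_coeff * (of_real (- (r * sin (r * t))) + \<i> * of_real (m * cos (r * t))) / of_real l ^ 2
     = - \<i> * (of_real l * free_wave1 l t - of_real m * free_wave2 l t)"
  proof -
    have "of_real r * (wave_coeff * (of_real (- (r * sin (r * t))) + \<i> * of_real (m * cos (r * t))))
      = - \<i> * (of_real l * (- \<i> * wave_coeff * of_real (l * sin (r * t)))
          - of_real m * (wave_coeff * (of_real r * of_real (cos (r * t)) + \<i> * of_real (m * sin (r * t)))))"
      unfolding of_real_mult of_real_minus using r(2) i_squared by algebra
    then show ?thesis using r l unfolding free_wave1_def free_wave2_def r_def[symmetric] by (simp add: field_simps)
  qed
  ultimately show "(free_wave2 l has_vector_derivative - \<i> * (of_real l * free_wave1 l t - of_real m * free_wave2 l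
      t)) (at t within S)" by simp
qed

lemma remainder_deriv:
  assumes l: "l > 0" and t: "t \<in> {0..1}"
  shows "(remainder1 l has_vector_derivative - \<i> * (of_real m * remainder1 l t + of_real l * remainder2 l t) +
      residual1 l t) (at t within {0..1})"
    and "(remainder2 l has_vector_derivative - \<i> * (of_real l * remainder1 l t - of_real m * remainder2 l t) +
        residual2 l t) (at t within {0..1})"
proof -
  have l0: "complex_of_real l \<noteq> 0" using l by simp
  have "(remainder1 l has_vector_derivative (- \<i> * (of_real m * Amp1 l t + of_real l * Amp2 l t) + R1 l t)
     - (- \<i> * r0 1 t / of_real l + third_order 1 t / of_real l ^ 3) - (- \<i> * (of_real m * free_wave1 l t + of_real l
         * free_wave2 l t))) (at t within {0..1})"
    unfolding remainder1_def[abs_def] One_nat_def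
    by (intro has_vector_derivative_diff has_vector_derivative_add has_vector_derivative_divide
         has_vector_derivative_mult_right Amp_deriv free_wave_deriv r_deriv third_order_deriv l t)
  moreover have "(- \<i> * (of_real m * Amp1 l t + of_real l * Amp2 l t) + R1 l t)
     - (- \<i> * r0 1 t / of_real l + third_order 1 t / of_real l ^ 3) - (- \<i> * (of_real m * free_wave1 l t + of_real l
         * free_wave2 l t))
     = - \<i> * (of_real m * remainder1 l t + of_real l * remainder2 l t) + residual1 l t"
    using l0 unfolding remainder1_def remainder2_def residual1_def second_order_def
    by (simp add: field_simps power2_eq_square power3_eq_cube)
  ultimately show "(remainder1 l has_vector_derivative - \<i> * (of_real m * remainder1 l t + of_real l * remainder2 l
      t) + residual1 l t) (at t within {0..1})" by simp
  have "(remainder2 l has_vector_derivative (- \<i> * (of_real l * Amp1 l t - of_real m * Amp2 l t) + R2 l t)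
     - second_order 1 t / of_real l ^ 2 - (- \<i> * (of_real l * free_wave1 l t - of_real m * free_wave2 l t))) (at t
         within {0..1})"
    unfolding remainder2_def[abs_def] One_nat_def
    by (intro has_vector_derivative_diff has_vector_derivative_divide Amp_deriv free_wave_deriv second_order_deriv l
        t)
  moreover have "(- \<i> * (of_real l * Amp1 l t - of_real m * Amp2 l t) + R2 l t)
     - second_order 1 t / of_real l ^ 2 - (- \<i> * (of_real l * free_wave1 l t - of_real m * free_wave2 l t))
     = - \<i> * (of_real l * remainder1 l t - of_real m * remainder2 l t) + residual2 l t"
    using l0 unfolding remainder1_def remainder2_def residual2_def third_order_def
    by (simp add: field_simps power2_eq_square power3_eq_cube)
  ultimately show "(remainder2 l has_vector_derivative - \<i> * (of_real l * remainder1 l t - of_real m * remainder2 l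
      t) + residual2 l t) (at t within {0..1})" by simp
qed

text \<open>The formal solution was chosen such that everything up to \<open>O(1 / l ^ 3)\<close> cancels.\<close>

lemma residual_bound: obtains e where "e \<ge> 0"
  "\<And>l t. l \<ge> 1 \<Longrightarrow> t \<in> {0..1} \<Longrightarrow> norm (residual1 l t) \<le> e / l ^ 3 \<and> norm (residual2 l t) \<le> e / l ^ 3"
  "\<And>l. l \<ge> 1 \<Longrightarrow> norm (remainder1 l 0) \<le> e / l ^ 3 \<and> norm (remainder2 l 0) \<le> e / l ^ 3"
proof -
  obtain A0 where A0: "A0 \<ge> 0" "\<And>\<tau>. \<tau> \<in> {0..1} \<Longrightarrow> norm (third_order 0 \<tau>) \<le> A0" using third_order_bound by blast
  obtain A1 where A1: "A1 \<ge> 0" "\<And>\<tau>. \<tau> \<in> {0..1} \<Longrightarrow> norm (third_order 1 \<tau>) \<le> A1" using third_order_bound by blast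
  have C: "C \<ge> 0" using order_trans[OF norm_ge_zero G_asy(1)[of 1]] by simp
  define e where "e = C + A0 + (A1 + \<bar>m\<bar> * A0)"
  have e: "C \<le> e" "C + A0 \<le> e" "C + (A1 + \<bar>m\<bar> * A0) \<le> e" "e \<ge> 0"
    using A0(1) A1(1) C by (auto simp: e_def)
  show ?thesis
  proof (rule that[OF e(4)])
    fix l t :: real assume l: "l \<ge> 1" and t: "t \<in> {0..1}"
    have "norm (third_order 1 t + \<i> * of_real m * third_order 0 t) \<le> A1 + \<bar>m\<bar> * A0"
      using A0(2)[OF t] A1(2)[OF t]
      by (intro order_trans[OF norm_triangle_ineq] add_mono) (auto simp: norm_mult intro!: mult_left_mono)
    then have "norm ((third_order 1 t + \<i> * of_real m * third_order 0 t) / of_real l ^ 3) \<le> (A1 + \<bar>m\<bar> * A0) / l ^ 3"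
      by (rule norm_over_power_le) (use l in simp)
    then have "norm (residual1 l t) \<le> C / l ^ 3 + (A1 + \<bar>m\<bar> * A0) / l ^ 3"
      unfolding residual1_def by (intro order_trans[OF norm_triangle_ineq4] add_mono R_asy(1)[OF l t])
    also have "\<dots> \<le> e / l ^ 3"
      unfolding add_divide_distrib[symmetric] using e l by (intro divide_right_mono) auto
    finally have 1: "norm (residual1 l t) \<le> e / l ^ 3" .
    have "norm (residual2 l t) \<le> C / l ^ 3" unfolding residual2_def by (rule R_asy(2)[OF l t])
    also have "\<dots> \<le> e / l ^ 3" using e l by (intro divide_right_mono) auto
    finally show "norm (residual1 l t) \<le> e / l ^ 3 \<and> norm (residual2 l t) \<le> e / l ^ 3" using 1 by simp
  next
    fix l :: real assume l: "l \<ge> 1"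
    have l0: "complex_of_real l \<noteq> 0" using l by simp
    have "norm (third_order 0 0 / of_real l ^ 3) \<le> A0 / l ^ 3"
      by (rule norm_over_power_le) (use l A0 in auto)
    moreover have "remainder1 l 0 = (G1 l + \<i> * r0 0 0 / of_real l) - third_order 0 0 / of_real l ^ 3"
      using l by (simp add: remainder1_def Amp_init free_wave1_def)
    ultimately have "norm (remainder1 l 0) \<le> C / l ^ 3 + A0 / l ^ 3"
      using G_asy(1)[OF l] by (auto intro!: order_trans[OF norm_triangle_ineq4] add_mono)
    also have "\<dots> \<le> e / l ^ 3"
      unfolding add_divide_distrib[symmetric] using e l by (intro divide_right_mono) auto
    finally have 1: "norm (remainder1 l 0) \<le> e / l ^ 3" .
    have "remainder2 l 0 = G2 l - \<gamma> / (of_real l)\<^sup>2"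
      using l by (simp add: remainder2_def Amp_init free_wave2_def wave_coeff_def diff_divide_distrib)
    then have "norm (remainder2 l 0) \<le> C / l ^ 3" using G_asy(2)[OF l] by simp
    also have "\<dots> \<le> e / l ^ 3" using e l by (intro divide_right_mono) auto
    finally show "norm (remainder1 l 0) \<le> e / l ^ 3 \<and> norm (remainder2 l 0) \<le> e / l ^ 3" using 1 by simp
  qed
qed

lemma residual_cont: "continuous_on {0..1} (residual1 l)" "continuous_on {0..1} (residual2 l)"
proof -
  have c: "continuous_on {0..1} (r0 0)" "continuous_on {0..1} (r1 0)" "continuous_on {0..1} (r2 0)"
    by (rule continuous_on_vector_derivative, rule r_deriv, assumption)+
  have d: "continuous_on {0..1} (\<lambda>t. f t / complex_of_real l ^ k)" if "continuous_on {0..1} f" for f k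
    unfolding divide_inverse by (intro continuous_on_mult that continuous_on_const)
  from d[OF c(2), of 1] show "continuous_on {0..1} (residual1 l)" unfolding residual1_def[abs_def]
    by (intro continuous_on_diff R_cont1 d continuous_on_add continuous_on_mult continuous_on_const third_order_cont)
        simp
  show "continuous_on {0..1} (residual2 l)" unfolding residual2_def[abs_def]
    by (intro continuous_on_diff continuous_on_add R_cont1 d c)
qed

text \<open>The size \<open>O(1 / l ^ 3)\<close> follows from the estimate \<open>dirac_bound\<close>; the time derivative is then read
off from the system, whose coefficients are of order \<open>l\<close>.\<close>

lemma remainder_controlled: "\<exists>f'. controlled {1..} remainder1 f'" "\<exists>f'. controlled {1..} remainder2 f'"
proof -
  obtain e where e: "e \<ge> 0"
    "\<And>l t. l \<ge> 1 \<Longrightarrow> t \<in> {0..1} \<Longrightarrow> norm (residual1 l t) \<le> e / l ^ 3 \<and> norm (residual2 l t) \<le> e / l ^ 3"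
    "\<And>l. l \<ge> 1 \<Longrightarrow> norm (remainder1 l 0) \<le> e / l ^ 3 \<and> norm (remainder2 l 0) \<le> e / l ^ 3"
    using residual_bound by blast
  have y: "norm (remainder1 l t) \<le> 6 * e / l ^ 3" "norm (remainder2 l t) \<le> 6 * e / l ^ 3" if l: "l \<ge> 1" and t: "t \<in>
      {0..1}" for l t
  proof -
    have l0: "l > 0" using l by simp
    show "norm (remainder1 l t) \<le> 6 * e / l ^ 3" "norm (remainder2 l t) \<le> 6 * e / l ^ 3"
      using dirac_bound[OF l0 remainder_deriv[OF l0], of "e / l ^ 3" t] e(2,3)[OF l] t by auto
  qed
  define M where "M = (\<bar>m\<bar> + 1) * (6 * e) + e"
  have M: "6 * e \<le> M" using e(1) mult_nonneg_nonneg[of "\<bar>m\<bar>" "6 * e"] by (simp add: M_def algebra_simps)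
  have d: "norm (- \<i> * (p + q) + R) \<le> M / l\<^sup>2" "norm (- \<i> * (q - p) + R) \<le> M / l\<^sup>2"
    if l: "l \<ge> 1" and "norm p \<le> \<bar>m\<bar> * (6 * e / l ^ 3)" "norm q \<le> l * (6 * e / l ^ 3)" "norm R \<le> e / l ^ 3" for p q R
        :: complex and l
  proof -
    have "norm (- \<i> * p') = norm p'" for p' :: complex by (simp add: norm_mult)
    then have "norm (- \<i> * (p + q) + R) \<le> norm p + norm q + norm R" "norm (- \<i> * (q - p) + R) \<le> norm p + norm q +
        norm R"
      using norm_triangle_ineq[of "- \<i> * (p + q)" R] norm_triangle_ineq[of "- \<i> * (q - p)" R]
        norm_triangle_ineq[of p q] norm_triangle_ineq4[of q p] by (metis add_right_mono order_trans add.commute)+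
    moreover have "\<bar>m\<bar> * (6 * e / l ^ 3) \<le> \<bar>m\<bar> * (6 * e) / l\<^sup>2"
      using l e(1) by (auto intro!: divide_left_mono mult_left_mono power_increasing)
    moreover have "e / l ^ 3 \<le> e / l\<^sup>2"
      using l e(1) by (auto intro!: divide_left_mono power_increasing)
    moreover have "l * (6 * e / l ^ 3) = 6 * e / l\<^sup>2"
      using l by (simp add: power2_eq_square power3_eq_cube)
    moreover have "\<bar>m\<bar> * (6 * e) / l\<^sup>2 + 6 * e / l\<^sup>2 + e / l\<^sup>2 = M / l\<^sup>2"
      by (simp add: M_def algebra_simps add_divide_distrib)
    ultimately show "norm (- \<i> * (p + q) + R) \<le> M / l\<^sup>2" "norm (- \<i> * (q - p) + R) \<le> M / l\<^sup>2"
      using that(2-4) by linarith+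
  qed
  have M3: "6 * e / l ^ 3 \<le> M / l ^ 3" if "l \<ge> 1" for l
    using M that by (intro divide_right_mono) auto
  have ms: "norm (of_real m * p) \<le> \<bar>m\<bar> * (6 * e / l ^ 3)" "norm (of_real l * p) \<le> l * (6 * e / l ^ 3)"
    if "l \<ge> 1" "norm p \<le> 6 * e / l ^ 3" for l and p :: complex
    unfolding norm_mult norm_of_real using that mult_left_mono[OF that(2), of "\<bar>m\<bar>"] mult_left_mono[OF that(2), of l]
    by simp_all
  have ct: "continuous_on {0..1} (remainder1 l)" "continuous_on {0..1} (remainder2 l)" if "l \<ge> 1" for l
    by (rule continuous_on_vector_derivative, rule remainder_deriv, use that in simp, assumption)+
  have cO: "continuous_on {1..} (\<lambda>l. free_wave1 l t)" "continuous_on {1..} (\<lambda>l. free_wave2 l t)" for t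
    unfolding free_wave1_def free_wave2_def by (intro continuous_intros; auto simp: rho_eq_0_iff)+
  have cl: "continuous_on {1..} (\<lambda>l. remainder1 l t)" "continuous_on {1..} (\<lambda>l. remainder2 l t)" if "t \<in> {0..1}" for t
    unfolding remainder1_def remainder2_def
    by (intro continuous_on_diff continuous_on_add cO continuous_on_subset[OF Amp_cont(1)[OF that]]
        continuous_on_subset[OF Amp_cont(2)[OF that]] continuous_intros; auto)+
  have "controlled {1..} remainder1 (\<lambda>l t. - \<i> * (of_real m * remainder1 l t + of_real l * remainder2 l t) +
      residual1 l t)"
  proof (rule controlled_highI[of _ _ M])
    fix l t :: real assume l: "l \<ge> 1" and t: "t \<in> {0..1}"
    show "(remainder1 l has_vector_derivative - \<i> * (of_real m * remainder1 l t + of_real l * remainder2 l t) +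
        residual1 l t) (at t within {0..1})"
      by (rule remainder_deriv(1)) (use l t in auto)
    show "norm (remainder1 l t) \<le> M / l ^ 3" using y(1)[OF l t] M3[OF l] by simp
    show "norm (- \<i> * (of_real m * remainder1 l t + of_real l * remainder2 l t) + residual1 l t) \<le> M / l\<^sup>2"
      using y[OF l t] e(2)[OF l t] by (intro d l ms) auto
  qed (intro cl residual_cont ct continuous_on_add continuous_on_mult continuous_on_const; simp)+
  then show "\<exists>f'. controlled {1..} remainder1 f'" by blast
  have "controlled {1..} remainder2 (\<lambda>l t. - \<i> * (of_real l * remainder1 l t - of_real m * remainder2 l t) +
      residual2 l t)"
  proof (rule controlled_highI[of _ _ M])
    fix l t :: real assume l: "l \<ge> 1" and t: "t \<in> {0..1}"
    show "(remainder2 l has_vector_derivative - \<i> * (of_real l * remainder1 l t - of_real m * remainder2 l t) +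
        residual2 l t) (at t within {0..1})"
      by (rule remainder_deriv(2)) (use l t in auto)
    show "norm (remainder2 l t) \<le> M / l ^ 3" using y(2)[OF l t] M3[OF l] by simp
    show "norm (- \<i> * (of_real l * remainder1 l t - of_real m * remainder2 l t) + residual2 l t) \<le> M / l\<^sup>2"
      using y[OF l t] e(2)[OF l t] by (intro d l ms) auto
  qed (intro cl residual_cont ct continuous_on_add continuous_on_diff continuous_on_mult continuous_on_const; simp)+
  then show "\<exists>f'. controlled {1..} remainder2 f'" by blast
qed

lemma third_order_controlled: "\<exists>f'. controlled {1..} (\<lambda>l t. third_order 0 t / of_real l ^ 3) f'"
proof -
  obtain A0 where A0: "A0 \<ge> 0" "\<And>\<tau>. \<tau> \<in> {0..1} \<Longrightarrow> norm (third_order 0 \<tau>) \<le> A0" using third_order_bound by blast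
  obtain A1 where A1: "A1 \<ge> 0" "\<And>\<tau>. \<tau> \<in> {0..1} \<Longrightarrow> norm (third_order 1 \<tau>) \<le> A1" using third_order_bound by blast
  have "controlled {1..} (\<lambda>l t. third_order 0 t / of_real l ^ 3) (\<lambda>l t. third_order 1 t / of_real l ^ 3)"
  proof (rule controlled_highI[of _ _ "A0 + A1"])
    fix l t :: real assume l: "l \<ge> 1" and t: "t \<in> {0..1}"
    show "((\<lambda>t. third_order 0 t / of_real l ^ 3) has_vector_derivative third_order 1 t / of_real l ^ 3) (at t within
        {0..1})"
      unfolding One_nat_def by (intro has_vector_derivative_divide third_order_deriv t)
    show "norm (third_order 0 t / of_real l ^ 3) \<le> (A0 + A1) / l ^ 3"
      by (rule norm_over_power_le) (use A0(2)[OF t] A1(1) l in auto)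
    have "norm (third_order 1 t / of_real l ^ 3) \<le> (A0 + A1) / l ^ 3"
      by (rule norm_over_power_le) (use A1(2)[OF t] A0(1) l in auto)
    also have "\<dots> \<le> (A0 + A1) / l\<^sup>2"
      using l A0 A1 by (intro divide_left_mono power_increasing) auto
    finally show "norm (third_order 1 t / of_real l ^ 3) \<le> (A0 + A1) / l\<^sup>2" .
  next
    show "continuous_on {0..1} (\<lambda>t. third_order 1 t / of_real l ^ 3)" if "l \<ge> 1" for l
      using that by (intro continuous_intros third_order_cont) auto
    show "continuous_on {1..} (\<lambda>l. third_order 0 t / of_real l ^ 3)" for t
      by (intro continuous_intros) auto
  qed
  then show ?thesis by blast
qed

lemma sin_cos_rho_diff:
  assumes "l \<ge> 1" "t \<in> {0..1}"
  shows "\<bar>sin (rho m l * t) - sin (l * t)\<bar> \<le> m\<^sup>2 / l" "\<bar>cos (rho m l * t) - cos (l * t)\<bar> \<le> m\<^sup>2 / l"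
proof -
  have "norm (cis (rho m l * t) - cis (l * t)) \<le> \<bar>rho m l * t - l * t\<bar>" by (rule norm_cis_diff_le)
  also have "\<dots> = (rho m l - l) * t"
    using rho_ge_frequency[of l m] assms by (simp add: abs_mult flip: left_diff_distrib)
  also have "\<dots> \<le> (m\<^sup>2 / l) * 1"
    using rho_minus_frequency_le[of l m] rho_ge_frequency[of l m] assms by (intro mult_mono) auto
  finally have "norm (cis (rho m l * t) - cis (l * t)) \<le> m\<^sup>2 / l" by simp
  then show "\<bar>sin (rho m l * t) - sin (l * t)\<bar> \<le> m\<^sup>2 / l" "\<bar>cos (rho m l * t) - cos (l * t)\<bar> \<le> m\<^sup>2 / l"
    using abs_Im_le_cmod[of "cis (rho m l * t) - cis (l * t)"] abs_Re_le_cmod[of "cis (rho m l * t) - cis (l * t)"]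
    by auto
qed

text \<open>Up to a controlled error the free wave is the massless one. This cannot be seen from the
differential equation: the mass term is of order \<open>1 / l\<^sup>2\<close> and loses its effect only by oscillating.
The explicit formulas are therefore compared.\<close>

lemma free_wave_controlled:
  "\<exists>f'. controlled {1..} (\<lambda>l t. free_wave1 l t - (- \<i> * wave_coeff * of_real (sin (l * t)) / of_real l ^ 2)) f'"
  "\<exists>f'. controlled {1..} (\<lambda>l t. free_wave2 l t - wave_coeff * of_real (cos (l * t)) / of_real l ^ 2) f'"
proof -
  define D1 where "D1 l t = l * sin (rho m l * t) / rho m l - sin (l * t)" for l t
  define D2 where "D2 l t = cos (rho m l * t) - cos (l * t)" for l t
  define M where "M = norm wave_coeff * (2 * m\<^sup>2 + \<bar>m\<bar>)"
  have rl: "rho m l > 0" "rho m l \<ge> l" "rho m l \<ge> \<bar>m\<bar>" "rho m l - l \<le> m\<^sup>2 / l" if "l \<ge> 1" for l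
    using rho_pos[of l m] rho_ge_frequency[of l m] rho_ge_mass[of m l] rho_minus_frequency_le[of l m] that by auto
  have m2l: "m\<^sup>2 / l \<le> m\<^sup>2" if "l \<ge> 1" for l using that by (simp add: divide_le_eq mult_le_cancel_left1 mult_left_le)
  have D1: "\<bar>D1 l t\<bar> \<le> 2 * m\<^sup>2 / l" if l: "l \<ge> 1" and t: "t \<in> {0..1}" for l t
  proof -
    have eq: "D1 l t = (sin (rho m l * t) - sin (l * t)) - ((rho m l - l) / rho m l) * sin (rho m l * t)"
      using rl(1)[OF l] by (simp add: D1_def field_simps)
    have "\<bar>((rho m l - l) / rho m l) * sin (rho m l * t)\<bar> \<le> m\<^sup>2 / l * 1"
    proof -
      have "(rho m l - l) / rho m l \<le> (m\<^sup>2 / l) / 1"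
        using rl[OF l] l by (intro frac_le) auto
      then show ?thesis unfolding abs_mult using rl[OF l] l by (intro mult_mono) auto
    qed
    from add_mono[OF sin_cos_rho_diff(1)[OF l t] this] show ?thesis
      unfolding eq by (intro order_trans[OF abs_triangle_ineq4]) simp
  qed
  show "\<exists>f'. controlled {1..} (\<lambda>l t. free_wave1 l t - (- \<i> * wave_coeff * of_real (sin (l * t)) / of_real l ^ 2)) f'"
  proof (rule exI, rule controlled_cong)
    show "controlled {1..} (\<lambda>l t. - \<i> * wave_coeff * of_real (D1 l t) / of_real l ^ 2)
       (\<lambda>l t. - \<i> * wave_coeff * of_real (l * D2 l t) / of_real l ^ 2)"
    proof (rule controlled_highI[of _ _ M])
      fix l t :: real assume l: "l \<ge> 1" and t: "t \<in> {0..1}"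
      show "((\<lambda>t. - \<i> * wave_coeff * of_real (D1 l t) / of_real l ^ 2) has_vector_derivative - \<i> * wave_coeff *
          of_real (l * D2 l t) / of_real l ^ 2) (at t within {0..1})"
        unfolding D1_def D2_def using rl(1)[OF l]
        by (intro has_vector_derivative_divide has_vector_derivative_mult_right of_real_has_vector_derivative)
           (auto intro!: derivative_eq_intros simp: field_simps)
      have "norm (- \<i> * wave_coeff * of_real (D1 l t)) \<le> norm wave_coeff * (2 * m\<^sup>2 / l)"
        using mult_left_mono[OF D1[OF l t], of "norm wave_coeff"] by (simp add: norm_mult)
      also have "\<dots> \<le> M / l" using l by (simp add: M_def divide_right_mono mult_left_mono)
      finally have "norm (- \<i> * wave_coeff * of_real (D1 l t) / of_real l ^ 2) \<le> M / l / l ^ 2"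
        by (rule norm_over_power_le) (use l in simp)
      then show "norm (- \<i> * wave_coeff * of_real (D1 l t) / of_real l ^ 2) \<le> M / l ^ 3"
        by (simp add: power2_eq_square power3_eq_cube)
      have "\<bar>l * D2 l t\<bar> \<le> m\<^sup>2"
        using mult_left_mono[OF sin_cos_rho_diff(2)[OF l t, folded D2_def], of l] l unfolding abs_mult by simp
      then have "norm (- \<i> * wave_coeff * of_real (l * D2 l t)) \<le> norm wave_coeff * m\<^sup>2"
        by (simp add: norm_mult mult_left_mono abs_mult)
      also have "\<dots> \<le> M" by (simp add: M_def mult_left_mono)
      finally show "norm (- \<i> * wave_coeff * of_real (l * D2 l t) / of_real l ^ 2) \<le> M / l\<^sup>2"
        by (rule norm_over_power_le) (use l in simp)
    next
      show "continuous_on {0..1} (\<lambda>t. - \<i> * wave_coeff * of_real (l * D2 l t) / of_real l ^ 2)" if "l \<ge> 1" for l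
        unfolding D2_def using that by (intro continuous_intros) auto
      show "continuous_on {1..} (\<lambda>l. - \<i> * wave_coeff * of_real (D1 l t) / of_real l ^ 2)" for t
        unfolding D1_def by (intro continuous_intros) (auto simp: rho_eq_0_iff)
    qed
    show "- \<i> * wave_coeff * of_real (D1 l t) / of_real l ^ 2 = free_wave1 l t - (- \<i> * wave_coeff * of_real (sin (l
        * t)) / of_real l ^ 2)" for l t
      by (simp add: D1_def free_wave1_def diff_divide_distrib right_diff_distrib)
  qed
  show "\<exists>f'. controlled {1..} (\<lambda>l t. free_wave2 l t - wave_coeff * of_real (cos (l * t)) / of_real l ^ 2) f'"
  proof (rule exI, rule controlled_cong)
    show "controlled {1..} (\<lambda>l t. wave_coeff * (of_real (D2 l t) + \<i> * of_real (m * sin (rho m l * t) / rho m l)) /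
        of_real l ^ 2)
       (\<lambda>l t. wave_coeff * (of_real (- (rho m l * sin (rho m l * t)) + l * sin (l * t)) + \<i> * of_real (m * cos (rho m
           l * t))) / of_real l ^ 2)"
    proof (rule controlled_highI[of _ _ M])
      fix l t :: real assume l: "l \<ge> 1" and t: "t \<in> {0..1}"
      show "((\<lambda>t. wave_coeff * (of_real (D2 l t) + \<i> * of_real (m * sin (rho m l * t) / rho m l)) / of_real l ^ 2)
          has_vector_derivative
        wave_coeff * (of_real (- (rho m l * sin (rho m l * t)) + l * sin (l * t)) + \<i> * of_real (m * cos (rho m l *
            t))) / of_real l ^ 2) (at t within {0..1})"
        unfolding D2_def using rl(1)[OF l] l
        by (intro has_vector_derivative_divide has_vector_derivative_mult_right of_real_has_vector_derivative
            has_vector_derivative_add sin_rho_deriv)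
           (auto intro!: derivative_eq_intros)
      have "norm (of_real (D2 l t) + \<i> * complex_of_real (m * sin (rho m l * t) / rho m l)) \<le> m\<^sup>2 / l + \<bar>m\<bar> / l"
      proof (intro order_trans[OF norm_triangle_ineq] add_mono)
        show "norm (complex_of_real (D2 l t)) \<le> m\<^sup>2 / l"
          using sin_cos_rho_diff(2)[OF l t] unfolding D2_def norm_of_real .
        have "\<bar>m\<bar> * \<bar>sin (rho m l * t)\<bar> / rho m l \<le> \<bar>m\<bar> * 1 / l"
          using rl[OF l] l by (intro frac_le mult_left_mono) auto
        then show "norm (\<i> * complex_of_real (m * sin (rho m l * t) / rho m l)) \<le> \<bar>m\<bar> / l"
          using rl(1)[OF l] by (simp only: norm_mult norm_ii norm_of_real abs_divide abs_mult)
      qed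
      also have "\<dots> \<le> (2 * m\<^sup>2 + \<bar>m\<bar>) / l"
        using l by (simp add: add_divide_distrib divide_right_mono)
      finally have "norm (wave_coeff * (of_real (D2 l t) + \<i> * of_real (m * sin (rho m l * t) / rho m l))) \<le> M / l"
        unfolding norm_mult M_def using mult_left_mono[of _ _ "norm wave_coeff"] by fastforce
      then have "norm (wave_coeff * (of_real (D2 l t) + \<i> * of_real (m * sin (rho m l * t) / rho m l)) / of_real l ^
          2) \<le> M / l / l ^ 2"
        by (rule norm_over_power_le) (use l in simp)
      then show "norm (wave_coeff * (of_real (D2 l t) + \<i> * of_real (m * sin (rho m l * t) / rho m l)) / of_real l ^
          2) \<le> M / l ^ 3"
        by (simp add: power2_eq_square power3_eq_cube)
      have "norm (complex_of_real (- (rho m l * sin (rho m l * t)) + l * sin (l * t)) + \<i> * of_real (m * cos (rho m l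
          * t))) \<le> 2 * m\<^sup>2 + \<bar>m\<bar>"
      proof (intro order_trans[OF norm_triangle_ineq] add_mono)
        have "- (rho m l * sin (rho m l * t)) + l * sin (l * t) = - (rho m l - l) * sin (rho m l * t) - l * (sin (rho
            m l * t) - sin (l * t))"
          by (simp add: algebra_simps)
        moreover have "\<bar>- (rho m l - l) * sin (rho m l * t)\<bar> \<le> m\<^sup>2 * 1"
          unfolding abs_mult using rl[OF l] m2l[OF l] by (intro mult_mono) auto
        moreover have "\<bar>l * (sin (rho m l * t) - sin (l * t))\<bar> \<le> m\<^sup>2"
          using mult_left_mono[OF sin_cos_rho_diff(1)[OF l t], of l] l unfolding abs_mult by simp
        ultimately show "norm (complex_of_real (- (rho m l * sin (rho m l * t)) + l * sin (l * t))) \<le> 2 * m\<^sup>2"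
          unfolding norm_of_real by linarith
        show "norm (\<i> * complex_of_real (m * cos (rho m l * t))) \<le> \<bar>m\<bar>"
          by (simp only: norm_mult norm_ii norm_of_real abs_mult) (simp add: mult_left_le)
      qed
      then have "norm (wave_coeff * (of_real (- (rho m l * sin (rho m l * t)) + l * sin (l * t)) + \<i> * of_real (m *
          cos (rho m l * t)))) \<le> M"
        unfolding norm_mult M_def by (intro mult_left_mono) auto
      then show "norm (wave_coeff * (of_real (- (rho m l * sin (rho m l * t)) + l * sin (l * t)) + \<i> * of_real (m *
          cos (rho m l * t))) / of_real l ^ 2) \<le> M / l\<^sup>2"
        by (rule norm_over_power_le) (use l in simp)
    next
      show "continuous_on {0..1} (\<lambda>t. wave_coeff * (of_real (- (rho m l * sin (rho m l * t)) + l * sin (l * t)) + \<i> *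
          of_real (m * cos (rho m l * t))) / of_real l ^ 2)" if "l \<ge> 1" for l
        using that by (intro continuous_intros) auto
      show "continuous_on {1..} (\<lambda>l. wave_coeff * (of_real (D2 l t) + \<i> * of_real (m * sin (rho m l * t) / rho m l))
          / of_real l ^ 2)" for t
        unfolding D2_def by (intro continuous_intros) (auto simp: rho_eq_0_iff)
    qed
    show "wave_coeff * (of_real (D2 l t) + \<i> * of_real (m * sin (rho m l * t) / rho m l)) / of_real l ^ 2
       = free_wave2 l t - wave_coeff * of_real (cos (l * t)) / of_real l ^ 2" for l t
      by (simp add: D2_def free_wave2_def diff_divide_distrib algebra_simps add_divide_distrib)
  qed
qed

lemma high_frequency:
  "\<exists>f'. controlled {1..} (\<lambda>l t. Amp1 l t - (- \<i> * r0 0 t / of_real l - \<i> * wave_coeff * of_real (sin (l * t)) /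
      of_real l ^ 2)) f'"
  "\<exists>f'. controlled {1..} (\<lambda>l t. Amp2 l t - (second_order 0 t / of_real l ^ 2 + wave_coeff * of_real (cos (l * t)) /
      of_real l ^ 2)) f'"
proof -
  obtain a b c where "controlled {1..} remainder1 a" "controlled {1..} (\<lambda>l t. third_order 0 t / of_real l ^ 3) b"
    "controlled {1..} (\<lambda>l t. free_wave1 l t - (- \<i> * wave_coeff * of_real (sin (l * t)) / of_real l ^ 2)) c"
    using remainder_controlled third_order_controlled free_wave_controlled by blast
  note ctrl = controlled_add[OF this(1) controlled_add[OF this(2,3)]]
  show "\<exists>f'. controlled {1..} (\<lambda>l t. Amp1 l t - (- \<i> * r0 0 t / of_real l - \<i> * wave_coeff * of_real (sin (l * t)) /
      of_real l ^ 2)) f'"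
    by (rule exI, rule controlled_cong[OF ctrl]) (simp add: remainder1_def)
  obtain a b where "controlled {1..} remainder2 a"
    "controlled {1..} (\<lambda>l t. free_wave2 l t - wave_coeff * of_real (cos (l * t)) / of_real l ^ 2) b"
    using remainder_controlled free_wave_controlled by blast
  note ctrl2 = controlled_add[OF this]
  show "\<exists>f'. controlled {1..} (\<lambda>l t. Amp2 l t - (second_order 0 t / of_real l ^ 2 + wave_coeff * of_real (cos (l *
      t)) / of_real l ^ 2)) f'"
    by (rule exI, rule controlled_cong[OF ctrl2]) (simp add: remainder2_def)
qed

end

section \<open>Functions that are continuously differentiable up to the corner\<close>

text \<open>Regularity in the interior of \<open>\<Omega>\<close> and at the single boundary point \<open>(0, 0)\<close>.\<close>

definition corner_C1 :: "(real \<times> real) set \<Rightarrow> (real \<Rightarrow> real \<Rightarrow> complex) \<Rightarrow> bool" where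
  "corner_C1 \<Omega> P \<longleftrightarrow> (\<exists>Px Pt Lx Lt.
     (\<forall>(x, t)\<in>\<Omega>. ((\<lambda>y. P y t) has_vector_derivative Px (x, t)) (at x) \<and>
                  ((\<lambda>s. P x s) has_vector_derivative Pt (x, t)) (at t)) \<and>
     (Px \<longlongrightarrow> Lx) (at (0, 0) within \<Omega>) \<and> (Pt \<longlongrightarrow> Lt) (at (0, 0) within \<Omega>))"

lemma corner_C1I:
  assumes "\<And>x t. (x, t) \<in> \<Omega> \<Longrightarrow> ((\<lambda>y. P y t) has_vector_derivative Px (x, t)) (at x)"
    "\<And>x t. (x, t) \<in> \<Omega> \<Longrightarrow> ((\<lambda>s. P x s) has_vector_derivative Pt (x, t)) (at t)"
    "(Px \<longlongrightarrow> Lx) (at (0, 0) within \<Omega>)" "(Pt \<longlongrightarrow> Lt) (at (0, 0) within \<Omega>)"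
  shows "corner_C1 \<Omega> P"
  using assms unfolding corner_C1_def by blast

lemma corner_C1_lincomb:
  assumes "corner_C1 \<Omega> P" "corner_C1 \<Omega> Q"
  shows "corner_C1 \<Omega> (\<lambda>x t. a * P x t + b * Q x t)"
proof -
  from assms(1) obtain Px Pt Lx Lt where P:
    "\<forall>(x, t)\<in>\<Omega>. ((\<lambda>y. P y t) has_vector_derivative Px (x, t)) (at x) \<and> ((\<lambda>s. P x s) has_vector_derivative Pt (x, t))
        (at t)"
    "(Px \<longlongrightarrow> Lx) (at (0, 0) within \<Omega>)" "(Pt \<longlongrightarrow> Lt) (at (0, 0) within \<Omega>)"
    unfolding corner_C1_def by blast
  from assms(2) obtain Qx Qt Mx Mt where Q:
    "\<forall>(x, t)\<in>\<Omega>. ((\<lambda>y. Q y t) has_vector_derivative Qx (x, t)) (at x) \<and> ((\<lambda>s. Q x s) has_vector_derivative Qt (x, t))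
        (at t)"
    "(Qx \<longlongrightarrow> Mx) (at (0, 0) within \<Omega>)" "(Qt \<longlongrightarrow> Mt) (at (0, 0) within \<Omega>)"
    unfolding corner_C1_def by blast
  show ?thesis
  proof (rule corner_C1I)
    show "((\<lambda>p. a * Px p + b * Qx p) \<longlongrightarrow> a * Lx + b * Mx) (at (0, 0) within \<Omega>)"
      "((\<lambda>p. a * Pt p + b * Qt p) \<longlongrightarrow> a * Lt + b * Mt) (at (0, 0) within \<Omega>)"
      by (intro tendsto_intros P Q)+
  next
    fix x t assume "(x, t) \<in> \<Omega>"
    then show "((\<lambda>y. a * P y t + b * Q y t) has_vector_derivative a * Px (x, t) + b * Qx (x, t)) (at x)"
      "((\<lambda>s. a * P x s + b * Q x s) has_vector_derivative a * Pt (x, t) + b * Qt (x, t)) (at t)"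
      using P(1) Q(1) by (auto intro!: has_vector_derivative_add has_vector_derivative_mult_right)
  qed
qed

lemma corner_C1_cong:
  assumes "corner_C1 \<Omega> P" "open \<Omega>" "\<And>x t. (x, t) \<in> \<Omega> \<Longrightarrow> P x t = Q x t"
  shows "corner_C1 \<Omega> Q"
proof -
  from assms(1) obtain Px Pt Lx Lt where P:
    "\<And>x t. (x, t) \<in> \<Omega> \<Longrightarrow> ((\<lambda>y. P y t) has_vector_derivative Px (x, t)) (at x)"
    "\<And>x t. (x, t) \<in> \<Omega> \<Longrightarrow> ((\<lambda>s. P x s) has_vector_derivative Pt (x, t)) (at t)"
    "(Px \<longlongrightarrow> Lx) (at (0, 0) within \<Omega>)" "(Pt \<longlongrightarrow> Lt) (at (0, 0) within \<Omega>)"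
    unfolding corner_C1_def by blast
  have slices: "open ((\<lambda>y. (y, t)) -` \<Omega>)" "open ((\<lambda>s. (x, s)) -` \<Omega>)" for x t
    using assms(2) by (auto intro!: open_vimage continuous_intros)
  show ?thesis
  proof (rule corner_C1I[OF _ _ P(3,4)])
    fix x t assume xt: "(x, t) \<in> \<Omega>"
    show "((\<lambda>y. Q y t) has_vector_derivative Px (x, t)) (at x)"
      by (rule has_vector_derivative_transform_within_open[OF P(1)[OF xt] slices(1)[of t]])
         (use xt assms(3) in auto)
    show "((\<lambda>s. Q x s) has_vector_derivative Pt (x, t)) (at t)"
      by (rule has_vector_derivative_transform_within_open[OF P(2)[OF xt] slices(2)[of x]])
         (use xt assms(3) in auto)
  qed
qed

lemma at_within_unit_interval: "0 < t \<Longrightarrow> t < 1 \<Longrightarrow> at t within {0..1} = at (t::real)"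
  by (rule at_within_interior) auto

lemma corner_C1_product:
  fixes a S :: "real \<Rightarrow> complex"
  assumes \<Omega>: "\<Omega> \<subseteq> {0<..<1} \<times> {0<..<1}"
    and a: "\<And>t. t \<in> {0..1} \<Longrightarrow> (a has_vector_derivative a' t) (at t within {0..1})" "continuous_on {0..1} a'"
    and S: "\<And>x. (S has_vector_derivative S' x) (at x)" "continuous_on UNIV S'"
  shows "corner_C1 \<Omega> (\<lambda>x t. a t * S x)"
proof (rule corner_C1I)
  fix x t assume xt: "(x, t) \<in> \<Omega>"
  then have t: "0 < t" "t < 1" using \<Omega> by auto
  have "(a has_vector_derivative a' t) (at t)"
    using a(1)[of t] t by (simp add: at_within_unit_interval)
  then show "((\<lambda>s. a s * S x) has_vector_derivative (\<lambda>(x, t). a' t * S x) (x, t)) (at t)"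
    by (simp add: has_vector_derivative_mult_left)
  show "((\<lambda>y. a t * S y) has_vector_derivative (\<lambda>(x, t). a t * S' x) (x, t)) (at x)"
    using S(1) by (simp add: has_vector_derivative_mult_right)
next
  have ca: "continuous_on {0..1} a" by (rule continuous_on_vector_derivative) (rule a)
  have cS: "continuous_on UNIV S"
    by (rule continuous_on_vector_derivative) (use S in \<open>auto intro: has_vector_derivative_at_within\<close>)
  have c: "continuous_on (UNIV \<times> {0..1}) (\<lambda>p. a (snd p) * S' (fst p))" "continuous_on (UNIV \<times> {0..1}) (\<lambda>p. a' (snd p)
      * S (fst p))"
    by (intro continuous_on_mult continuous_on_compose2[OF ca] continuous_on_compose2[OF a(2)]
          continuous_on_compose2[OF cS] continuous_on_compose2[OF S(2)] continuous_intros; auto)+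
  have sub: "\<Omega> \<subseteq> UNIV \<times> {0..1}" using \<Omega> by auto
  show "((\<lambda>(x, t). a t * S' x) \<longlongrightarrow> a 0 * S' 0) (at (0, 0) within \<Omega>)"
    unfolding split_def by (rule tendsto_within_subset[OF _ sub]) (use c(1) in \<open>force simp: continuous_on_def\<close>)
  show "((\<lambda>(x, t). a' t * S x) \<longlongrightarrow> a' 0 * S 0) (at (0, 0) within \<Omega>)"
    unfolding split_def by (rule tendsto_within_subset[OF _ sub]) (use c(2) in \<open>force simp: continuous_on_def\<close>)
qed

lemma corner_C1_linear_argument:
  fixes S :: "real \<Rightarrow> complex"
  assumes S: "\<And>x. (S has_vector_derivative S' x) (at x)" "continuous_on UNIV S'"
  shows "corner_C1 \<Omega> (\<lambda>x t. S (a * x + b * t))"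
proof (rule corner_C1I)
  fix x t :: real
  have "((S \<circ> (\<lambda>y. a * y + b * t)) has_vector_derivative a *\<^sub>R S' (a * x + b * t)) (at x)"
    by (rule vector_diff_chain_at)
       (auto intro!: derivative_eq_intros S simp flip: has_real_derivative_iff_has_vector_derivative)
  then show "((\<lambda>y. S (a * y + b * t)) has_vector_derivative (\<lambda>p. a *\<^sub>R S' (a * fst p + b * snd p)) (x, t)) (at x)"
    by (simp add: comp_def)
  have "((S \<circ> (\<lambda>s. a * x + b * s)) has_vector_derivative b *\<^sub>R S' (a * x + b * t)) (at t)"
    by (rule vector_diff_chain_at)
       (auto intro!: derivative_eq_intros S simp flip: has_real_derivative_iff_has_vector_derivative)
  then show "((\<lambda>s. S (a * x + b * s)) has_vector_derivative (\<lambda>p. b *\<^sub>R S' (a * fst p + b * snd p)) (x, t)) (at t)"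
    by (simp add: comp_def)
next
  have *: "continuous_on UNIV (\<lambda>p. c *\<^sub>R S' (a * fst p + b * snd p))" for c
    by (intro continuous_intros continuous_on_compose2[OF S(2)]) auto
  have "((\<lambda>p. c *\<^sub>R S' (a * fst p + b * snd p)) \<longlongrightarrow> c *\<^sub>R S' (a * 0 + b * 0)) (at (0, 0) within \<Omega>)" for c
    by (rule tendsto_within_subset[of _ _ _ UNIV])
       (use *[of c] in \<open>drule_tac continuous_on_def[THEN iffD1], drule_tac x = "(0, 0)" in bspec, auto\<close>)
  then show "((\<lambda>p. a *\<^sub>R S' (a * fst p + b * snd p)) \<longlongrightarrow> a *\<^sub>R S' (a * 0 + b * 0)) (at (0, 0) within \<Omega>)"
    "((\<lambda>p. b *\<^sub>R S' (a * fst p + b * snd p)) \<longlongrightarrow> b *\<^sub>R S' (a * 0 + b * 0)) (at (0, 0) within \<Omega>)" by blast+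
qed

lemma controlled_integrable:
  assumes ctrl: "controlled K f f'" and K: "K \<in> sets lebesgue"
    and S: "continuous_on UNIV S" "\<And>x. \<bar>S x\<bar> \<le> 1" and t: "t \<in> {0..1}"
  shows "(\<lambda>l. of_real (S (l * x)) * f l t) integrable_on K"
proof -
  from ctrl obtain w where w: "w integrable_on K" "\<And>l. l \<in> K \<Longrightarrow> (1 + \<bar>l\<bar>) * norm (f l t) \<le> w l"
    using t unfolding controlled_def by blast
  show ?thesis
  proof (rule integrable_on_continuous_bounded[OF _ K w(1)])
    have "continuous_on K (\<lambda>l. f l t)" using ctrl t unfolding controlled_def by blast
    then show "continuous_on K (\<lambda>l. of_real (S (l * x)) * f l t)"
      by (intro continuous_intros continuous_on_compose2[OF S(1)]) auto
    fix l assume l: "l \<in> K"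
    have "norm (of_real (S (l * x)) * f l t) \<le> (1 + \<bar>l\<bar>) * norm (f l t)"
      unfolding norm_mult using S(2)[of "l * x"] by (intro mult_right_mono) auto
    then show "norm (of_real (S (l * x)) * f l t) \<le> w l" using w(2)[OF l] by simp
  qed
qed

text \<open>Differentiation under the integral sign, with the function \<open>w\<close> of \<^const>\<open>controlled\<close> as the common
majorant, in the parameter as well as for the limit at the origin. The kernel \<open>S\<close> will be sine or
cosine.\<close>

lemma corner_C1_integral:
  assumes ctrl: "controlled K f f'" and K: "K \<in> sets lebesgue"
    and S: "\<And>x. (S has_real_derivative S' x) (at x)" "continuous_on UNIV S'" "\<And>x. \<bar>S x\<bar> \<le> 1" "\<And>x. \<bar>S' x\<bar> \<le> 1"
    and \<Omega>: "\<Omega> \<subseteq> {0<..<1} \<times> {0<..<1}"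
  shows "corner_C1 \<Omega> (\<lambda>x t. integral K (\<lambda>l. of_real (S (l * x)) * f l t))"
proof (rule corner_C1I)
  have cS: "continuous_on UNIV S"
    using S(1) by (intro DERIV_continuous_on[of _ S S']) (auto intro: has_field_derivative_at_within)
  from ctrl obtain w where w: "w integrable_on K"
    "\<And>l t. l \<in> K \<Longrightarrow> t \<in> {0..1} \<Longrightarrow> (1 + \<bar>l\<bar>) * norm (f l t) \<le> w l"
    "\<And>l t. l \<in> K \<Longrightarrow> t \<in> {0..1} \<Longrightarrow> norm (f' l t) \<le> w l"
    unfolding controlled_def by blast
  have f': "(f l has_vector_derivative f' l t) (at t within {0..1})" "continuous_on {0..1} (f' l)" if "l \<in> K" "t \<in>
      {0..1}" for l t
    using ctrl that unfolding controlled_def by auto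
  have cf: "continuous_on {0..1} (f l)" if "l \<in> K" for l
    by (rule continuous_on_vector_derivative) (rule f'[OF that])
  note int = controlled_integrable[OF ctrl K cS S(3)]
  have bx: "norm (of_real l * of_real (S' (l * x)) * f l t) \<le> w l" if "l \<in> K" "t \<in> {0..1}" for l x t
  proof -
    have "norm (of_real l * of_real (S' (l * x)) * f l t) \<le> (\<bar>l\<bar> * 1) * norm (f l t)"
      unfolding norm_mult norm_of_real using S(4) by (intro mult_right_mono mult_left_mono) auto
    also have "\<dots> \<le> (1 + \<bar>l\<bar>) * norm (f l t)" by (simp add: distrib_right)
    finally show ?thesis using w(2)[OF that] by simp
  qed
  have bt: "norm (of_real (S (l * x)) * f' l t) \<le> w l" if "l \<in> K" "t \<in> {0..1}" for l x t
    using mult_mono[OF S(3)[of "l * x"] w(3)[OF that]] by (simp add: norm_mult)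
  have dx: "((\<lambda>y. of_real (S (l * y)) * f l t) has_vector_derivative of_real l * of_real (S' (l * x)) * f l t) (at
      x)" for l x t
  proof -
    have "((\<lambda>y. S (l * y)) has_real_derivative S' (l * x) * l) (at x)"
      by (rule DERIV_chain2[OF S(1)]) (auto intro!: derivative_eq_intros)
    then have "((\<lambda>y. complex_of_real (S (l * y))) has_vector_derivative of_real (S' (l * x) * l)) (at x)"
      by (rule of_real_has_vector_derivative)
    from has_vector_derivative_mult_left[OF this, of "f l t"] show ?thesis by (simp add: mult.commute)
  qed
  have ix: "(\<lambda>l. of_real l * of_real (S' (l * x)) * f l t) integrable_on K" if "t \<in> {0..1}" for x t
    by (rule dominated_derivative_integrable[where Y = UNIV and f = "\<lambda>x l. of_real (S (l * x)) * f l t" and w = w])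
       (use int[OF that] w(1) dx bx that in auto)
  have it: "(\<lambda>l. of_real (S (l * x)) * f' l t) integrable_on K" if "t \<in> {0..1}" for x t
    by (rule dominated_derivative_integrable[where Y = "{0..1}" and f = "\<lambda>t l. of_real (S (l * x)) * f l t" and w =
        w])
       (use int w(1) f' bt that in \<open>auto intro!: has_vector_derivative_mult_right simp: islimpt_Icc\<close>)
  {
    fix x t assume "(x, t) \<in> \<Omega>"
    then have t: "0 < t" "t < 1" using \<Omega> by auto
    show "((\<lambda>y. integral K (\<lambda>l. of_real (S (l * y)) * f l t)) has_vector_derivative
        (\<lambda>p. integral K (\<lambda>l. of_real l * of_real (S' (l * fst p)) * f l (snd p))) (x, t)) (at x)"
      using dominated_vector_derivative[where Y = UNIV and f = "\<lambda>x l. of_real (S (l * x)) * f l t" and K = K and w = w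
          and f' = "\<lambda>x l. of_real l * of_real (S' (l * x)) * f l t" and y = x] int[of t] w(1) dx bx t by auto
    have "((\<lambda>s. integral K (\<lambda>l. of_real (S (l * x)) * f l s)) has_vector_derivative
        integral K (\<lambda>l. of_real (S (l * x)) * f' l t)) (at t within {0..1})"
      by (rule dominated_vector_derivative[where w = w])
         (use int w(1) f' bt t in \<open>auto intro!: has_vector_derivative_mult_right\<close>)
    then show "((\<lambda>s. integral K (\<lambda>l. of_real (S (l * x)) * f l s)) has_vector_derivative
        (\<lambda>p. integral K (\<lambda>l. of_real (S (l * fst p)) * f' l (snd p))) (x, t)) (at t)"
      using t by (simp add: at_within_unit_interval)
  }
  have lim: "((\<lambda>p. of_real (c * T (l * fst p)) * h (snd p)) \<longlongrightarrow> of_real (c * T (l * 0)) * h 0) (at (0, 0) within \<Omega>)"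
    if "continuous_on UNIV T" "continuous_on {0..1} h" for c l and T :: "real \<Rightarrow> real" and h :: "real \<Rightarrow> complex"
  proof -
    have "continuous_on (UNIV \<times> {0..1}) (\<lambda>p. of_real (c * T (l * fst p)) * h (snd p))"
      by (intro continuous_intros continuous_on_compose2[OF that(1)] continuous_on_compose2[OF that(2)]) auto
    then have "((\<lambda>p. of_real (c * T (l * fst p)) * h (snd p)) \<longlongrightarrow> of_real (c * T (l * 0)) * h 0) (at (0, 0) within UNIV
        \<times> {0..1})"
      unfolding continuous_on_def by (drule_tac x = "(0, 0)" in bspec) auto
    then show ?thesis by (rule tendsto_within_subset) (use \<Omega> in auto)
  qed
  show "((\<lambda>p. integral K (\<lambda>l. of_real l * of_real (S' (l * fst p)) * f l (snd p))) \<longlongrightarrow>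
      integral K (\<lambda>l. of_real l * of_real (S' (l * 0)) * f l 0)) (at (0, 0) within \<Omega>)"
  proof (rule dominated_tendsto[OF _ w(1)])
    fix l assume "l \<in> K"
    from lim[OF S(2) cf[OF this], of l l]
    show "((\<lambda>p. of_real l * of_real (S' (l * fst p)) * f l (snd p)) \<longlongrightarrow> of_real l * of_real (S' (l * 0)) * f l 0) (at
        (0, 0) within \<Omega>)"
      by simp
  qed (use \<Omega> ix bx in force)+
  show "((\<lambda>p. integral K (\<lambda>l. of_real (S (l * fst p)) * f' l (snd p))) \<longlongrightarrow>
      integral K (\<lambda>l. of_real (S (l * 0)) * f' l 0)) (at (0, 0) within \<Omega>)"
  proof (rule dominated_tendsto[OF _ w(1)])
    fix l assume "l \<in> K"
    from lim[OF cS f'(2)[OF this, of 0], of 1 l]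
    show "((\<lambda>p. of_real (S (l * fst p)) * f' l (snd p)) \<longlongrightarrow> of_real (S (l * 0)) * f' l 0) (at (0, 0) within \<Omega>)"
      by simp
  qed (use \<Omega> it bt in force)+
qed

section \<open>The leading frequency integrals\<close>

text \<open>These are \<open>\<integral> sin (l x) / l dl\<close> and \<open>\<integral> cos (l x) / l\<^sup>2 dl\<close> over \<open>{1..}\<close> for positive \<open>x\<close>. The
formulas extend them smoothly to the whole line, whereas the first integral jumps at \<open>0\<close> and the
second has a corner there.\<close>

definition sin_tail :: "real \<Rightarrow> complex" where "sin_tail x = of_real (pi / 2 - Si x)"
definition cos_tail :: "real \<Rightarrow> complex" where "cos_tail x = of_real (cos x + x * Si x - x * (pi / 2))"

lemma sin_tail_deriv: "(sin_tail has_vector_derivative of_real (- sinc x)) (at x)"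
  unfolding sin_tail_def[abs_def]
  by (rule of_real_has_vector_derivative) (auto intro!: derivative_eq_intros DERIV_Si)

lemma cos_tail_deriv: "(cos_tail has_vector_derivative of_real (Si x - pi / 2)) (at x)"
  unfolding cos_tail_def[abs_def]
  by (rule of_real_has_vector_derivative) (auto intro!: derivative_eq_intros DERIV_Si)

lemma Si_scaled_deriv:
  assumes "l \<noteq> 0" shows "((\<lambda>l. Si (x * l)) has_real_derivative sin (l * x) / l) (at l within T)"
proof -
  have "((\<lambda>l. Si (x * l)) has_real_derivative sinc (x * l) * x) (at l within T)"
    by (rule DERIV_chain2[OF DERIV_Si]) (auto intro!: derivative_eq_intros)
  then show ?thesis using assms by (cases "x = 0") (simp_all add: mult.commute)
qed

lemma Si_scaled_at_top:
  assumes "x > 0" shows "((\<lambda>A. Si (x * A)) \<longlongrightarrow> pi / 2) at_top"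
  by (rule filterlim_compose[OF Si_at_top]) (intro filterlim_tendsto_pos_mult_at_top[OF tendsto_const assms]
      filterlim_ident)

lemma sin_tail_limit:
  assumes x: "x > 0"
  shows "((\<lambda>A. integral {1..A} (\<lambda>l. of_real (sin (l * x) / l))) \<longlongrightarrow> sin_tail x) at_top"
proof (rule Lim_transform_eventually)
  show "((\<lambda>A. of_real (Si (x * A) - Si x)) \<longlongrightarrow> sin_tail x) at_top"
    unfolding sin_tail_def by (intro tendsto_intros Si_scaled_at_top x)
  show "\<forall>\<^sub>F A in at_top. of_real (Si (x * A) - Si x) = integral {1..A} (\<lambda>l. complex_of_real (sin (l * x) / l))"
    using eventually_ge_at_top[of 1]
  proof eventually_elim
    case (elim A)
    have "((\<lambda>l. complex_of_real (sin (l * x) / l)) has_integral of_real (Si (x * A)) - of_real (Si (x * 1))) {1..A}"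
    proof (rule fundamental_theorem_of_calculus[OF elim])
      fix l assume "l \<in> {1..A}"
      then show "((\<lambda>l. complex_of_real (Si (x * l))) has_vector_derivative of_real (sin (l * x) / l)) (at l within
          {1..A})"
        by (intro of_real_has_vector_derivative Si_scaled_deriv) simp
    qed
    then show ?case by (simp add: integral_unique)
  qed
qed

lemma cos_tail_limit:
  assumes x: "x \<ge> 0"
  shows "((\<lambda>A. integral {1..A} (\<lambda>l. of_real (cos (l * x) / l\<^sup>2))) \<longlongrightarrow> cos_tail x) at_top"
proof (rule Lim_transform_eventually)
  have "((\<lambda>A. - cos (x * A) / A) \<longlongrightarrow> 0) at_top"
  proof (rule Lim_null_comparison)
    show "\<forall>\<^sub>F A in at_top. norm (- cos (x * A) / A) \<le> 1 / A"
      using eventually_ge_at_top[of 1] by eventually_elim (simp add: divide_right_mono)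
    show "((\<lambda>A::real. 1 / A) \<longlongrightarrow> 0) at_top"
      by (intro tendsto_divide_0[OF tendsto_const] filterlim_at_top_imp_at_infinity filterlim_ident)
  qed
  moreover have "((\<lambda>A. x * Si (x * A)) \<longlongrightarrow> x * (pi / 2)) at_top"
    using x by (cases "x = 0") (simp, intro tendsto_mult tendsto_const Si_scaled_at_top, simp)
  ultimately have lim: "((\<lambda>A. - cos (x * A) / A) \<longlongrightarrow> 0) at_top" "((\<lambda>A. x * Si (x * A)) \<longlongrightarrow> x * (pi / 2)) at_top"
    by blast+
  have "((\<lambda>A. complex_of_real ((- cos (x * A) / A - x * Si (x * A)) - (- cos x - x * Si x))) \<longlongrightarrow>
      of_real ((0 - x * (pi / 2)) - (- cos x - x * Si x))) at_top"
    by (intro tendsto_of_real tendsto_diff lim tendsto_const)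
  then show "((\<lambda>A. complex_of_real ((- cos (x * A) / A - x * Si (x * A)) - (- cos x - x * Si x))) \<longlongrightarrow> cos_tail x)
      at_top"
    by (simp add: cos_tail_def algebra_simps)
  show "\<forall>\<^sub>F A in at_top. complex_of_real ((- cos (x * A) / A - x * Si (x * A)) - (- cos x - x * Si x))
      = integral {1..A} (\<lambda>l. complex_of_real (cos (l * x) / l\<^sup>2))"
    using eventually_ge_at_top[of 1]
  proof eventually_elim
    case (elim A)
    have "((\<lambda>l. complex_of_real (cos (l * x) / l\<^sup>2)) has_integral
        of_real (- cos (x * A) / A - x * Si (x * A)) - of_real (- cos (x * 1) / 1 - x * Si (x * 1))) {1..A}"
    proof (rule fundamental_theorem_of_calculus[OF elim])
      fix l assume l: "l \<in> {1..A}"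
      have "((\<lambda>l. - cos (x * l) / l - x * Si (x * l)) has_real_derivative cos (l * x) / l\<^sup>2) (at l within {1..A})"
      proof -
        have "((\<lambda>l. - cos (x * l) / l) has_real_derivative x * sin (x * l) / l + cos (x * l) / l\<^sup>2) (at l within
            {1..A})"
          using l by (auto intro!: derivative_eq_intros simp: field_simps power2_eq_square)
        from DERIV_diff[OF this DERIV_cmult[OF Si_scaled_deriv[of l x], of x]] show ?thesis
          using l by (simp add: mult.commute)
      qed
      then show "((\<lambda>l. complex_of_real (- cos (x * l) / l - x * Si (x * l))) has_vector_derivative of_real (cos (l *
          x) / l\<^sup>2)) (at l within {1..A})"
        by (rule of_real_has_vector_derivative)
    qed
    then show ?case by (simp add: integral_unique)
  qed
qed

section \<open>Transforms of the amplitudes\<close>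

lemma controlled_limit:
  assumes ctrl: "controlled {1..} f f'"
    and S: "continuous_on UNIV S" "\<And>x. \<bar>S x\<bar> \<le> 1" and t: "t \<in> {0..1}"
  shows "((\<lambda>A. integral {1..A} (\<lambda>l. of_real (S (l * x)) * f l t)) \<longlongrightarrow>
    integral {1..} (\<lambda>l. of_real (S (l * x)) * f l t)) at_top"
proof -
  from ctrl obtain w where w: "w integrable_on {1..}" "\<And>l. l \<ge> 1 \<Longrightarrow> (1 + \<bar>l\<bar>) * norm (f l t) \<le> w l"
    using t unfolding controlled_def by (metis atLeast_iff)
  show ?thesis
  proof (rule integral_at_top_limit(2)[OF _ w(1)])
    show "(\<lambda>l. of_real (S (l * x)) * f l t) integrable_on {1..A}" for A
      by (rule integrable_on_subinterval[OF controlled_integrable[OF ctrl _ S t]]) auto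
    fix l :: real assume l: "l \<ge> 1"
    have "norm (of_real (S (l * x)) * f l t) \<le> (1 + \<bar>l\<bar>) * norm (f l t)"
      unfolding norm_mult using S(2)[of "l * x"] by (intro mult_right_mono) auto
    then show "norm (of_real (S (l * x)) * f l t) \<le> w l" using w(2)[OF l] by simp
  qed
qed

lemma integral_lincomb3:
  fixes f g h :: "real \<Rightarrow> complex"
  assumes "f integrable_on K" "g integrable_on K" "h integrable_on K"
  shows "integral K (\<lambda>l. f l + (a * g l + b * h l)) = integral K f + (a * integral K g + b * integral K h)"
  using assms by (simp add: integral_add integrable_on_mult_right integrable_add)

lemma corner_C1_add: "corner_C1 \<Omega> P \<Longrightarrow> corner_C1 \<Omega> Q \<Longrightarrow> corner_C1 \<Omega> (\<lambda>x t. P x t + Q x t)"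
  using corner_C1_lincomb[of \<Omega> P Q 1 1] by simp

lemma corner_C1_cmult: "corner_C1 \<Omega> P \<Longrightarrow> corner_C1 \<Omega> (\<lambda>x t. a * P x t)"
  using corner_C1_lincomb[of \<Omega> P P a 0] by simp

context half_line_data
begin

text \<open>Product-to-sum formulas. Only the absolute value of \<open>x - t\<close> enters, and this is the sole source of
non-smoothness on the diagonal.\<close>

lemma cos_difference_limit:
  assumes "0 < x" "0 < t"
  shows "((\<lambda>A. integral {1..A} (\<lambda>l. of_real (sin (l * x) * sin (l * t) / l\<^sup>2)))
      \<longlongrightarrow> (cos_tail \<bar>x - t\<bar> - cos_tail (x + t)) / 2) at_top"
    and "((\<lambda>A. integral {1..A} (\<lambda>l. of_real (cos (l * x) * cos (l * t) / l\<^sup>2)))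
      \<longlongrightarrow> (cos_tail \<bar>x - t\<bar> + cos_tail (x + t)) / 2) at_top"
proof -
  let ?c = "\<lambda>y l. complex_of_real (cos (l * y) / l\<^sup>2)"
  have int: "?c y integrable_on {1..A}" for y A
    by (intro integrable_continuous_real continuous_intros) auto
  have "cos (l * \<bar>y\<bar>) = cos (l * y)" for l y :: real by (cases "y \<ge> 0") auto
  then have abs: "cos (l * \<bar>x - t\<bar>) = cos (l * x - l * t)" for l by (simp add: right_diff_distrib)
  have "integral {1..A} (\<lambda>l. complex_of_real (sin (l * x) * sin (l * t) / l\<^sup>2))
      = (integral {1..A} (?c \<bar>x - t\<bar>) - integral {1..A} (?c (x + t))) / 2" for A
    unfolding integral_diff[OF int int, symmetric] integral_divide[symmetric]
    by (rule arg_cong[where f = "integral _"], rule ext)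
       (simp add: abs distrib_left cos_add cos_diff diff_divide_distrib add_divide_distrib)
  then show "((\<lambda>A. integral {1..A} (\<lambda>l. complex_of_real (sin (l * x) * sin (l * t) / l\<^sup>2)))
      \<longlongrightarrow> (cos_tail \<bar>x - t\<bar> - cos_tail (x + t)) / 2) at_top"
    using assms by (simp only:) (intro tendsto_divide tendsto_diff cos_tail_limit tendsto_const; simp)
  have "integral {1..A} (\<lambda>l. complex_of_real (cos (l * x) * cos (l * t) / l\<^sup>2))
      = (integral {1..A} (?c \<bar>x - t\<bar>) + integral {1..A} (?c (x + t))) / 2" for A
    unfolding integral_add[OF int int, symmetric] integral_divide[symmetric]
    by (rule arg_cong[where f = "integral _"], rule ext)
       (simp add: abs distrib_left cos_add cos_diff add_divide_distrib diff_divide_distrib)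
  then show "((\<lambda>A. integral {1..A} (\<lambda>l. complex_of_real (cos (l * x) * cos (l * t) / l\<^sup>2)))
      \<longlongrightarrow> (cos_tail \<bar>x - t\<bar> + cos_tail (x + t)) / 2) at_top"
    using assms by (simp only:) (intro tendsto_divide tendsto_add cos_tail_limit tendsto_const; simp)
qed

lemma trig_continuous: "continuous_on UNIV (sin :: real \<Rightarrow> real)" "continuous_on UNIV (cos :: real \<Rightarrow> real)"
  by (intro continuous_intros)+

lemma tail_derivs_continuous: "continuous_on UNIV (\<lambda>x. complex_of_real (Si x - pi / 2))" "continuous_on UNIV (\<lambda>x.
    complex_of_real (- sinc x))"
  by (intro continuous_intros continuous_at_imp_continuous_on ballI isCont_Si isCont_sinc)+

lemma corner_C1_cos_tails:
  assumes "\<And>x t. (x, t) \<in> \<Omega> \<Longrightarrow> \<bar>x - t\<bar> = \<epsilon> * (x - t)" "open \<Omega>"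
  shows "corner_C1 \<Omega> (\<lambda>x t. cos_tail \<bar>x - t\<bar>)" "corner_C1 \<Omega> (\<lambda>x t. cos_tail (x + t))"
proof -
  note c = tail_derivs_continuous(1)
  show "corner_C1 \<Omega> (\<lambda>x t. cos_tail (x + t))"
    using corner_C1_linear_argument[OF cos_tail_deriv c, of \<Omega> 1 1] by simp
  show "corner_C1 \<Omega> (\<lambda>x t. cos_tail \<bar>x - t\<bar>)"
    by (rule corner_C1_cong[OF corner_C1_linear_argument[OF cos_tail_deriv c, of \<Omega> \<epsilon> "- \<epsilon>"] assms(2)])
       (simp add: assms(1) right_diff_distrib)
qed

text \<open>The half-line is split at \<open>1\<close>. Below, the amplitude itself is controlled; above, its remainder is,
and the leading terms are integrated in closed form.\<close>

lemma corner_C1_sine_transform: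
  assumes \<Omega>: "open \<Omega>" "\<Omega> \<subseteq> {0<..<1} \<times> {0<..<1}" "\<And>x t. (x, t) \<in> \<Omega> \<Longrightarrow> \<bar>x - t\<bar> = \<epsilon> * (x - t)"
    and int: "\<And>x t A. (x, t) \<in> \<Omega> \<Longrightarrow> (\<lambda>l. of_real (sin (l * x)) * Amp1 l t) integrable_on {0..A}"
    and lim: "\<And>x t. (x, t) \<in> \<Omega> \<Longrightarrow> ((\<lambda>A. integral {0..A} (\<lambda>l. of_real (sin (l * x)) * Amp1 l t)) \<longlongrightarrow> P x t) at_top"
  shows "corner_C1 \<Omega> P"
proof -
  obtain f' where f': "controlled {1..} (\<lambda>l t. Amp1 l t - (- \<i> * r0 0 t / of_real l - \<i> * wave_coeff * of_real (sin
      (l * t)) / of_real l ^ 2)) f'"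
      (is "controlled _ ?w _")
    using high_frequency(1) by blast
  let ?W = "\<lambda>x t. integral {0<..1} (\<lambda>l. of_real (sin (l * x)) * Amp1 l t)
     + (integral {1..} (\<lambda>l. of_real (sin (l * x)) * ?w l t)
     + ((- \<i>) * (r0 0 t * sin_tail x) + (- \<i> * wave_coeff / 2) * (cos_tail \<bar>x - t\<bar> + (-1) * cos_tail (x + t))))"
  have "corner_C1 \<Omega> ?W"
  proof (intro corner_C1_add corner_C1_cmult corner_C1_cos_tails[OF \<Omega>(3,1)])
    show "corner_C1 \<Omega> (\<lambda>x t. integral {0<..1} (\<lambda>l. of_real (sin (l * x)) * Amp1 l t))"
      by (rule corner_C1_integral[OF low_frequency(1) _ _ trig_continuous(2) _ _ \<Omega>(2)]) (auto intro!:
          derivative_eq_intros)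
    show "corner_C1 \<Omega> (\<lambda>x t. integral {1..} (\<lambda>l. of_real (sin (l * x)) * ?w l t))"
      by (rule corner_C1_integral[OF f' _ _ trig_continuous(2) _ _ \<Omega>(2)]) (auto intro!: derivative_eq_intros)
    show "corner_C1 \<Omega> (\<lambda>x t. r0 0 t * sin_tail x)"
      by (rule corner_C1_product[OF \<Omega>(2) r_deriv(1) _ sin_tail_deriv tail_derivs_continuous(2)])
         (auto intro: continuous_on_vector_derivative r_deriv)
  qed
  then show ?thesis
  proof (rule corner_C1_cong[OF _ \<Omega>(1)])
    fix x t assume xt: "(x, t) \<in> \<Omega>"
    then have x: "0 < x" "0 < t" "t \<in> {0..1}" using \<Omega>(2) by auto
    have iw: "(\<lambda>l. of_real (sin (l * x)) * ?w l t) integrable_on {1..A}" for A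
      by (rule integrable_on_subinterval[OF controlled_integrable[OF f' _ trig_continuous(1) _ x(3)]]) auto
    have isc: "(\<lambda>l. complex_of_real (sin (l * x) / l)) integrable_on {1..A}"
      "(\<lambda>l. complex_of_real (sin (l * x) * sin (l * t) / l\<^sup>2)) integrable_on {1..A}" for A
      by (intro integrable_continuous_real continuous_intros; auto)+
    have eq: "integral {1..A} (\<lambda>l. of_real (sin (l * x)) * Amp1 l t)
      = integral {1..A} (\<lambda>l. of_real (sin (l * x)) * ?w l t)
        + ((- \<i> * r0 0 t) * integral {1..A} (\<lambda>l. of_real (sin (l * x) / l))
           + (- \<i> * wave_coeff) * integral {1..A} (\<lambda>l. of_real (sin (l * x) * sin (l * t) / l\<^sup>2)))" for A
      unfolding integral_lincomb3[OF iw isc, symmetric]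
      by (rule arg_cong[where f = "integral _"], rule ext) (simp add: algebra_simps)
    have "((\<lambda>A. integral {1..A} (\<lambda>l. of_real (sin (l * x)) * Amp1 l t)) \<longlongrightarrow>
        integral {1..} (\<lambda>l. of_real (sin (l * x)) * ?w l t)
        + ((- \<i> * r0 0 t) * sin_tail x + (- \<i> * wave_coeff) * ((cos_tail \<bar>x - t\<bar> - cos_tail (x + t)) / 2))) at_top"
      unfolding eq using x
      by (intro tendsto_add tendsto_mult tendsto_const controlled_limit[OF f' trig_continuous(1)] sin_tail_limit
          cos_difference_limit) auto
    from tendsto_unique[OF _ integral_Icc_split_limit[OF int[OF xt] this] lim[OF xt]]
    show "?W x t = P x t"
      by (simp add: integral_Ioc_eq algebra_simps diff_divide_distrib)
  qed
qed

lemma corner_C1_cosine_transform: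
  assumes \<Omega>: "open \<Omega>" "\<Omega> \<subseteq> {0<..<1} \<times> {0<..<1}" "\<And>x t. (x, t) \<in> \<Omega> \<Longrightarrow> \<bar>x - t\<bar> = \<epsilon> * (x - t)"
    and int: "\<And>x t A. (x, t) \<in> \<Omega> \<Longrightarrow> (\<lambda>l. of_real (cos (l * x)) * Amp2 l t) integrable_on {0..A}"
    and lim: "\<And>x t. (x, t) \<in> \<Omega> \<Longrightarrow> ((\<lambda>A. integral {0..A} (\<lambda>l. of_real (cos (l * x)) * Amp2 l t)) \<longlongrightarrow> P x t) at_top"
  shows "corner_C1 \<Omega> P"
proof -
  obtain f' where f': "controlled {1..} (\<lambda>l t. Amp2 l t - (second_order 0 t / of_real l ^ 2 + wave_coeff * of_real
      (cos (l * t)) / of_real l ^ 2)) f'"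
      (is "controlled _ ?w _")
    using high_frequency(2) by blast
  let ?W = "\<lambda>x t. integral {0<..1} (\<lambda>l. of_real (cos (l * x)) * Amp2 l t)
     + (integral {1..} (\<lambda>l. of_real (cos (l * x)) * ?w l t)
     + (second_order 0 t * cos_tail x + (wave_coeff / 2) * (cos_tail \<bar>x - t\<bar> + cos_tail (x + t))))"
  have "corner_C1 \<Omega> ?W"
  proof (intro corner_C1_add corner_C1_cmult corner_C1_cos_tails[OF \<Omega>(3,1)])
    show "corner_C1 \<Omega> (\<lambda>x t. integral {0<..1} (\<lambda>l. of_real (cos (l * x)) * Amp2 l t))"
      by (rule corner_C1_integral[OF low_frequency(2), where S' = "\<lambda>x. - sin x"])
         (use \<Omega>(2) in \<open>auto intro!: derivative_eq_intros continuous_intros\<close>)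
    show "corner_C1 \<Omega> (\<lambda>x t. integral {1..} (\<lambda>l. of_real (cos (l * x)) * ?w l t))"
      by (rule corner_C1_integral[OF f', where S' = "\<lambda>x. - sin x"])
         (use \<Omega>(2) in \<open>auto intro!: derivative_eq_intros continuous_intros\<close>)
    show "corner_C1 \<Omega> (\<lambda>x t. second_order 0 t * cos_tail x)"
      by (rule corner_C1_product[OF \<Omega>(2) second_order_deriv _ cos_tail_deriv tail_derivs_continuous(1)])
         (auto intro: continuous_on_vector_derivative second_order_deriv)
  qed
  then show ?thesis
  proof (rule corner_C1_cong[OF _ \<Omega>(1)])
    fix x t assume xt: "(x, t) \<in> \<Omega>"
    then have x: "0 < x" "0 < t" "t \<in> {0..1}" using \<Omega>(2) by auto
    have iw: "(\<lambda>l. of_real (cos (l * x)) * ?w l t) integrable_on {1..A}" for A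
      by (rule integrable_on_subinterval[OF controlled_integrable[OF f' _ trig_continuous(2) _ x(3)]]) auto
    have isc: "(\<lambda>l. complex_of_real (cos (l * x) / l\<^sup>2)) integrable_on {1..A}"
      "(\<lambda>l. complex_of_real (cos (l * x) * cos (l * t) / l\<^sup>2)) integrable_on {1..A}" for A
      by (intro integrable_continuous_real continuous_intros; auto)+
    have eq: "integral {1..A} (\<lambda>l. of_real (cos (l * x)) * Amp2 l t)
      = integral {1..A} (\<lambda>l. of_real (cos (l * x)) * ?w l t)
        + (second_order 0 t * integral {1..A} (\<lambda>l. of_real (cos (l * x) / l\<^sup>2))
           + wave_coeff * integral {1..A} (\<lambda>l. of_real (cos (l * x) * cos (l * t) / l\<^sup>2)))" for A
      unfolding integral_lincomb3[OF iw isc, symmetric]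
      by (rule arg_cong[where f = "integral _"], rule ext) (simp add: algebra_simps)
    have "((\<lambda>A. integral {1..A} (\<lambda>l. of_real (cos (l * x)) * Amp2 l t)) \<longlongrightarrow>
        integral {1..} (\<lambda>l. of_real (cos (l * x)) * ?w l t)
        + (second_order 0 t * cos_tail x + wave_coeff * ((cos_tail \<bar>x - t\<bar> + cos_tail (x + t)) / 2))) at_top"
      unfolding eq using x
      by (intro tendsto_add tendsto_mult tendsto_const controlled_limit[OF f' trig_continuous(2)] cos_tail_limit
          cos_difference_limit) auto
    from tendsto_unique[OF _ integral_Icc_split_limit[OF int[OF xt] this] lim[OF xt]]
    show "?W x t = P x t"
      by (simp add: integral_Ioc_eq algebra_simps add_divide_distrib)
  qed
qed

end

section \<open>Passing to the limit at the corner\<close>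

definition below_diagonal :: "(real \<times> real) set" where
  "below_diagonal = {(x, t). 0 < t \<and> t < x \<and> x < 1}"

definition above_diagonal :: "(real \<times> real) set" where
  "above_diagonal = {(x, t). 0 < x \<and> x < t \<and> t < 1}"

lemma diagonal_regions:
  shows "open below_diagonal" "open above_diagonal"
    and "below_diagonal \<subseteq> {0<..<1} \<times> {0<..<1}" "above_diagonal \<subseteq> {0<..<1} \<times> {0<..<1}"
    and "\<And>x t. (x, t) \<in> below_diagonal \<Longrightarrow> \<bar>x - t\<bar> = 1 * (x - t)"
    and "\<And>x t. (x, t) \<in> above_diagonal \<Longrightarrow> \<bar>x - t\<bar> = (- 1) * (x - t)"
proof -
  have "open ({p::real \<times> real. 0 < snd p} \<inter> {p. snd p < fst p} \<inter> {p. fst p < 1})"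
    "open ({p::real \<times> real. 0 < fst p} \<inter> {p. fst p < snd p} \<inter> {p. snd p < 1})"
    by (intro open_Int open_Collect_less continuous_intros)+
  moreover have "{p::real \<times> real. 0 < snd p} \<inter> {p. snd p < fst p} \<inter> {p. fst p < 1} = below_diagonal"
    "{p::real \<times> real. 0 < fst p} \<inter> {p. fst p < snd p} \<inter> {p. snd p < 1} = above_diagonal"
    by (auto simp: below_diagonal_def above_diagonal_def)
  ultimately show "open below_diagonal" "open above_diagonal" by simp_all
qed (auto simp: below_diagonal_def above_diagonal_def)

abbreviation "punctured \<equiv> quadrant - {(0, 0)}"

text \<open>An estimate on \<open>\<Omega>\<close> close to the origin passes to those points of the punctured quadrant that are
limits of points of \<open>\<Omega>\<close>.\<close>

lemma boundary_bound:
  fixes D :: "real \<times> real \<Rightarrow> complex"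
  assumes cont: "continuous_on punctured D" and p: "p \<in> punctured" "dist p (0, 0) < \<delta>"
    and q: "\<And>n. q n \<in> \<Omega>" "\<Omega> \<subseteq> punctured" "q \<longlonglongrightarrow> p"
    and le: "\<And>z. z \<in> \<Omega> \<Longrightarrow> dist z (0, 0) < \<delta> \<Longrightarrow> dist (D z) L \<le> \<epsilon>"
  shows "dist (D p) L \<le> \<epsilon>"
proof (rule tendsto_upperbound)
  have "(\<lambda>n. D (q n)) \<longlonglongrightarrow> D p"
    by (rule continuous_on_tendsto_compose[OF cont q(3) p(1)], rule always_eventually) (use q in blast)
  then show "(\<lambda>n. dist (D (q n)) L) \<longlonglongrightarrow> dist (D p) L" by (intro tendsto_intros)
  have "(\<lambda>n. dist (q n) (0, 0)) \<longlonglongrightarrow> dist p (0, 0)" by (intro tendsto_intros q)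
  from order_tendstoD(2)[OF this p(2)] show "\<forall>\<^sub>F n in sequentially. dist (D (q n)) L \<le> \<epsilon>"
    by eventually_elim (use le q in blast)
qed simp

lemma approach_below:
  assumes "0 \<le> t" "t \<le> x" "0 < x" "x < 1"
  obtains q where "\<And>n. q n \<in> below_diagonal" "q \<longlonglongrightarrow> (x, t)"
proof
  let ?s = "\<lambda>n. inverse (real (Suc (Suc n)))"
  have s: "0 < ?s n" "?s n < 1" for n by (auto simp: field_simps)
  \<comment> \<open>moving from \<open>t\<close> towards \<open>x / 2\<close> enters the region from both of its boundary lines \<open>t = 0\<close> and \<open>t = x\<close>\<close>
  show "(x, t + ?s n * (x / 2 - t)) \<in> below_diagonal" for n
  proof -
    have "t + ?s n * (x / 2 - t) = (1 - ?s n) * t + ?s n * (x / 2)" by (simp add: algebra_simps)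
    moreover have "0 < (1 - ?s n) * t + ?s n * (x / 2)"
      using s[of n] assms by (intro add_nonneg_pos mult_nonneg_nonneg mult_pos_pos) auto
    moreover have "(1 - ?s n) * t + ?s n * (x / 2) < (1 - ?s n) * x + ?s n * x"
      using s[of n] assms by (intro add_le_less_mono mult_left_mono mult_strict_left_mono) auto
    ultimately show ?thesis using assms by (auto simp: below_diagonal_def algebra_simps)
  qed
  have "?s \<longlonglongrightarrow> 0" using LIMSEQ_Suc[OF LIMSEQ_inverse_real_of_nat] by simp
  then have "(\<lambda>n. (x, t + ?s n * (x / 2 - t))) \<longlonglongrightarrow> (x, t + 0 * (x / 2 - t))"
    by (intro tendsto_Pair tendsto_add tendsto_mult tendsto_const)
  then show "(\<lambda>n. (x, t + ?s n * (x / 2 - t))) \<longlonglongrightarrow> (x, t)" by simp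
qed

lemma approach_above:
  assumes "0 \<le> x" "x \<le> t" "0 < t" "t < 1"
  obtains q where "\<And>n. q n \<in> above_diagonal" "q \<longlonglongrightarrow> (x, t)"
proof -
  obtain q where q: "\<And>n. q n \<in> below_diagonal" "q \<longlonglongrightarrow> (t, x)"
    using approach_below[OF assms] by blast
  show ?thesis
  proof (rule that)
    show "prod.swap (q n) \<in> above_diagonal" for n
      using q(1)[of n] by (auto simp: below_diagonal_def above_diagonal_def prod.swap_def)
    show "(\<lambda>n. prod.swap (q n)) \<longlonglongrightarrow> (x, t)"
      using tendsto_Pair[OF tendsto_snd[OF q(2)] tendsto_fst[OF q(2)]] by (simp add: prod.swap_def)
  qed
qed

text \<open>Every point of the punctured quadrant close to the origin is a limit of points of one of the two
regions, and the diagonal points are limits of points of both. Hence the values of \<open>D\<close> at small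
diagonal points are close to both one-sided limits.\<close>

lemma limit_across_diagonal:
  fixes D :: "real \<times> real \<Rightarrow> complex"
  assumes cont: "continuous_on punctured D"
    and La: "(D \<longlongrightarrow> La) (at (0, 0) within below_diagonal)"
    and Lb: "(D \<longlongrightarrow> Lb) (at (0, 0) within above_diagonal)"
  shows "\<exists>L. (D \<longlongrightarrow> L) (at (0, 0) within punctured) \<and> continuous_on quadrant (D((0, 0) := L))"
proof -
  have sub: "below_diagonal \<subseteq> punctured" "above_diagonal \<subseteq> punctured"
    by (auto simp: below_diagonal_def above_diagonal_def quadrant_def)
  have key: "\<exists>\<delta>>0. \<forall>(x, t)\<in>punctured. dist (x, t) (0, 0) < \<delta> \<longrightarrow>
      (t \<le> x \<longrightarrow> dist (D (x, t)) La \<le> \<epsilon>) \<and> (x \<le> t \<longrightarrow> dist (D (x, t)) Lb \<le> \<epsilon>)" if \<epsilon>: "\<epsilon> > 0" for \<epsilon>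
  proof -
    obtain d1 where d1: "d1 > 0" "\<And>z. z \<in> below_diagonal \<Longrightarrow> dist z (0, 0) < d1 \<Longrightarrow> dist (D z) La \<le> \<epsilon>"
      using La \<epsilon> unfolding Lim_within by (force simp: below_diagonal_def intro: less_imp_le)
    obtain d2 where d2: "d2 > 0" "\<And>z. z \<in> above_diagonal \<Longrightarrow> dist z (0, 0) < d2 \<Longrightarrow> dist (D z) Lb \<le> \<epsilon>"
      using Lb \<epsilon> unfolding Lim_within by (force simp: above_diagonal_def intro: less_imp_le)
    have "(t \<le> x \<longrightarrow> dist (D (x, t)) La \<le> \<epsilon>) \<and> (x \<le> t \<longrightarrow> dist (D (x, t)) Lb \<le> \<epsilon>)"
      if p: "(x, t) \<in> punctured" and d: "dist (x, t) (0, 0) < min 1 (min d1 d2)" for x t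
    proof (intro conjI impI)
      have nn: "0 \<le> x" "0 \<le> t" "x > 0 \<or> t > 0" using p by (auto simp: quadrant_def)
      have "dist x 0 < 1" "dist t 0 < 1" using d dist_fst_le[of "(x, t)" "(0, 0)"] dist_snd_le[of "(x, t)" "(0, 0)"]
          by auto
      then have lt: "x < 1" "t < 1" by (auto simp: dist_real_def)
      show "dist (D (x, t)) La \<le> \<epsilon>" if le: "t \<le> x"
      proof -
        have "0 < x" using that nn by arith
        then obtain q where q: "\<And>n. q n \<in> below_diagonal" "q \<longlonglongrightarrow> (x, t)"
          using approach_below[OF nn(2) le _ lt(1)] by blast
        show ?thesis by (rule boundary_bound[OF cont p _ q(1) sub(1) q(2) d1(2)]) (use d in auto)
      qed
      show "dist (D (x, t)) Lb \<le> \<epsilon>" if le: "x \<le> t"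
      proof -
        have "0 < t" using that nn by arith
        then obtain q where q: "\<And>n. q n \<in> above_diagonal" "q \<longlonglongrightarrow> (x, t)"
          using approach_above[OF nn(1) le _ lt(2)] by blast
        show ?thesis by (rule boundary_bound[OF cont p _ q(1) sub(2) q(2) d2(2)]) (use d in auto)
      qed
    qed
    then show ?thesis using d1(1) d2(1) by (intro exI[of _ "min 1 (min d1 d2)"]) auto
  qed
  have eq: "La = Lb"
  proof -
    have "dist La Lb \<le> \<epsilon>" if "\<epsilon> > 0" for \<epsilon>
    proof -
      obtain \<delta> where \<delta>: "\<delta> > 0" "\<forall>(x, t)\<in>punctured. dist (x, t) (0, 0) < \<delta> \<longrightarrow>
        (t \<le> x \<longrightarrow> dist (D (x, t)) La \<le> \<epsilon> / 2) \<and> (x \<le> t \<longrightarrow> dist (D (x, t)) Lb \<le> \<epsilon> / 2)"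
        using key[OF half_gt_zero[OF \<open>\<epsilon> > 0\<close>]] by blast
      have "dist (\<delta> / 3, \<delta> / 3) (0, 0) \<le> norm (\<delta> / 3) + norm (\<delta> / 3)"
        unfolding dist_norm using norm_Pair_le[of "\<delta> / 3" "\<delta> / 3"] by simp
      also have "\<dots> < \<delta>" using \<delta>(1) by simp
      finally have near: "dist (\<delta> / 3, \<delta> / 3) (0, 0) < \<delta>" .
      have mem: "(\<delta> / 3, \<delta> / 3) \<in> punctured" using \<delta>(1) by (simp add: quadrant_def)
      have "dist (D (\<delta> / 3, \<delta> / 3)) La \<le> \<epsilon> / 2" "dist (D (\<delta> / 3, \<delta> / 3)) Lb \<le> \<epsilon> / 2"
        using \<delta>(2)[rule_format, OF mem] near by auto
      then show ?thesis using dist_triangle2[of La Lb "D (\<delta> / 3, \<delta> / 3)"] dist_commute[of La "D (\<delta> / 3, \<delta> / 3)"]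
          dist_commute[of Lb "D (\<delta> / 3, \<delta> / 3)"] by linarith
    qed
    then show ?thesis by (meson dist_le_zero_iff dense_ge)
  qed
  have lim: "(D \<longlongrightarrow> La) (at (0, 0) within punctured)"
    unfolding tendsto_iff
  proof (intro allI impI)
    fix \<epsilon> :: real assume "\<epsilon> > 0"
    then obtain \<delta> where \<delta>: "\<delta> > 0" "\<forall>(x, t)\<in>punctured. dist (x, t) (0, 0) < \<delta> \<longrightarrow>
        (t \<le> x \<longrightarrow> dist (D (x, t)) La \<le> \<epsilon> / 2) \<and> (x \<le> t \<longrightarrow> dist (D (x, t)) Lb \<le> \<epsilon> / 2)"
      using key[OF half_gt_zero] by blast
    have "dist (D z) La < \<epsilon>" if "z \<in> punctured" "dist z (0, 0) < \<delta>" for z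
    proof -
      obtain x t where z: "z = (x, t)" by (cases z)
      have "dist (D z) La \<le> \<epsilon> / 2" using \<delta>(2)[rule_format, OF that(1)] that(2) eq unfolding z by (cases "t \<le> x") auto
      then show ?thesis using \<open>\<epsilon> > 0\<close> by linarith
    qed
    then show "\<forall>\<^sub>F z in at (0, 0) within punctured. dist (D z) La < \<epsilon>"
      unfolding eventually_at using \<delta>(1) by blast
  qed
  moreover have "continuous_on quadrant (D((0, 0) := La))"
    unfolding continuous_on_def
  proof
    fix z assume z: "z \<in> quadrant"
    show "((D((0, 0) := La)) \<longlongrightarrow> (D((0, 0) := La)) z) (at z within quadrant)"
    proof (cases "z = (0, 0)")
      case True
      have "(D((0, 0) := La) \<longlongrightarrow> La) (at (0, 0) within punctured)"
        by (rule Lim_transform_eventually[OF lim]) (auto simp: eventually_at_filter)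
      then show ?thesis unfolding True by (simp add: at_within_def Diff_insert_absorb Diff_idemp)
    next
      case False
      then have "(D \<longlongrightarrow> D z) (at z within punctured)"
        using cont z unfolding continuous_on_def by auto
      moreover have "at z within punctured = at z within quadrant"
        by (rule at_within_nhd[of _ "- {(0, 0)}"]) (use False in auto)
      ultimately have "(D \<longlongrightarrow> D z) (at z within quadrant)" by simp
      moreover have "\<forall>\<^sub>F y in at z within quadrant. D y = (D((0, 0) := La)) y"
        using eventually_at_ball'[of 1] False
        by (intro eventually_mono[OF eventually_neq_at_within[of "(0, 0)" z quadrant]]) auto
      ultimately show ?thesis using False by (auto intro: Lim_transform_eventually)
    qed
  qed
  ultimately show ?thesis by blast
qed

text \<open>In the two open regions the extension agrees with the formula \<open>P\<close>, so its partial derivatives along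
the slices of the quadrant are the ordinary partial derivatives of \<open>P\<close>.\<close>

lemma extension_gradient_limits:
  assumes ext: "C1_extension P \<Psi>"
    and P: "corner_C1 below_diagonal P" "corner_C1 above_diagonal P"
    and D: "D \<in> {pdx punctured \<Psi>, pdt punctured \<Psi>}"
  shows "\<exists>L. (D \<longlongrightarrow> L) (at (0, 0) within punctured) \<and> continuous_on quadrant (D((0, 0) := L))"
proof -
  have cont: "continuous_on punctured D"
    using ext D unfolding C1_extension_def by auto
  have lim: "\<exists>L. (D \<longlongrightarrow> L) (at (0, 0) within \<Omega>)"
    if C: "corner_C1 \<Omega> P" and \<Omega>: "open \<Omega>" "\<And>x t. (x, t) \<in> \<Omega> \<Longrightarrow> 0 < x \<and> 0 < t \<and> x \<noteq> t" for \<Omega>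
  proof -
    have "corner_C1 \<Omega> (\<lambda>x t. \<Psi> (x, t))"
      by (rule corner_C1_cong[OF C \<Omega>(1)]) (use ext \<Omega>(2) in \<open>auto simp: C1_extension_def\<close>)
    then obtain Px Pt Lx Lt where *:
      "\<And>x t. (x, t) \<in> \<Omega> \<Longrightarrow> ((\<lambda>y. \<Psi> (y, t)) has_vector_derivative Px (x, t)) (at x)"
      "\<And>x t. (x, t) \<in> \<Omega> \<Longrightarrow> ((\<lambda>s. \<Psi> (x, s)) has_vector_derivative Pt (x, t)) (at t)"
      "(Px \<longlongrightarrow> Lx) (at (0, 0) within \<Omega>)" "(Pt \<longlongrightarrow> Lt) (at (0, 0) within \<Omega>)"
      unfolding corner_C1_def by blast
    have slice: "at x within {y. (y, t) \<in> punctured} = at x" "at t within {s. (x, s) \<in> punctured} = at t"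
      if "(x, t) \<in> \<Omega>" for x t
    proof -
      have "0 < x" "0 < t" using \<Omega>(2)[OF that] by auto
      moreover from this have "{y. (y, t) \<in> punctured} = {0..}" "{s. (x, s) \<in> punctured} = {0..}"
        by (auto simp: quadrant_def)
      ultimately show "at x within {y. (y, t) \<in> punctured} = at x" "at t within {s. (x, s) \<in> punctured} = at t"
        by (auto intro!: at_within_interior)
    qed
    have eq: "Px z = pdx punctured \<Psi> z" "Pt z = pdt punctured \<Psi> z" if "z \<in> \<Omega>" for z
      using that *(1,2)[of "fst z" "snd z"] slice[of "fst z" "snd z"]
      by (auto simp: pdx_def pdt_def split_def vector_derivative_at)
    have "\<forall>\<^sub>F z in at (0, 0) within \<Omega>. Px z = pdx punctured \<Psi> z" "\<forall>\<^sub>F z in at (0, 0) within \<Omega>. Pt z = pdt punctured \<Psi>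
        z"
      unfolding eventually_at_filter by (rule always_eventually, use eq in blast)+
    then have "(pdx punctured \<Psi> \<longlongrightarrow> Lx) (at (0, 0) within \<Omega>)" "(pdt punctured \<Psi> \<longlongrightarrow> Lt) (at (0, 0) within \<Omega>)"
      using *(3,4) Lim_transform_eventually by blast+
    then show ?thesis using D by blast
  qed
  obtain La where "(D \<longlongrightarrow> La) (at (0, 0) within below_diagonal)"
    using lim[OF P(1) diagonal_regions(1)] by (auto simp: below_diagonal_def)
  moreover obtain Lb where "(D \<longlongrightarrow> Lb) (at (0, 0) within above_diagonal)"
    using lim[OF P(2) diagonal_regions(2)] by (auto simp: above_diagonal_def)
  ultimately show ?thesis by (rule limit_across_diagonal[OF cont])
qed

section \<open>Regularity of the data\<close>

lemma decay_from_moments: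
  fixes a M N y :: real
  assumes "a \<le> M" "y\<^sup>2 * a \<le> N" "a \<ge> 0" "y \<ge> 0"
  shows "a \<le> 2 * (\<bar>M\<bar> + \<bar>N\<bar>) / (1 + y)\<^sup>2"
proof -
  have "0 \<le> (1 - y)\<^sup>2 * a" using assms by simp
  then have "(1 + y)\<^sup>2 * a \<le> 2 * (a + y\<^sup>2 * a)" by (simp add: power2_eq_square algebra_simps)
  also have "\<dots> \<le> 2 * (\<bar>M\<bar> + \<bar>N\<bar>)"
    using assms by (intro mult_left_mono add_mono order_trans[OF _ abs_ge_self]) auto
  finally show ?thesis using assms(4) by (simp add: pos_le_divide_eq mult.commute)
qed

lemma uniform_decay_constant:
  fixes a :: "nat \<Rightarrow> 'i \<Rightarrow> real"
  assumes "\<And>n. \<exists>M. \<forall>i\<in>I. a n i \<le> M / (1 + y i)\<^sup>2" "\<And>i. i \<in> I \<Longrightarrow> 0 \<le> y i"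
  shows "\<exists>C. \<forall>n\<le>k. \<forall>i\<in>I. a n i \<le> C / (1 + y i)\<^sup>2"
proof -
  obtain M where M: "\<And>n i. i \<in> I \<Longrightarrow> a n i \<le> M n / (1 + y i)\<^sup>2"
    using assms(1) by metis
  have "a n i \<le> (\<Sum>j\<le>k. \<bar>M j\<bar>) / (1 + y i)\<^sup>2" if "n \<le> k" "i \<in> I" for n i
  proof -
    have "M n \<le> \<bar>M n\<bar>" by simp
    also have "\<dots> \<le> (\<Sum>j\<le>k. \<bar>M j\<bar>)" by (rule member_le_sum) (use that in auto)
    finally have "M n / (1 + y i)\<^sup>2 \<le> (\<Sum>j\<le>k. \<bar>M j\<bar>) / (1 + y i)\<^sup>2" by (rule divide_right_mono) simp
    then show ?thesis using M[OF that(2), of n] by linarith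
  qed
  then show ?thesis by blast
qed

lemma smooth_half_deriv:
  assumes "smooth_half h" "y \<ge> 0"
  shows "((half_deriv ^^ n) h has_vector_derivative (half_deriv ^^ Suc n) h y) (at y within {0..})"
  using assms vector_derivative_works unfolding smooth_half_def by (auto simp: half_deriv_def)

lemma schwartz_decaying:
  assumes "g \<in> schwartz_half"
  shows "\<exists>C. decaying_derivs C (\<lambda>n. (half_deriv ^^ n) g)"
proof -
  have sm: "smooth_half g" and bd: "\<And>a b. bdd_above ((\<lambda>x. x ^ a * norm ((half_deriv ^^ b) g x)) ` {0..})"
    using assms unfolding schwartz_half_def by auto
  have "\<exists>M. \<forall>y\<in>{0..}. norm ((half_deriv ^^ n) g y) \<le> M / (1 + y)\<^sup>2" for n
  proof -
    obtain M N where "\<And>y. y \<ge> 0 \<Longrightarrow> y ^ 0 * norm ((half_deriv ^^ n) g y) \<le> M"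
      "\<And>y. y \<ge> 0 \<Longrightarrow> y ^ 2 * norm ((half_deriv ^^ n) g y) \<le> N"
      using bd[of 0 n] bd[of 2 n] unfolding bdd_above_def by auto
    then show ?thesis
      by (intro exI[of _ "2 * (\<bar>M\<bar> + \<bar>N\<bar>)"] ballI decay_from_moments) auto
  qed
  from uniform_decay_constant[where a = "\<lambda>n y. norm ((half_deriv ^^ n) g y)", OF this, of 3]
  obtain C where "\<forall>n\<le>3. \<forall>y\<in>{0..}. norm ((half_deriv ^^ n) g y) \<le> C / (1 + y)\<^sup>2" by auto
  then show ?thesis
    using smooth_half_deriv[OF sm] unfolding decaying_derivs_def by (auto simp del: funpow.simps)
qed

lemma quadrant_slices: "t \<ge> 0 \<Longrightarrow> {y. (y, t) \<in> quadrant} = {0..}" "x \<ge> 0 \<Longrightarrow> {s. (x, s) \<in> quadrant} = {0..}"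
  by (auto simp: quadrant_def)

lemma smooth_quadrantD:
  assumes "smooth_quadrant F"
  shows "continuous_on quadrant F" "smooth_quadrant (pdx quadrant F)" "smooth_quadrant (pdt quadrant F)"
    and "x \<ge> 0 \<Longrightarrow> t \<ge> 0 \<Longrightarrow> ((\<lambda>y. F (y, t)) has_vector_derivative pdx quadrant F (x, t)) (at x within {0..})"
    and "x \<ge> 0 \<Longrightarrow> t \<ge> 0 \<Longrightarrow> ((\<lambda>s. F (x, s)) has_vector_derivative pdt quadrant F (x, t)) (at t within {0..})"
proof -
  have F: "Ck_on (Suc k) quadrant F" for k using assms unfolding smooth_quadrant_def by blast
  show "continuous_on quadrant F" "smooth_quadrant (pdx quadrant F)" "smooth_quadrant (pdt quadrant F)"
    using F unfolding smooth_quadrant_def by auto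
  assume xt: "x \<ge> 0" "t \<ge> 0"
  then have "(x, t) \<in> quadrant" by (simp add: quadrant_def)
  then have "(\<lambda>y. F (y, t)) differentiable (at x within {y. (y, t) \<in> quadrant})"
    "(\<lambda>s. F (x, s)) differentiable (at t within {s. (x, s) \<in> quadrant})"
    using F[of 0] by auto
  then show "((\<lambda>y. F (y, t)) has_vector_derivative pdx quadrant F (x, t)) (at x within {0..})"
    "((\<lambda>s. F (x, s)) has_vector_derivative pdt quadrant F (x, t)) (at t within {0..})"
    unfolding quadrant_slices[OF xt(2)] quadrant_slices[OF xt(1)] vector_derivative_works
    by (simp_all add: pdx_def pdt_def quadrant_slices xt)
qed

lemma smooth_quadrant_funpow:
  assumes "smooth_quadrant F"
  shows "smooth_quadrant ((pdx quadrant ^^ n) F)" "smooth_quadrant ((pdt quadrant ^^ n) F)"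
  by (induction n) (auto simp: assms smooth_quadrantD)

text \<open>The hypothesis bounds \<open>f\<close> only for positive arguments; by continuity the bounds extend to the
boundary of the quadrant.\<close>

lemma rapid_decaying:
  assumes sm: "smooth_quadrant f" and rd: "rapid_decay f"
  shows "\<exists>C. \<forall>\<tau>\<in>{0..1}. decaying_derivs C (\<lambda>n y. (pdx quadrant ^^ n) f (y, \<tau>))"
proof -
  have "\<exists>M. \<forall>p\<in>{0<..} \<times> {0..1}. norm ((pdx quadrant ^^ n) f p) \<le> M / (1 + fst p)\<^sup>2" for n
  proof -
    have "bdd_above ((\<lambda>(x, t). x ^ E * norm ((pdx quadrant ^^ n) ((pdt quadrant ^^ 0) f) (x, t))) ` ({0<..} \<times>
        {0..1}))" for E
      by (rule rd[unfolded rapid_decay_def, rule_format, OF zero_less_one])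
    from this[of 0] this[of 2]
    obtain M N where "\<forall>y\<in>{0<..}. \<forall>t\<in>{0..1}. norm ((pdx quadrant ^^ n) f (y, t)) \<le> M"
      "\<forall>y\<in>{0<..}. \<forall>t\<in>{0..1}. y ^ 2 * norm ((pdx quadrant ^^ n) f (y, t)) \<le> N"
      unfolding bdd_above_def by auto
    then show ?thesis
      by (intro exI[of _ "2 * (\<bar>M\<bar> + \<bar>N\<bar>)"] ballI decay_from_moments) auto
  qed
  from uniform_decay_constant[where a = "\<lambda>n p. norm ((pdx quadrant ^^ n) f p)", OF this, of 3]
  obtain C where C: "\<forall>n\<le>3. \<forall>p\<in>{0<..} \<times> {0..1}. norm ((pdx quadrant ^^ n) f p) \<le> C / (1 + fst p)\<^sup>2" by auto
  have "decaying_derivs C (\<lambda>n y. (pdx quadrant ^^ n) f (y, \<tau>))" if \<tau>: "\<tau> \<in> {0..1}" for \<tau>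
    unfolding decaying_derivs_def
  proof (intro conjI allI impI)
    have der: "((\<lambda>y. (pdx quadrant ^^ n) f (y, \<tau>)) has_vector_derivative (pdx quadrant ^^ Suc n) f (y, \<tau>)) (at y
        within {0..})"
      if "y \<ge> 0" for n y
      using smooth_quadrantD(4)[OF smooth_quadrant_funpow(1)[OF sm, of n], of y \<tau>] that \<tau> by simp
    then show "((\<lambda>y. (pdx quadrant ^^ n) f (y, \<tau>)) has_vector_derivative (pdx quadrant ^^ Suc n) f (y, \<tau>)) (at y
        within {0..})"
      if "y \<ge> 0" for n y using that .
    fix n :: nat and y :: real assume n: "n \<le> 3" and y: "y \<ge> 0"
    let ?h = "\<lambda>y. of_real ((1 + y)\<^sup>2) * (pdx quadrant ^^ n) f (y, \<tau>)"
    have "continuous_on {0..} (\<lambda>y. (pdx quadrant ^^ n) f (y, \<tau>))"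
      by (rule continuous_on_vector_derivative) (use der in auto)
    then have "continuous_on (closure {0<..}) ?h"
      by (auto intro!: continuous_intros)
    moreover have "\<forall>z\<in>{0<..}. norm (?h z) \<le> C"
      using C[rule_format, OF n, of "(z, \<tau>)" for z] \<tau> by (auto simp: norm_mult pos_le_divide_eq mult.commute simp
          flip: of_real_power)
    ultimately have "norm (?h y) \<le> C"
      by (rule continuous_on_closure_norm_le) (use y in auto)
    then show "norm ((pdx quadrant ^^ n) f (y, \<tau>)) \<le> C / (1 + y)\<^sup>2"
      using y by (simp add: norm_mult pos_le_divide_eq mult.commute del: of_real_power)
  qed
  then show ?thesis by blast
qed

text \<open>In the odd part of \<open>hat_expansion\<close> the even power of \<open>1 / l\<close> cancels, in the even part the odd one.\<close>

lemma hat_parity: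
  assumes d: "decaying_derivs C d" and l: "l \<ge> 1"
  shows "norm (hat (d 0) l - hat (d 0) (- l) + 2 * \<i> * d 0 0 / of_real l) \<le> 4 * C / l ^ 3"
    and "norm (hat (d 0) l + hat (d 0) (- l) + 2 * d 1 0 / (of_real l)\<^sup>2) \<le> 4 * C / l ^ 3"
proof -
  let ?e = "\<lambda>l. hat (d 0) l - (d 0 0 / (\<i> * of_real l) + d 1 0 / (\<i> * of_real l)\<^sup>2)"
  have e: "norm (?e l) \<le> 2 * C / l ^ 3" "norm (?e (- l)) \<le> 2 * C / l ^ 3"
    using hat_expansion(2)[OF d, of l] hat_expansion(2)[OF d, of "- l"] l by auto
  have 1: "d 0 0 / (\<i> * of_real l) = - \<i> * (d 0 0 / of_real l)" "d 0 0 / (\<i> * of_real (- l)) = \<i> * (d 0 0 / of_real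
      l)"
    "d 1 0 / (\<i> * of_real l)\<^sup>2 = - (d 1 0 / (of_real l)\<^sup>2)" "d 1 0 / (\<i> * of_real (- l))\<^sup>2 = - (d 1 0 / (of_real
        l)\<^sup>2)"
    unfolding divide_divide_eq_left[symmetric] by (simp_all add: power_mult_distrib)
  have "hat (d 0) l - hat (d 0) (- l) + 2 * \<i> * d 0 0 / of_real l = ?e l - ?e (- l)"
    "hat (d 0) l + hat (d 0) (- l) + 2 * d 1 0 / (of_real l)\<^sup>2 = ?e l + ?e (- l)"
    unfolding 1 by simp_all
  moreover have "norm (?e l - ?e (- l)) \<le> 2 * C / l ^ 3 + 2 * C / l ^ 3"
    by (rule order_trans[OF norm_triangle_ineq4 add_mono[OF e]])
  moreover have "norm (?e l + ?e (- l)) \<le> 2 * C / l ^ 3 + 2 * C / l ^ 3"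
    by (rule order_trans[OF norm_triangle_ineq add_mono[OF e]])
  ultimately show "norm (hat (d 0) l - hat (d 0) (- l) + 2 * \<i> * d 0 0 / of_real l) \<le> 4 * C / l ^ 3"
    "norm (hat (d 0) l + hat (d 0) (- l) + 2 * d 1 0 / (of_real l)\<^sup>2) \<le> 4 * C / l ^ 3"
    by (simp_all only:)
qed

section \<open>The solution formula on the half-line of positive frequencies\<close>

text \<open>All integrands of the formula that stem from initial values and sources have this form, with \<open>\<epsilon> = \<plusminus>
1\<close>.\<close>

definition data_integrand :: "real \<Rightarrow> (real \<Rightarrow> complex) \<Rightarrow> (real \<Rightarrow> complex) \<Rightarrow> complex \<Rightarrow> (real \<Rightarrow> complex) \<Rightarrow> (real \<Rightarrow>
    complex) \<Rightarrow> real \<Rightarrow> real \<Rightarrow> real \<Rightarrow> complex" where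
  "data_integrand m om om' \<epsilon> X1 X2 x t l =
     wave om x t l * (of_real l * X2 l + \<epsilon> * (\<i> * om' l + of_real m) * X1 l) / of_real (2 * rho m l)"

definition boundary_integrand :: "real \<Rightarrow> (real \<Rightarrow> complex) \<Rightarrow> (real \<Rightarrow> complex) \<Rightarrow> (real \<Rightarrow> complex) \<Rightarrow> real \<Rightarrow> real \<Rightarrow> real
    \<Rightarrow> complex" where
  "boundary_integrand m om u h x t l =
     wave om x t l * integral {0..t} (\<lambda>\<tau>. h \<tau> * exp (om l * of_real \<tau>)) * u l / of_real (rho m l)"

lemma data_integrand_signs:
  "data_integrand m om om' 1 X1 X2 x t =
     (\<lambda>l. wave om x t l * (of_real l * X2 l + (\<i> * om' l + of_real m) * X1 l) / of_real (2 * rho m l))"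
  "data_integrand m om om' (- 1) X1 X2 x t =
     (\<lambda>l. wave om x t l * (of_real l * X2 l - (\<i> * om' l + of_real m) * X1 l) / of_real (2 * rho m l))"
  by (simp_all add: data_integrand_def fun_eq_iff algebra_simps)

lemma om_signed: "om1 m l = \<i> * of_real (1 * rho m l)" "om2 m l = \<i> * of_real ((- 1) * rho m l)"
  by (simp_all add: om1_def om2_def)

lemma om_factor: "\<i> * om1 m l + of_real m = of_real m - of_real (rho m l)" "\<i> * om2 m l + of_real m = of_real m +
    of_real (rho m l)"
  by (simp_all add: om1_def om2_def)

lemma data_integrand_line_conv:
  assumes om: "om \<in> {om1 m, om2 m}" "om' \<in> {om1 m, om2 m}" and \<epsilon>: "\<epsilon> \<in> {1, -1}"
    and X: "\<exists>c. amplitude c X1" "\<exists>c. amplitude c X2" and xt: "0 < x" "0 < t" "x \<noteq> t"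
  shows "line_conv (data_integrand m om om' \<epsilon> X1 X2 x t)"
proof -
  obtain s where s: "\<bar>s\<bar> = 1" "\<And>l. om l = \<i> * of_real (s * rho m l)"
    using om(1) om_signed[of m] by (metis abs_1 abs_minus_cancel empty_iff insert_iff)
  obtain \<beta> where \<beta>: "\<And>l. \<i> * om' l + of_real m = \<beta> * of_real (rho m l) + of_real m"
    using om(2) om_factor[of m] by (metis (no_types, lifting) add.commute add_uminus_conv_diff empty_iff insert_iff
        mult_1 mult_minus1)
  obtain c1 c2 where amp: "amplitude c1 X1" "amplitude c2 X2" using X by blast
  have "norm (\<epsilon> * complex_of_real m) \<le> \<bar>m\<bar>" using \<epsilon> by (auto simp: norm_mult)
  from amplitude_line_conv[OF s(2,1) amp this xt, of "\<epsilon> * \<beta>"]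
  show ?thesis unfolding data_integrand_def[abs_def] \<beta> by (simp add: algebra_simps)
qed

lemma boundary_integrand_line_conv:
  assumes om: "om \<in> {om1 m, om2 m}"
    and h: "\<And>\<tau>. \<tau> \<in> {0..t} \<Longrightarrow> (h has_vector_derivative h' \<tau>) (at \<tau> within {0..t})"
      "\<And>\<tau>. \<tau> \<in> {0..t} \<Longrightarrow> (h' has_vector_derivative h'' \<tau>) (at \<tau> within {0..t})"
      "continuous_on {0..t} h''"
    and u: "u \<in> {of_real, \<lambda>l. \<i> * om l + of_real m}" and xt: "0 < x" "0 < t" "x \<noteq> t"
  shows "line_conv (boundary_integrand m om u h x t)"
proof -
  obtain s where s: "\<bar>s\<bar> = 1" "\<And>l. om l = \<i> * of_real (s * rho m l)"
    using om(1) om_signed[of m] by (metis abs_1 abs_minus_cancel empty_iff insert_iff)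
  have ne: "x - s * t \<noteq> 0" "- x - s * t \<noteq> 0" "x \<noteq> 0" "- x \<noteq> 0"
    using s(1) xt by (auto simp: abs_if split: if_splits)
  have t: "t \<ge> 0" using xt by simp
  obtain \<alpha> \<beta> \<kappa> where u': "\<And>l. u l = \<alpha> * of_real l + \<beta> * of_real (rho m l) + \<kappa>" "norm \<kappa> \<le> \<bar>m\<bar>"
  proof (cases "u = of_real")
    case True
    then show ?thesis by (intro that[of 1 0 0]) auto
  next
    case False
    then have "u = (\<lambda>l. \<i> * om l + of_real m)" using u by simp
    then show ?thesis by (intro that[of 0 "- of_real s" "of_real m"]) (auto simp: s(2))
  qed
  have exp: "integral {0..t} (\<lambda>\<tau>. h \<tau> * exp (om l * of_real \<tau>)) = integral {0..t} (\<lambda>\<tau>. cis (s * rho m l * \<tau>) * h \<tau>)"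
      for l
    by (simp add: s(2) cis_conv_exp mult.assoc mult.commute mult.left_commute)
  show ?thesis
    unfolding line_conv_def boundary_integrand_def exp u' wave_cis[of om, OF s(2)]
    using boundary_half_conv[OF t h s(1) u'(2) ne(3,1), of \<alpha> \<beta>]
      boundary_half_conv[OF t h s(1) u'(2) ne(4,2), of "- \<alpha>" \<beta>]
    by simp
qed

locale half_line_problem =
  fixes m :: real and g1 g2 h1 :: "real \<Rightarrow> complex" and f1 f2 :: "real \<times> real \<Rightarrow> complex"
  assumes g: "g1 \<in> schwartz_half" "g2 \<in> schwartz_half"
    and h: "smooth_half h1"
    and f1: "smooth_quadrant f1" "rapid_decay f1"
    and f2: "smooth_quadrant f2" "rapid_decay f2"
    and compat: "h1 0 = g1 0"
begin

text \<open>On the frequency side \<open>g1\<close> and \<open>f1\<close> are continued to the line as odd, \<open>g2\<close> and \<open>f2\<close> as even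
functions. The even continuation has a source at the boundary, which accounts for \<open>2 h1\<close>.\<close>

definition "odd_data l = hat g1 l - hat g1 (- l)"
definition "even_data l = hat g2 l + hat g2 (- l)"
definition "odd_source l \<tau> = hat (\<lambda>y. f1 (y, \<tau>)) l - hat (\<lambda>y. f1 (y, \<tau>)) (- l)"
definition "even_source l \<tau> = hat (\<lambda>y. f2 (y, \<tau>)) l + hat (\<lambda>y. f2 (y, \<tau>)) (- l) + 2 * h1 \<tau>"

lemma hat_source_continuous:
  assumes "smooth_quadrant f" "rapid_decay f"
  shows "continuous_on (UNIV \<times> {0..1}) (\<lambda>(l, \<tau>). hat (\<lambda>y. f (y, \<tau>)) l)"
    "continuous_on (UNIV \<times> {0..1}) (\<lambda>(l, \<tau>). hat (\<lambda>y. f (y, \<tau>)) (- l))"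
proof -
  obtain C where C: "\<forall>\<tau>\<in>{0..1}. decaying_derivs C (\<lambda>n y. (pdx quadrant ^^ n) f (y, \<tau>))"
    using rapid_decaying[OF assms] by blast
  show 1: "continuous_on (UNIV \<times> {0..1}) (\<lambda>(l, \<tau>). hat (\<lambda>y. f (y, \<tau>)) l)"
  proof (rule hat_continuous_on[where f = "\<lambda>\<tau> y. f (y, \<tau>)" and C = C])
    show "continuous_on ({0..1} \<times> {0..}) (\<lambda>(\<tau>, y). f (y, \<tau>))"
      unfolding split_def
      by (intro continuous_on_compose2[OF smooth_quadrantD(1)[OF assms(1)]] continuous_intros) (auto simp:
          quadrant_def)
    show "norm (f (y, \<tau>)) \<le> C / (1 + y)\<^sup>2" if "\<tau> \<in> {0..1}" "y \<ge> 0" for y \<tau>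
      using C that unfolding decaying_derivs_def by (metis funpow_0 le0)
  qed
  have "continuous_on (UNIV \<times> {0..1}) (\<lambda>p. (- fst p, snd p) :: real \<times> real)" by (intro continuous_intros)
  from continuous_on_compose2[OF 1 this]
  show "continuous_on (UNIV \<times> {0..1}) (\<lambda>(l, \<tau>). hat (\<lambda>y. f (y, \<tau>)) (- l))" by (force simp: split_def)
qed

lemma hat_source_continuous1:
  assumes "smooth_quadrant f" "rapid_decay f" "t \<le> 1"
  shows "continuous_on {0..t} (\<lambda>\<tau>. hat (\<lambda>y. f (y, \<tau>)) l)"
  using continuous_on_compose2[OF hat_source_continuous(1)[OF assms(1,2)], of "{0..t}" "\<lambda>\<tau>. (l, \<tau>)"] assms(3)
  by (force intro: continuous_intros)

lemma hat_data_amplitude: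
  assumes "g \<in> schwartz_half"
  shows "\<exists>c. amplitude c (hat g)" "\<exists>c. amplitude c (\<lambda>l. hat g (- l))"
proof -
  obtain C where "decaying_derivs C (\<lambda>n. (half_deriv ^^ n) g)" using schwartz_decaying[OF assms] by blast
  from hat_amplitude[OF this] show 1: "\<exists>c. amplitude c (hat g)" by auto
  then show "\<exists>c. amplitude c (\<lambda>l. hat g (- l))" using amplitude_reflect by blast
qed

lemma tilde_hat_source_amplitude:
  assumes f: "smooth_quadrant f" "rapid_decay f" and om: "om \<in> {om1 m, om2 m}" and t: "0 < t" "t < 1"
  shows "\<exists>c. amplitude c (\<lambda>l. tilde_hat f l (om l) t)" "\<exists>c. amplitude c (\<lambda>l. tilde_hat f (- l) (om l) t)"
proof -
  obtain C where C: "\<forall>\<tau>\<in>{0..1}. decaying_derivs C (\<lambda>n y. (pdx quadrant ^^ n) f (y, \<tau>))"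
    using rapid_decaying[OF f] by blast
  obtain s where s: "\<bar>s\<bar> = 1" "\<And>l. om l = \<i> * of_real (s * rho m l)"
    using om(1) om_signed[of m] by (metis abs_1 abs_minus_cancel empty_iff insert_iff)
  have "amplitude 0 (\<lambda>l. tilde_hat f l (om l) t)"
  proof (rule tilde_hat_amplitude[OF _ _ _ _ _ s(2,1)])
    show "decaying_derivs C (\<lambda>n y. (pdx quadrant ^^ n) f (y, \<tau>))" if "\<tau> \<in> {0..t}" for \<tau>
      using C that t by auto
    show "continuous_on ({0..} \<times> {0..t}) f"
      by (rule continuous_on_subset[OF smooth_quadrantD(1)[OF f(1)]]) (auto simp: quadrant_def)
    show "((\<lambda>\<tau>. f (0, \<tau>)) has_vector_derivative pdt quadrant f (0, \<tau>)) (at \<tau> within {0..t})" if "\<tau> \<in> {0..t}" for \<tau>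
      by (rule has_vector_derivative_within_subset[OF smooth_quadrantD(5)[OF f(1)]]) (use that in auto)
    show "continuous_on {0..t} (\<lambda>\<tau>. pdt quadrant f (0, \<tau>))"
      by (intro continuous_on_compose2[OF smooth_quadrantD(1)[OF smooth_quadrantD(3)[OF f(1)]]] continuous_intros)
         (auto simp: quadrant_def)
  qed (use t in auto)
  moreover from amplitude_reflect[OF this] have "amplitude (- 0) (\<lambda>l. tilde_hat f (- l) (om l) t)"
    using s(2) by simp
  ultimately show "\<exists>c. amplitude c (\<lambda>l. tilde_hat f l (om l) t)" "\<exists>c. amplitude c (\<lambda>l. tilde_hat f (- l) (om l) t)"
    by blast+
qed

lemma data_asymptotics:
  "\<exists>C. half_line_data odd_data even_data odd_source even_source (\<lambda>k \<tau>. 2 * (half_deriv ^^ k) h1 \<tau>)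
     (\<lambda>k \<tau>. - 2 * \<i> * (pdt quadrant ^^ k) f1 (0, \<tau>))
     (\<lambda>k \<tau>. - 2 * (pdt quadrant ^^ k) (pdx quadrant f2) (0, \<tau>)) (- 2 * half_deriv g2 0) C"
proof -
  obtain C1 C2 where C12: "decaying_derivs C1 (\<lambda>n. (half_deriv ^^ n) g1)" "decaying_derivs C2 (\<lambda>n. (half_deriv ^^ n)
      g2)"
    using schwartz_decaying g by blast
  obtain D1 D2 where D12: "\<forall>\<tau>\<in>{0..1}. decaying_derivs D1 (\<lambda>n y. (pdx quadrant ^^ n) f1 (y, \<tau>))"
     "\<forall>\<tau>\<in>{0..1}. decaying_derivs D2 (\<lambda>n y. (pdx quadrant ^^ n) f2 (y, \<tau>))"
    using rapid_decaying f1 f2 by meson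
  define C where "C = 4 * max (max C1 C2) (max D1 D2)"
  have C: "4 * c / l ^ 3 \<le> C / l ^ 3" if "c \<in> {C1, C2, D1, D2}" "l \<ge> 1" for c l :: real
    using that by (intro divide_right_mono) (auto simp: C_def)
  have h': "((\<lambda>\<tau>. 2 * (half_deriv ^^ k) h1 \<tau>) has_vector_derivative 2 * (half_deriv ^^ Suc k) h1 \<tau>) (at \<tau> within
      {0..1})" if "\<tau> \<in> {0..1}" for k \<tau>
    by (intro has_vector_derivative_mult_right has_vector_derivative_within_subset[OF smooth_half_deriv[OF h]]) (use
        that in auto)
  have t': "((\<lambda>\<tau>. c * (pdt quadrant ^^ k) F (0, \<tau>)) has_vector_derivative c * (pdt quadrant ^^ Suc k) F (0, \<tau>)) (at \<tau>
      within {0..1})"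
    if "smooth_quadrant F" "\<tau> \<in> {0..1}" for F k \<tau> and c :: complex
  proof -
    have "((\<lambda>\<tau>. (pdt quadrant ^^ k) F (0, \<tau>)) has_vector_derivative (pdt quadrant ^^ Suc k) F (0, \<tau>)) (at \<tau> within
        {0..})"
      using smooth_quadrantD(5)[OF smooth_quadrant_funpow(2)[OF that(1), of k], of 0 \<tau>] that(2) by simp
    then show ?thesis
      by (intro has_vector_derivative_mult_right) (rule has_vector_derivative_within_subset, auto)
  qed
  have hc: "continuous_on {0..1} h1"
    by (rule continuous_on_vector_derivative[of _ _ "half_deriv h1"])
       (use has_vector_derivative_within_subset[OF smooth_half_deriv[OF h, of _ 0]] in auto)
  have hatc: "continuous_on UNIV (hat g)" "continuous_on UNIV (\<lambda>l. hat g (- l))" if "g \<in> schwartz_half" for g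
    using hat_data_amplitude[OF that] by (auto simp: amplitude_def)
  have "half_line_data odd_data even_data odd_source even_source (\<lambda>k \<tau>. 2 * (half_deriv ^^ k) h1 \<tau>)
     (\<lambda>k \<tau>. - 2 * \<i> * (pdt quadrant ^^ k) f1 (0, \<tau>))
     (\<lambda>k \<tau>. - 2 * (pdt quadrant ^^ k) (pdx quadrant f2) (0, \<tau>)) (- 2 * half_deriv g2 0) C"
  proof
    show "continuous_on UNIV odd_data" "continuous_on UNIV even_data"
      unfolding odd_data_def[abs_def] even_data_def[abs_def] by (intro continuous_intros hatc g)+
    have "continuous_on (UNIV \<times> {0..1}) (\<lambda>p::real \<times> real. h1 (snd p))"
      by (intro continuous_on_compose2[OF hc] continuous_intros) auto
    then show "continuous_on (UNIV \<times> {0..1}) (\<lambda>(l, \<tau>). odd_source l \<tau>)" "continuous_on (UNIV \<times> {0..1}) (\<lambda>(l, \<tau>).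
        even_source l \<tau>)"
      unfolding odd_source_def even_source_def split_def
      by (intro continuous_on_add continuous_on_diff continuous_on_mult continuous_on_const
            hat_source_continuous[unfolded split_def] f1 f2; assumption)+
    fix l :: real assume l: "l \<ge> 1"
    show "norm (odd_data l + \<i> * (2 * (half_deriv ^^ 0) h1 0) / of_real l) \<le> C / l ^ 3"
      using hat_parity(1)[OF C12(1) l] C[of C1, OF _ l] by (simp add: odd_data_def compat mult.left_commute
          mult.assoc)
    show "norm (even_data l - (- 2 * half_deriv g2 0) / (of_real l)\<^sup>2) \<le> C / l ^ 3"
      using hat_parity(2)[OF C12(2) l] C[of C2, OF _ l] by (simp add: even_data_def)
    fix \<tau> :: real assume \<tau>: "\<tau> \<in> {0..1}"
    show "norm (odd_source l \<tau> - (- 2 * \<i> * (pdt quadrant ^^ 0) f1 (0, \<tau>)) / of_real l) \<le> C / l ^ 3"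
      using hat_parity(1)[OF D12(1)[rule_format, OF \<tau>] l] C[of D1, OF _ l] by (simp add: odd_source_def)
    show "norm (even_source l \<tau> - (2 * (half_deriv ^^ 0) h1 \<tau> + (- 2 * (pdt quadrant ^^ 0) (pdx quadrant f2) (0, \<tau>))
        / (of_real l)\<^sup>2)) \<le> C / l ^ 3"
      using hat_parity(2)[OF D12(2)[rule_format, OF \<tau>] l] C[of D2, OF _ l] by (simp add: even_source_def add.assoc)
  qed (rule h' t' f1 smooth_quadrantD(2)[OF f2(1)]; assumption?)+
  then show ?thesis by blast
qed


lemma boundary_line_conv:
  assumes "om \<in> {om1 m, om2 m}" "u \<in> {of_real, \<lambda>l. \<i> * om l + of_real m}" "0 < x" "0 < t" "x \<noteq> t"
  shows "line_conv (boundary_integrand m om u h1 x t)"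
proof -
  have d: "((half_deriv ^^ n) h1 has_vector_derivative (half_deriv ^^ Suc n) h1 \<tau>) (at \<tau> within {0..t})" if "\<tau> \<in>
      {0..t}" for n \<tau>
    by (rule has_vector_derivative_within_subset[OF smooth_half_deriv[OF h]]) (use that in auto)
  show ?thesis
  proof (rule boundary_integrand_line_conv[OF assms(1) _ _ _ assms(2-5)])
    show "(h1 has_vector_derivative (half_deriv ^^ 1) h1 \<tau>) (at \<tau> within {0..t})" if "\<tau> \<in> {0..t}" for \<tau>
      using d[OF that, of 0] by simp
    show "((half_deriv ^^ 1) h1 has_vector_derivative (half_deriv ^^ 2) h1 \<tau>) (at \<tau> within {0..t})" if "\<tau> \<in> {0..t}"
        for \<tau>
      using d[OF that, of 1] by (simp add: numeral_2_eq_2)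
    show "continuous_on {0..t} ((half_deriv ^^ 2) h1)"
      by (rule continuous_on_vector_derivative) (rule d)
  qed
qed

text \<open>The integrands of all the integrals in the definitions of \<^const>\<open>Psi1\<close> and \<^const>\<open>Psi2\<close>, added with their
signs.\<close>

definition "integrand1 x t l =
     data_integrand m (om1 m) (om2 m) 1 (hat g1) (hat g2) x t l
   + data_integrand m (om1 m) (om2 m) (-1) (\<lambda>l. hat g1 (- l)) (\<lambda>l. hat g2 (- l)) x t l
   - data_integrand m (om2 m) (om1 m) 1 (hat g1) (hat g2) x t l
   - data_integrand m (om2 m) (om1 m) (-1) (\<lambda>l. hat g1 (- l)) (\<lambda>l. hat g2 (- l)) x t l
   + boundary_integrand m (om1 m) of_real h1 x t l
   - boundary_integrand m (om2 m) of_real h1 x t l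
   + (data_integrand m (om1 m) (om2 m) 1 (\<lambda>l. tilde_hat f1 l (om1 m l) t) (\<lambda>l. tilde_hat f2 l (om1 m l) t) x t l
    + data_integrand m (om1 m) (om2 m) (-1) (\<lambda>l. tilde_hat f1 (- l) (om1 m l) t) (\<lambda>l. tilde_hat f2 (- l) (om1 m l) t)
        x t l)
   - (data_integrand m (om2 m) (om1 m) 1 (\<lambda>l. tilde_hat f1 l (om2 m l) t) (\<lambda>l. tilde_hat f2 l (om2 m l) t) x t l
    + data_integrand m (om2 m) (om1 m) (-1) (\<lambda>l. tilde_hat f1 (- l) (om2 m l) t) (\<lambda>l. tilde_hat f2 (- l) (om2 m l) t)
        x t l)"

definition "integrand2 x t l =
     data_integrand m (om1 m) (om1 m) (-1) (hat g2) (hat g1) x t l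
   - data_integrand m (om1 m) (om1 m) 1 (\<lambda>l. hat g2 (- l)) (\<lambda>l. hat g1 (- l)) x t l
   - data_integrand m (om2 m) (om2 m) (-1) (hat g2) (hat g1) x t l
   + data_integrand m (om2 m) (om2 m) 1 (\<lambda>l. hat g2 (- l)) (\<lambda>l. hat g1 (- l)) x t l
   - boundary_integrand m (om1 m) (\<lambda>l. \<i> * om1 m l + of_real m) h1 x t l
   + boundary_integrand m (om2 m) (\<lambda>l. \<i> * om2 m l + of_real m) h1 x t l
   + (data_integrand m (om1 m) (om1 m) (-1) (\<lambda>l. tilde_hat f2 l (om1 m l) t) (\<lambda>l. tilde_hat f1 l (om1 m l) t) x t l
    - data_integrand m (om1 m) (om1 m) 1 (\<lambda>l. tilde_hat f2 (- l) (om1 m l) t) (\<lambda>l. tilde_hat f1 (- l) (om1 m l) t) x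
        t l)
   - (data_integrand m (om2 m) (om2 m) (-1) (\<lambda>l. tilde_hat f2 l (om2 m l) t) (\<lambda>l. tilde_hat f1 l (om2 m l) t) x t l
    - data_integrand m (om2 m) (om2 m) 1 (\<lambda>l. tilde_hat f2 (- l) (om2 m l) t) (\<lambda>l. tilde_hat f1 (- l) (om2 m l) t) x
        t l)"

lemma Psi_gen_integral:
  assumes xt: "0 < x" "0 < t" "t < 1" "x \<noteq> t"
  shows "line_conv (integrand1 x t)" "gen_integral (integrand1 x t) = 2 * pi * Psi1 m g1 g2 h1 f1 f2 x t"
    and "line_conv (integrand2 x t)" "gen_integral (integrand2 x t) = 2 * pi * Psi2 m g1 g2 h1 f1 f2 x t"
proof -
  note amp = hat_data_amplitude[OF g(1)] hat_data_amplitude[OF g(2)]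
    tilde_hat_source_amplitude[OF f1 _ xt(2,3), of "om1 m"] tilde_hat_source_amplitude[OF f1 _ xt(2,3), of "om2 m"]
    tilde_hat_source_amplitude[OF f2 _ xt(2,3), of "om1 m"] tilde_hat_source_amplitude[OF f2 _ xt(2,3), of "om2 m"]
  note amp' = amp[simplified]
  have conv: "line_conv (data_integrand m om om' \<epsilon> X1 X2 x t)"
    if "om \<in> {om1 m, om2 m}" "om' \<in> {om1 m, om2 m}" "\<epsilon> \<in> {1, -1}" "\<exists>c. amplitude c X1" "\<exists>c. amplitude c X2" for om
        om' \<epsilon> X1 X2
    by (rule data_integrand_line_conv[OF that xt(1,2,4)])
  have bconv: "line_conv (boundary_integrand m (om1 m) of_real h1 x t)" "line_conv (boundary_integrand m (om2 m)
      of_real h1 x t)"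
    "line_conv (boundary_integrand m (om1 m) (\<lambda>l. \<i> * om1 m l + of_real m) h1 x t)"
    "line_conv (boundary_integrand m (om2 m) (\<lambda>l. \<i> * om2 m l + of_real m) h1 x t)"
    by (rule boundary_line_conv; use xt in simp)+
  note C = line_conv_add line_conv_diff conv bconv amp'
  note defs = G11_def G12_def G13_def G14_def G21_def G22_def G23_def G24_def H1_def H2_def
    F11_def F12_def F21_def F22_def data_integrand_signs boundary_integrand_def[abs_def]
  show "line_conv (integrand1 x t)" "line_conv (integrand2 x t)"
    unfolding integrand1_def[abs_def] integrand2_def[abs_def] by (intro C; simp)+
  show "gen_integral (integrand1 x t) = 2 * pi * Psi1 m g1 g2 h1 f1 f2 x t"
    unfolding integrand1_def[abs_def]
    by (simp add: gen_integral_add gen_integral_diff C, simp add: Psi1_def defs)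
  show "gen_integral (integrand2 x t) = 2 * pi * Psi2 m g1 g2 h1 f1 f2 x t"
    unfolding integrand2_def[abs_def]
    by (simp add: gen_integral_add gen_integral_diff C, simp add: Psi2_def defs)
qed

lemma source_integral:
  assumes "smooth_quadrant f" "rapid_decay f" "t \<le> 1"
  shows "(\<lambda>\<tau>. cis (s * rho m l * \<tau>) * hat (\<lambda>y. f (y, \<tau>)) k) integrable_on {0..t}"
  by (intro integrable_continuous_real continuous_intros hat_source_continuous1 assms)

lemma duhamel_integrals:
  assumes t: "0 < t" "t < 1" and s: "\<And>l. om l = \<i> * of_real (s * rho m l)"
  shows "integral {0..t} (\<lambda>\<tau>. cis (s * rho m l * \<tau>) * odd_source l \<tau>) = tilde_hat f1 l (om l) t - tilde_hat f1 (- l)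
      (om l) t"
    and "integral {0..t} (\<lambda>\<tau>. cis (s * rho m l * \<tau>) * even_source l \<tau>) = tilde_hat f2 l (om l) t + tilde_hat f2 (- l)
        (om l) t
       + 2 * integral {0..t} (\<lambda>\<tau>. h1 \<tau> * exp (om l * of_real \<tau>))"
proof -
  have e: "exp (om l * of_real \<tau>) = cis (s * rho m l * \<tau>)" for \<tau>
    by (simp add: s cis_conv_exp mult.assoc)
  have i1: "(\<lambda>\<tau>. cis (s * rho m l * \<tau>) * hat (\<lambda>y. f1 (y, \<tau>)) k) integrable_on {0..t}" for k
    by (rule source_integral[OF f1]) (use t in simp)
  have i2: "(\<lambda>\<tau>. cis (s * rho m l * \<tau>) * hat (\<lambda>y. f2 (y, \<tau>)) k) integrable_on {0..t}" for k
    by (rule source_integral[OF f2]) (use t in simp)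
  have "continuous_on {0..t} h1"
    by (rule continuous_on_vector_derivative[of _ _ "half_deriv h1"])
       (use has_vector_derivative_within_subset[OF smooth_half_deriv[OF h, of _ 0]] in auto)
  then have i3: "(\<lambda>\<tau>. h1 \<tau> * cis (s * rho m l * \<tau>)) integrable_on {0..t}"
    by (intro integrable_continuous_real continuous_intros)
  show "integral {0..t} (\<lambda>\<tau>. cis (s * rho m l * \<tau>) * odd_source l \<tau>) = tilde_hat f1 l (om l) t - tilde_hat f1 (- l)
      (om l) t"
    unfolding tilde_hat_def e integral_diff[OF i1 i1, symmetric] odd_source_def by (simp add: right_diff_distrib)
  have "integral {0..t} (\<lambda>\<tau>. cis (s * rho m l * \<tau>) * even_source l \<tau>)
    = integral {0..t} (\<lambda>\<tau>. (cis (s * rho m l * \<tau>) * hat (\<lambda>y. f2 (y, \<tau>)) l + cis (s * rho m l * \<tau>) * hat (\<lambda>y. f2 (y,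
        \<tau>)) (- l))
       + 2 * (h1 \<tau> * cis (s * rho m l * \<tau>)))"
    by (simp add: even_source_def algebra_simps)
  also have "\<dots> = (integral {0..t} (\<lambda>\<tau>. cis (s * rho m l * \<tau>) * hat (\<lambda>y. f2 (y, \<tau>)) l)
       + integral {0..t} (\<lambda>\<tau>. cis (s * rho m l * \<tau>) * hat (\<lambda>y. f2 (y, \<tau>)) (- l)))
       + 2 * integral {0..t} (\<lambda>\<tau>. h1 \<tau> * cis (s * rho m l * \<tau>))"
    unfolding integral_add[OF integrable_add[OF i2 i2] integrable_on_mult_right[OF i3]] integral_add[OF i2 i2] by simp
  finally show "integral {0..t} (\<lambda>\<tau>. cis (s * rho m l * \<tau>) * even_source l \<tau>) = tilde_hat f2 l (om l) t + tilde_hat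
      f2 (- l) (om l) t
       + 2 * integral {0..t} (\<lambda>\<tau>. h1 \<tau> * exp (om l * of_real \<tau>))"
    unfolding tilde_hat_def e .
qed

lemma wave_signed:
  "wave (om1 m) x t l = cis (l * x) * cis (- (rho m l * t))" "wave (om2 m) x t l = cis (l * x) * cis (rho m l * t)"
  unfolding wave_cis[of "om1 m", OF om_signed(1)] wave_cis[of "om2 m", OF om_signed(2)] cis_mult by simp_all

lemma om_even: "om1 m (- l) = om1 m l" "om2 m (- l) = om2 m l"
  by (simp_all add: om1_def om2_def)

text \<open>After summation the integrands are the plane wave \<open>cis (l x)\<close> times the solution of the system,
which for the first component is odd and for the second even in \<open>l\<close>. Both sides are polynomials in
the transforms of the data, so comparing coefficients suffices.\<close>

lemma total_amplitude:
  assumes l: "l > 0" and t: "0 < t" "t < 1"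
  shows "integrand1 x t l = cis (l * x) * duhamel m (odd_data l) (even_data l) (odd_source l) (even_source l) l t"
    and "integrand1 x t (- l) = - cis (- (l * x)) * duhamel m (odd_data l) (even_data l) (odd_source l) (even_source
        l) l t"
    and "integrand2 x t l = cis (l * x) * duhamel (- m) (even_data l) (odd_data l) (even_source l) (odd_source l) l t"
    and "integrand2 x t (- l) = cis (- (l * x)) * duhamel (- m) (even_data l) (odd_data l) (even_source l)
        (odd_source l) l t"
proof -
  define w where "w = inverse (complex_of_real (2 * rho m l))"
  have w: "inverse (complex_of_real (rho m l)) = 2 * w" by (simp add: w_def)
  note D = duhamel_integrals[OF t om_signed(1), of l] duhamel_integrals[OF t om_signed(2), of l]
  note U = integrand1_def integrand2_def data_integrand_def boundary_integrand_def
     om_even rho_minus om_factor wave_signed odd_data_def even_data_def minus_minus mult_minus_left of_real_minus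
         divide_inverse w w_def[symmetric] of_real_add of_real_diff
  show "integrand1 x t l = cis (l * x) * duhamel m (odd_data l) (even_data l) (odd_source l) (even_source l) l t"
    unfolding duhamel_def Let_def rho_minus_mass D unfolding U by (simp add: algebra_simps)
  show "integrand1 x t (- l) = - cis (- (l * x)) * duhamel m (odd_data l) (even_data l) (odd_source l) (even_source
      l) l t"
    unfolding duhamel_def Let_def rho_minus_mass D unfolding U by (simp add: algebra_simps)
  show "integrand2 x t l = cis (l * x) * duhamel (- m) (even_data l) (odd_data l) (even_source l) (odd_source l) l t"
    unfolding duhamel_def Let_def rho_minus_mass D unfolding U by (simp add: algebra_simps)
  show "integrand2 x t (- l) = cis (- (l * x)) * duhamel (- m) (even_data l) (odd_data l) (even_source l) (odd_source
      l) l t"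
    unfolding duhamel_def Let_def rho_minus_mass D unfolding U by (simp add: algebra_simps)
qed


text \<open>The point \<open>l = 0\<close> is excluded because the integrands of the massless case divide by zero there; the
integrals do not see it.\<close>

lemma half_line_limit:
  assumes T: "line_conv T" and F: "\<And>l. l > 0 \<Longrightarrow> T l + T (- l) = c * F l" and c: "c \<noteq> 0"
  shows "F integrable_on {0..A}" "((\<lambda>A. integral {0..A} F) \<longlongrightarrow> gen_integral T / c) at_top"
proof -
  have int: "(\<lambda>l. T l + T (- l)) integrable_on {0..A}" for A
    using T by (intro integrable_add) (auto simp: line_conv_def half_conv_def)
  have F': "F l = (T l + T (- l)) / c" if "l \<in> {0..A} - {0}" for l A
    using F[of l] that c by auto
  have "(\<lambda>l. (T l + T (- l)) / c) integrable_on {0..A}" for A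
    using int by (rule integrable_on_divide)
  then show "F integrable_on {0..A}" for A
    by (rule integrable_spike[of _ _ "{0}"]) (use F' in auto)
  have "integral {0..A} F = integral {0..A} (\<lambda>l. T l + T (- l)) / c" for A
    unfolding integral_divide[symmetric] by (rule integral_spike[of "{0}"]) (use F' in auto)
  then show "((\<lambda>A. integral {0..A} F) \<longlongrightarrow> gen_integral T / c) at_top"
    using tendsto_divide[OF gen_integral_tendsto[OF T] tendsto_const c] by simp
qed

lemma Psi_corner_C1:
  assumes \<Omega>: "open \<Omega>" "\<Omega> \<subseteq> {0<..<1} \<times> {0<..<1}" "\<And>x t. (x, t) \<in> \<Omega> \<Longrightarrow> \<bar>x - t\<bar> = \<epsilon> * (x - t)"
    and off: "\<And>x t. (x, t) \<in> \<Omega> \<Longrightarrow> x \<noteq> t"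
  shows "corner_C1 \<Omega> (Psi1 m g1 g2 h1 f1 f2)" "corner_C1 \<Omega> (Psi2 m g1 g2 h1 f1 f2)"
proof -
  obtain C where C: "half_line_data odd_data even_data odd_source even_source (\<lambda>k \<tau>. 2 * (half_deriv ^^ k) h1 \<tau>)
     (\<lambda>k \<tau>. - 2 * \<i> * (pdt quadrant ^^ k) f1 (0, \<tau>))
     (\<lambda>k \<tau>. - 2 * (pdt quadrant ^^ k) (pdx quadrant f2) (0, \<tau>)) (- 2 * half_deriv g2 0) C"
    using data_asymptotics by blast
  interpret D: half_line_data m odd_data even_data odd_source even_source "\<lambda>k \<tau>. 2 * (half_deriv ^^ k) h1 \<tau>"
     "\<lambda>k \<tau>. - 2 * \<i> * (pdt quadrant ^^ k) f1 (0, \<tau>)"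
     "\<lambda>k \<tau>. - 2 * (pdt quadrant ^^ k) (pdx quadrant f2) (0, \<tau>)" "- 2 * half_deriv g2 0" C
    by (rule C)
  have xt: "0 < x" "0 < t" "t < 1" "x \<noteq> t" if "(x, t) \<in> \<Omega>" for x t
    using \<Omega>(2) off that by auto
  have s: "integrand1 x t l + integrand1 x t (- l) = (2 * \<i>) * (of_real (sin (l * x)) * D.Amp1 l t)" if "(x, t) \<in> \<Omega>"
      "l > 0" for x t l
  proof -
    have "cis (l * x) - cis (- (l * x)) = 2 * \<i> * of_real (sin (l * x))" by (simp add: complex_eq_iff)
    then have "cis (l * x) * D.Amp1 l t - cis (- (l * x)) * D.Amp1 l t = 2 * \<i> * of_real (sin (l * x)) * D.Amp1 l t"
      by (simp flip: left_diff_distrib)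
    then show ?thesis
      using total_amplitude(1,2)[OF that(2) xt(2,3)[OF that(1)]] by (simp add: D.Amp1_def mult.assoc)
  qed
  have c: "integrand2 x t l + integrand2 x t (- l) = 2 * (of_real (cos (l * x)) * D.Amp2 l t)" if "(x, t) \<in> \<Omega>" "l >
      0" for x t l
  proof -
    have "cis (l * x) + cis (- (l * x)) = 2 * of_real (cos (l * x))" by (simp add: complex_eq_iff)
    then have "cis (l * x) * D.Amp2 l t + cis (- (l * x)) * D.Amp2 l t = 2 * of_real (cos (l * x)) * D.Amp2 l t"
      by (simp flip: distrib_right)
    then show ?thesis
      using total_amplitude(3,4)[OF that(2) xt(2,3)[OF that(1)]] by (simp add: D.Amp2_def mult.assoc)
  qed
  have "corner_C1 \<Omega> (\<lambda>x t. gen_integral (integrand1 x t) / (2 * \<i>))"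
    by (rule D.corner_C1_sine_transform[OF \<Omega>])
       (use half_line_limit[OF Psi_gen_integral(1)[OF xt] s] in auto)
  from corner_C1_cmult[OF this, of "\<i> / of_real pi"]
  show "corner_C1 \<Omega> (Psi1 m g1 g2 h1 f1 f2)"
    by (rule corner_C1_cong[OF _ \<Omega>(1)]) (simp add: Psi_gen_integral(2)[OF xt])
  have "corner_C1 \<Omega> (\<lambda>x t. gen_integral (integrand2 x t) / 2)"
    by (rule D.corner_C1_cosine_transform[OF \<Omega>])
       (use half_line_limit[OF Psi_gen_integral(3)[OF xt] c] in auto)
  from corner_C1_cmult[OF this, of "1 / of_real pi"]
  show "corner_C1 \<Omega> (Psi2 m g1 g2 h1 f1 f2)"
    by (rule corner_C1_cong[OF _ \<Omega>(1)]) (simp add: Psi_gen_integral(4)[OF xt])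
qed

end

theorem proposition2:
  fixes m :: real
    and g1 g2 h1 :: "real \<Rightarrow> complex"
    and f1 f2 \<Psi>1 \<Psi>2 :: "real \<times> real \<Rightarrow> complex"
  assumes "m \<ge> 0"
    and "g1 \<in> schwartz_half" and "g2 \<in> schwartz_half"
    and "smooth_half h1"
    and "smooth_quadrant f1" and "rapid_decay f1"
    and "smooth_quadrant f2" and "rapid_decay f2"
    and "h1 0 = g1 0"
    and "half_deriv h1 0 = - half_deriv g2 0 + f1 (0, 0)"
    and "C1_extension (Psi1 m g1 g2 h1 f1 f2) \<Psi>1"
    and "C1_extension (Psi2 m g1 g2 h1 f1 f2) \<Psi>2"
  shows "\<forall>\<Psi>\<in>{\<Psi>1, \<Psi>2}. \<forall>D\<in>{pdx (quadrant - {(0, 0)}) \<Psi>, pdt (quadrant - {(0, 0)}) \<Psi>}.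
           \<exists>L. (D \<longlongrightarrow> L) (at (0, 0) within (quadrant - {(0, 0)})) \<and>
               continuous_on quadrant (D((0, 0) := L))"
proof -
  interpret half_line_problem m g1 g2 h1 f1 f2
    by unfold_locales (fact assms)+
  note below = Psi_corner_C1[OF diagonal_regions(1,3,5)] and above = Psi_corner_C1[OF diagonal_regions(2,4,6)]
  have reg: "x \<noteq> t" if "(x, t) \<in> below_diagonal \<or> (x, t) \<in> above_diagonal" for x t
    using that by (auto simp: below_diagonal_def above_diagonal_def)
  show ?thesis
  proof (intro ballI)
    fix \<Psi> D assume \<Psi>: "\<Psi> \<in> {\<Psi>1, \<Psi>2}" and D: "D \<in> {pdx punctured \<Psi>, pdt punctured \<Psi>}"
    show "\<exists>L. (D \<longlongrightarrow> L) (at (0, 0) within punctured) \<and> continuous_on quadrant (D((0, 0) := L))"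
      using \<Psi>
    proof (elim insertE emptyE)
      assume "\<Psi> = \<Psi>1"
      then show ?thesis
        using extension_gradient_limits[OF assms(11) below(1) above(1)] D reg by blast
    next
      assume "\<Psi> = \<Psi>2"
      then show ?thesis
        using extension_gradient_limits[OF assms(12) below(2) above(2)] D reg by blast
    qed
  qed
qed

end
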